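(* Let $(A,\Delta)$ be an algebraic quantum group and $(X,\alpha)$ a right $A$-Galois object, and let $\varphi_X$ be the functional on $X$ determined by $(\iota\otimes\varphi)(\alpha(x))=\varphi_X(x)1$. Then there exists an (algebra) automorphism $\sigma_X$ of $X$ such that $\varphi_X(y\sigma_X(x))=\varphi_X(xy)$ for all $x,y\in X$. Furthermore, $\varphi_X\circ\sigma_X=\varphi_X$.
   Context: Conventions: $k$ is a field; all algebras are $k$-algebras, non-zero, possibly without unit, and non-degenerate ($ab=0$ for all $b$ implies $a=0$, and $ab=0$ for all $a$ implies $b=0$). $M(X)$ is the multiplier algebra of $X$, with $X\subseteq M(X)$ and $k=k\cdot 1\subseteq M(X)$; $\otimes$ is over $k$; $\iota$ is the identity map; functionals are linear. A regular multiplier Hopf algebra is a pair $(A,\Delta)$ with $A$ an algebra and $\Delta:A\to M(A\otimes A)$ a coassociative homomorphism which is non-degenerate ($\Delta(A)(A\otimes A)=A\otimes A=(A\otimes A)\Delta(A)$) and such that the maps sending $a\otimes b$ to $\Delta(a)(1\otimes b)$, $(a\otimes 1)\Delta(b)$, $\Delta(a)(b\otimes 1)$, $(1\otimes a)\Delta(b)$ are all bijections of $A\otimes A$ onto $A\otimes A$. An algebraic quantum group is a regular multiplier Hopf algebra with a non-zero functional $\varphi$ (the left invariant functional, faithful and unique up to scalar; a choice is fixed) such that $(\iota\otimes\varphi)(\Delta(a)(b\otimes 1))=\varphi(a)b$ for all $a,b\in A$. A right coaction of $A$ on an algebra $X$ is an injective homomorphism $\alpha:X\to M(X\otimes A)$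 with $\alpha(X)(1\otimes A)\subseteq X\otimes A$, $(1\otimes A)\alpha(X)\subseteq X\otimes A$ and $(\alpha\otimes\iota)\alpha=(\iota\otimes\Delta)\alpha$; it extends canonically to $M(X)\to M(X\otimes A)$. It is reduced if also $(X\otimes 1)\alpha(X)\subseteq X\otimes A$ (then also $\alpha(X)(X\otimes 1)\subseteq X\otimes A$). The coinvariants are the $f\in M(X)$ with $\alpha(f)=f\otimes 1$. $(X,\alpha)$ is a right $A$-Galois object if $\alpha$ is a reduced right coaction, the algebra of coinvariants is $k$, and $V:X\otimes X\to X\otimes A$, $x\otimes y\mapsto (x\otimes 1)\alpha(y)$, is bijective. $(\iota\otimes\varphi)(\alpha(x))$ is a multiplier of $X$ which is a scalar (it is coinvariant), so $\varphi_X$ is well defined. *)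

theory Defs
  imports Complex_Main
begin

text \<open>
  A \<open>k\<close>-algebra is a type of class \<^class>\<open>ring\<close> (rings without unit) together with a scalar
  multiplication. Tensor products are given up to isomorphism, by a bilinear map with the
  universal property; statements hold for arbitrary choices of them.
\<close>

section \<open>Algebras and multipliers\<close>

locale k_algebra = vector_space scale
  for scale :: "'k::field \<Rightarrow> 'x::ring \<Rightarrow> 'x" +
  assumes scale_mult_left: "scale c (x * y) = scale c x * y"
    and scale_mult_right: "scale c (x * y) = x * scale c y"
    and nonzero: "\<exists>x::'x. x \<noteq> 0"
    and nondegenerate_left: "(\<And>y::'x. x * y = 0) \<Longrightarrow> x = 0"
    and nondegenerate_right: "(\<And>x::'x. x * y = 0) \<Longrightarrow> y = 0"

text \<open>
  Multipliers are double centralizers: \<open>(l, r)\<close> stands for \<open>m\<close> with \<open>m x = l x\<close> and \<open>x m = r x\<close>.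
  In a non-degenerate algebra the last condition implies the others and also linearity of
  \<open>l\<close> and \<open>r\<close> over \<open>k\<close>.
\<close>

typedef (overloaded) 'x multiplier =
  "{(l :: 'x::ring \<Rightarrow> 'x, r :: 'x \<Rightarrow> 'x).
      (\<forall>x y. l (x + y) = l x + l y) \<and> (\<forall>x y. r (x + y) = r x + r y) \<and>
      (\<forall>x y. l (x * y) = l x * y) \<and> (\<forall>x y. r (x * y) = x * r y) \<and>
      (\<forall>x y. x * l y = r x * y)}"
  by (rule exI[of _ "(id, id)"]) auto

definition lact :: "'x::ring multiplier \<Rightarrow> 'x \<Rightarrow> 'x"
  where "lact m = fst (Rep_multiplier m)"

definition ract :: "'x::ring multiplier \<Rightarrow> 'x \<Rightarrow> 'x"
  where "ract m = snd (Rep_multiplier m)"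

lemma multiplier_props:
  "lact m (x + y) = lact m x + lact m y" "ract m (x + y) = ract m x + ract m y"
  "lact m (x * y) = lact m x * y" "ract m (x * y) = x * ract m y"
  "x * lact m y = ract m x * y"
  using Rep_multiplier[of m] by (auto simp: lact_def ract_def split: prod.splits)

lemma multiplier_eqI:
  assumes "\<And>x. lact m x = lact n x" and "\<And>x. ract m x = ract n x"
  shows "m = n"
  using assms by (metis Rep_multiplier_inject ext lact_def ract_def prod_eqI)

lemma acts_Abs_multiplier:
  assumes "\<And>x y. l (x + y) = l x + l y" "\<And>x y. r (x + y) = r x + r y"
    "\<And>x y. l (x * y) = l x * y" "\<And>x y. r (x * y) = x * r y" "\<And>x y. x * l y = r x * y"
  shows "lact (Abs_multiplier (l, r)) = l" "ract (Abs_multiplier (l, r)) = r"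
  using assms by (auto simp: lact_def ract_def Abs_multiplier_inverse)

lemma act_zero: "lact m 0 = 0" "ract m 0 = 0"
  using multiplier_props(1)[of m 0 0] multiplier_props(2)[of m 0 0] by auto

lemma act_minus: "lact m (- x) = - lact m x" "ract m (- x) = - ract m x"
  using multiplier_props(1)[of m x "- x"] multiplier_props(2)[of m x "- x"]
  by (simp_all add: act_zero eq_neg_iff_add_eq_0 add.commute)

instantiation multiplier :: (ring) "{ring, monoid_mult}"
begin

definition zero_multiplier :: "'a multiplier"
  where "0 = Abs_multiplier (\<lambda>_. 0, \<lambda>_. 0)"
definition one_multiplier :: "'a multiplier"
  where "1 = Abs_multiplier (\<lambda>x. x, \<lambda>x. x)"
definition plus_multiplier :: "'a multiplier \<Rightarrow> 'a multiplier \<Rightarrow> 'a multiplier"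
  where "m + n = Abs_multiplier (\<lambda>x. lact m x + lact n x, \<lambda>x. ract m x + ract n x)"
definition uminus_multiplier :: "'a multiplier \<Rightarrow> 'a multiplier"
  where "- m = Abs_multiplier (\<lambda>x. - lact m x, \<lambda>x. - ract m x)"
definition minus_multiplier :: "'a multiplier \<Rightarrow> 'a multiplier \<Rightarrow> 'a multiplier"
  where "m - n = m + (- n :: 'a multiplier)"
definition times_multiplier :: "'a multiplier \<Rightarrow> 'a multiplier \<Rightarrow> 'a multiplier"
  where "m * n = Abs_multiplier (\<lambda>x. lact m (lact n x), \<lambda>x. ract n (ract m x))"

lemma acts [simp]:
  fixes m n :: "'a multiplier"
  shows "lact 0 x = (0::'a)" "ract 0 x = (0::'a)"
    "lact 1 x = x" "ract 1 x = x"
    "lact (m + n) x = lact m x + lact n x" "ract (m + n) x = ract m x + ract n x"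
    "lact (- m) x = - lact m x" "ract (- m) x = - ract m x"
    "lact (m - n) x = lact m x - lact n x" "ract (m - n) x = ract m x - ract n x"
    "lact (m * n) x = lact m (lact n x)" "ract (m * n) x = ract n (ract m x)"
  unfolding minus_multiplier_def zero_multiplier_def one_multiplier_def plus_multiplier_def
    uminus_multiplier_def times_multiplier_def
  by ((subst acts_Abs_multiplier;
       simp add: multiplier_props acts_Abs_multiplier algebra_simps)+)

instance
  by standard (auto intro!: multiplier_eqI simp: multiplier_props algebra_simps)

end

text \<open>The inclusions of an algebra and of \<open>k\<close> into \<open>M(X)\<close>.\<close>

definition of_alg :: "'x::ring \<Rightarrow> 'x multiplier"
  where "of_alg a = Abs_multiplier (\<lambda>x. a * x, \<lambda>x. x * a)"

definition to_alg :: "'x::ring multiplier \<Rightarrow> 'x"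
  where "to_alg m = (THE x. of_alg x = m)"

definition mscalar :: "('k::field \<Rightarrow> 'x::ring \<Rightarrow> 'x) \<Rightarrow> 'k \<Rightarrow> 'x multiplier"
  where "mscalar scale c = Abs_multiplier (scale c, scale c)"

definition mscale :: "('k::field \<Rightarrow> 'x::ring \<Rightarrow> 'x) \<Rightarrow> 'k \<Rightarrow> 'x multiplier \<Rightarrow> 'x multiplier"
  where "mscale scale c m = mscalar scale c * m"

lemma acts_of_alg [simp]: "lact (of_alg a) x = a * x" "ract (of_alg a) x = x * a"
  unfolding of_alg_def by ((subst acts_Abs_multiplier; simp add: algebra_simps)+)

lemma of_alg_mult: "of_alg (a * b) = of_alg a * of_alg b"
  by (rule multiplier_eqI) (simp_all add: algebra_simps)

lemma mult_of_alg: "m * of_alg a = of_alg (lact m a)" "of_alg a * m = of_alg (ract m a)"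
  by (auto intro!: multiplier_eqI simp: multiplier_props)

context k_algebra
begin

lemma of_alg_inject: "of_alg (a::'x) = of_alg b \<longleftrightarrow> a = b"
proof
  assume "of_alg a = of_alg b"
  then have "(a - b) * y = 0" for y
    by (metis acts_of_alg(1) left_diff_distrib right_minus_eq)
  then show "a = b" using nondegenerate_left[of "a - b"] by simp
qed simp

lemma to_alg_of_alg [simp]: "to_alg (of_alg (a::'x)) = a"
  by (simp add: to_alg_def of_alg_inject)

lemma acts_mscalar [simp]:
  "lact (mscalar scale c) x = scale c x" "ract (mscalar scale c) x = scale c x"
  unfolding mscalar_def
  by (subst acts_Abs_multiplier;
      simp add: scale_right_distrib scale_mult_left[symmetric] scale_mult_right[symmetric])+

lemma vector_space_mscale: "vector_space (mscale scale)"
  by standard (auto intro!: multiplier_eqI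
      simp: mscale_def multiplier_props algebra_simps scale_left_distrib)

end

definition algebra_hom ::
  "('k::field \<Rightarrow> 'x::ring \<Rightarrow> 'x) \<Rightarrow> ('k \<Rightarrow> 'y::ring \<Rightarrow> 'y) \<Rightarrow> ('x \<Rightarrow> 'y) \<Rightarrow> bool"
  where "algebra_hom sX sY h \<longleftrightarrow>
    Vector_Spaces.linear sX sY h \<and> (\<forall>x y. h (x * y) = h x * h y)"

definition algebra_automorphism ::
  "('k::field \<Rightarrow> 'x::ring \<Rightarrow> 'x) \<Rightarrow> ('x \<Rightarrow> 'x) \<Rightarrow> bool"
  where "algebra_automorphism sX h \<longleftrightarrow> algebra_hom sX sX h \<and> bij h"

text \<open>
  \<open>ext_value h m n\<close>: the extension of the homomorphism \<open>h : X \<rightarrow> M(Y)\<close> to \<open>M(X)\<close> takes the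
  value \<open>n\<close> at \<open>m\<close>. The value is determined by these equations if
  \<open>h(X)Y\<close> and \<open>Y h(X)\<close> span \<open>Y\<close>, and this relation avoids choosing a value otherwise.
\<close>

definition ext_value :: "('x::ring \<Rightarrow> 'y::ring multiplier) \<Rightarrow> 'x multiplier \<Rightarrow> 'y multiplier \<Rightarrow> bool"
  where "ext_value h m n \<longleftrightarrow> (\<forall>x. n * h x = h (lact m x) \<and> h x * n = h (ract m x))"


section \<open>Tensor products\<close>

definition bilinear_map ::
  "('k::field \<Rightarrow> 'v::ab_group_add \<Rightarrow> 'v) \<Rightarrow> ('k \<Rightarrow> 'w::ab_group_add \<Rightarrow> 'w) \<Rightarrow>
   ('k \<Rightarrow> 't::ab_group_add \<Rightarrow> 't) \<Rightarrow> ('v \<Rightarrow> 'w \<Rightarrow> 't) \<Rightarrow> bool"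
  where "bilinear_map sV sW sT f \<longleftrightarrow>
    (\<forall>y. Vector_Spaces.linear sV sT (\<lambda>x. f x y)) \<and> (\<forall>x. Vector_Spaces.linear sW sT (f x))"

text \<open>
  Only bilinear forms occur in the axiom, because a locale cannot quantify over the type of
  the target space; over a field the universal property for all targets follows, see
  \<open>universal_property\<close> below.
\<close>

locale tensor_product =
  V: vector_space sV + W: vector_space sW + T: vector_space sT
  for sV :: "'k::field \<Rightarrow> 'v::ab_group_add \<Rightarrow> 'v"
    and sW :: "'k \<Rightarrow> 'w::ab_group_add \<Rightarrow> 'w"
    and sT :: "'k \<Rightarrow> 't::ab_group_add \<Rightarrow> 't" +
  fixes ten :: "'v \<Rightarrow> 'w \<Rightarrow> 't"
  assumes bilinear_ten: "bilinear_map sV sW sT ten"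
    and universal_form: "bilinear_map sV sW (*) \<beta> \<Longrightarrow>
      \<exists>!g. Vector_Spaces.linear sT (*) g \<and> (\<forall>x y. g (ten x y) = \<beta> x y)"

text \<open>The linear map \<open>x \<otimes> y \<mapsto> f x y\<close> on the tensor product.\<close>

definition tensor_lift ::
  "('v \<Rightarrow> 'w \<Rightarrow> 't::ab_group_add) \<Rightarrow> ('k::field \<Rightarrow> 't \<Rightarrow> 't) \<Rightarrow> ('k \<Rightarrow> 'u::ab_group_add \<Rightarrow> 'u) \<Rightarrow>
   ('v \<Rightarrow> 'w \<Rightarrow> 'u) \<Rightarrow> 't \<Rightarrow> 'u"
  where "tensor_lift ten sT sU f =
    (THE g. Vector_Spaces.linear sT sU g \<and> (\<forall>x y. g (ten x y) = f x y))"

context tensor_product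
begin

lemma vector_space_field: "vector_space ((*) :: 'k \<Rightarrow> 'k \<Rightarrow> 'k)"
  by standard (auto simp: algebra_simps)

lemma span_ten: "T.span {ten x y |x y. True} = UNIV"
proof (rule ccontr)
  let ?S = "{ten x y |x y. True}"
  interpret F: vector_space "(*) :: 'k \<Rightarrow> 'k \<Rightarrow> 'k" by (rule vector_space_field)
  interpret TF: vector_space_pair sT "(*) :: 'k \<Rightarrow> 'k \<Rightarrow> 'k" ..
  assume "T.span ?S \<noteq> UNIV"
  then obtain t where t: "t \<notin> T.span ?S" by (metis UNIV_eq_I)
  obtain B where B: "B \<subseteq> ?S" "T.independent B" "?S \<subseteq> T.span B"
    by (rule T.maximal_independent_subset)
  have span_B: "T.span B = T.span ?S"
    using B(1,3) by (intro antisym T.span_mono T.span_minimal T.subspace_span)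
  then have "T.independent (insert t B)"
    using T.independent_insertI[of t B] B(2) t by simp
  then obtain g where g: "Vector_Spaces.linear sT (*) g"
    and gB: "\<And>b. b \<in> insert t B \<Longrightarrow> g b = (if b = t then 1 else 0)"
    using TF.linear_independent_extend[of "insert t B" "\<lambda>b. if b = t then 1 else 0"] by blast
  have "t \<notin> B" using t span_B T.span_base[of t B] by auto
  then have "g b = 0" if "b \<in> B" for b using gB that by auto
  then have gS: "g b = 0" if "b \<in> T.span B" for b
    using TF.linear_eq_0_on_span[OF g, of B] that by simp
  have 1: "g (ten x y) = 0" for x y by (rule gS, rule subsetD[OF B(3)]) auto
  have g0: "Vector_Spaces.linear sT (*) (\<lambda>_. 0 :: 'k)"
    by (simp add: Vector_Spaces.linear_iff T.vector_space_axioms F.vector_space_axioms)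
  have "bilinear_map sV sW (*) (\<lambda>_ _. 0 :: 'k)"
    unfolding bilinear_map_def
    by (simp add: Vector_Spaces.linear_iff V.vector_space_axioms W.vector_space_axioms
        F.vector_space_axioms)
  from universal_form[OF this] have "\<exists>!g. Vector_Spaces.linear sT (*) g \<and> (\<forall>x y. g (ten x y) = 0)" .
  with g g0 1 have "g = (\<lambda>_. 0)" by blast
  then show False using gB[of t] by simp
qed

theorem universal_property:
  fixes sU :: "'k \<Rightarrow> 'u::ab_group_add \<Rightarrow> 'u"
  assumes U: "vector_space sU" and f: "bilinear_map sV sW sU f"
  shows "\<exists>!g. Vector_Spaces.linear sT sU g \<and> (\<forall>x y. g (ten x y) = f x y)"
proof (rule ex_ex1I)
  let ?S = "{ten x y |x y. True}"
  interpret U: vector_space sU by fact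
  interpret F: vector_space "(*) :: 'k \<Rightarrow> 'k \<Rightarrow> 'k" by (rule vector_space_field)
  interpret TU: vector_space_pair sT sU ..
  interpret TF: vector_space_pair sT "(*) :: 'k \<Rightarrow> 'k \<Rightarrow> 'k" ..
  interpret UF: vector_space_pair sU "(*) :: 'k \<Rightarrow> 'k \<Rightarrow> 'k" ..
  obtain B where B: "B \<subseteq> ?S" "T.independent B" "?S \<subseteq> T.span B"
    by (rule T.maximal_independent_subset)
  then have span_B: "T.span B = UNIV"
    using span_ten T.span_minimal[OF B(3) T.subspace_span] by (simp add: top.extremum_uniqueI)
  have "\<forall>b\<in>B. \<exists>x y. b = ten x y" using B(1) by blast
  then obtain p q where p: "\<And>b. b \<in> B \<Longrightarrow> b = ten (p b) (q b)" by metis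
  obtain g where g: "Vector_Spaces.linear sT sU g"
    and gB: "\<And>b. b \<in> B \<Longrightarrow> g b = f (p b) (q b)"
    using TU.linear_independent_extend[OF B(2), of "\<lambda>b. f (p b) (q b)"] by blast
  have "g (ten x y) = f x y" for x y
  proof (rule ccontr)
    assume neq: "g (ten x y) \<noteq> f x y"
    define u where "u = g (ten x y) - f x y"
    have "U.independent {u}" using neq by (simp add: u_def)
    then obtain \<xi> where \<xi>: "Vector_Spaces.linear sU (*) \<xi>" and "\<xi> u = 1"
      using UF.linear_independent_extend[of "{u}" "\<lambda>_. 1"] by blast
    have "bilinear_map sV sW (*) (\<lambda>x y. \<xi> (f x y))"
      using f \<xi> unfolding bilinear_map_def
      by (auto intro: Vector_Spaces.linear_compose[unfolded o_def])
    from universal_form[OF this] obtain h where h: "Vector_Spaces.linear sT (*) h"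
      and hten: "\<And>x y. h (ten x y) = \<xi> (f x y)" by blast
    have lin: "Vector_Spaces.linear sT (*) (\<lambda>t. \<xi> (g t))"
      using Vector_Spaces.linear_compose[OF g \<xi>] by (simp add: o_def)
    have "h b = \<xi> (g b)" if "b \<in> B" for b
      using that gB p hten by metis
    then have "h t = \<xi> (g t)" for t
      using TF.linear_eq_on[OF h lin, of t B] span_B by simp
    then have "\<xi> (f x y) = \<xi> (g (ten x y))" using hten by metis
    then have "\<xi> u = 0"
      unfolding u_def using UF.linear_diff[OF \<xi>] by simp
    with \<open>\<xi> u = 1\<close> show False by simp
  qed
  then show "\<exists>g. Vector_Spaces.linear sT sU g \<and> (\<forall>x y. g (ten x y) = f x y)"
    using g by blast
  fix g h
  assume "Vector_Spaces.linear sT sU g \<and> (\<forall>x y. g (ten x y) = f x y)"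
    and "Vector_Spaces.linear sT sU h \<and> (\<forall>x y. h (ten x y) = f x y)"
  then have g: "Vector_Spaces.linear sT sU g" and h: "Vector_Spaces.linear sT sU h"
    and eq: "\<And>x y. g (ten x y) = h (ten x y)" by auto
  show "g = h"
  proof (rule ext)
    fix t
    have "t \<in> T.span ?S" using span_ten by simp
    then show "g t = h t" by (rule TU.linear_eq_on[OF g h]) (use eq in blast)
  qed
qed

end

locale algebra_tensor = tensor_product sV sW sT ten
  for sV :: "'k::field \<Rightarrow> 'v::ring \<Rightarrow> 'v"
    and sW :: "'k \<Rightarrow> 'w::ring \<Rightarrow> 'w"
    and sT :: "'k \<Rightarrow> 't::ring \<Rightarrow> 't"
    and ten :: "'v \<Rightarrow> 'w \<Rightarrow> 't" +
  assumes ten_mult: "ten x y * ten x' y' = ten (x * x') (y * y')"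

text \<open>The tensor product \<open>m \<otimes> n \<in> M(X \<otimes> Y)\<close> of \<open>m \<in> M(X)\<close> and \<open>n \<in> M(Y)\<close>.\<close>

definition mtensor ::
  "('x::ring \<Rightarrow> 'y::ring \<Rightarrow> 't::ring) \<Rightarrow> 'x multiplier \<Rightarrow> 'y multiplier \<Rightarrow> 't multiplier"
  where "mtensor ten m n = (THE p. \<forall>x y.
    lact p (ten x y) = ten (lact m x) (lact n y) \<and>
    ract p (ten x y) = ten (ract m x) (ract n y))"

text \<open>
  For \<open>h : X \<rightarrow> M(Y)\<close> the map \<open>h \<otimes> \<iota> : X \<otimes> A \<rightarrow> M(Y \<otimes> A)\<close>, where \<open>t\<close> and \<open>t'\<close> are the bilinear
  maps of \<open>X \<otimes> A\<close> and \<open>Y \<otimes> A\<close>; then \<open>\<iota> \<otimes> h : A \<otimes> X \<rightarrow> M(A \<otimes> Y)\<close>, and \<open>\<iota> \<otimes> \<omega>\<close> for a functional \<open>\<omega>\<close>.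
\<close>

definition hom_tensor_id ::
  "('x::ring \<Rightarrow> 'a::ring \<Rightarrow> 't::ring) \<Rightarrow> ('k::field \<Rightarrow> 't \<Rightarrow> 't) \<Rightarrow>
   ('y::ring \<Rightarrow> 'a \<Rightarrow> 's::ring) \<Rightarrow> ('k \<Rightarrow> 's \<Rightarrow> 's) \<Rightarrow>
   ('x \<Rightarrow> 'y multiplier) \<Rightarrow> 't \<Rightarrow> 's multiplier"
  where "hom_tensor_id t sT t' sT' h =
    tensor_lift t sT (mscale sT') (\<lambda>x a. mtensor t' (h x) (of_alg a))"

definition id_tensor_hom ::
  "('a::ring \<Rightarrow> 'x::ring \<Rightarrow> 't::ring) \<Rightarrow> ('k::field \<Rightarrow> 't \<Rightarrow> 't) \<Rightarrow>
   ('a \<Rightarrow> 'y::ring \<Rightarrow> 's::ring) \<Rightarrow> ('k \<Rightarrow> 's \<Rightarrow> 's) \<Rightarrow>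
   ('x \<Rightarrow> 'y multiplier) \<Rightarrow> 't \<Rightarrow> 's multiplier"
  where "id_tensor_hom t sT t' sT' h =
    tensor_lift t sT (mscale sT') (\<lambda>a x. mtensor t' (of_alg a) (h x))"

definition id_tensor_functional ::
  "('x::ring \<Rightarrow> 'a::ring \<Rightarrow> 't::ring) \<Rightarrow> ('k::field \<Rightarrow> 't \<Rightarrow> 't) \<Rightarrow> ('k \<Rightarrow> 'x \<Rightarrow> 'x) \<Rightarrow>
   ('a \<Rightarrow> 'k) \<Rightarrow> 't \<Rightarrow> 'x"
  where "id_tensor_functional t sT sX \<omega> = tensor_lift t sT sX (\<lambda>x a. sX (\<omega> a) x)"

text \<open>
  \<open>slice_value t sT sX \<omega> m p\<close>: for \<open>m \<in> M(X \<otimes> A)\<close> such that \<open>m(X \<otimes> 1)\<close> and \<open>(X \<otimes> 1)m\<close> are contained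
  in \<open>X \<otimes> A\<close>, the multiplier \<open>(\<iota> \<otimes> \<omega>)(m)\<close> of \<open>X\<close> is \<open>p\<close>.
\<close>

definition slice_value ::
  "('x::ring \<Rightarrow> 'a::ring \<Rightarrow> 't::ring) \<Rightarrow> ('k::field \<Rightarrow> 't \<Rightarrow> 't) \<Rightarrow> ('k \<Rightarrow> 'x \<Rightarrow> 'x) \<Rightarrow>
   ('a \<Rightarrow> 'k) \<Rightarrow> 't multiplier \<Rightarrow> 'x multiplier \<Rightarrow> bool"
  where "slice_value t sT sX \<omega> m p \<longleftrightarrow> (\<forall>y.
    lact p y = id_tensor_functional t sT sX \<omega> (to_alg (m * mtensor t (of_alg y) 1)) \<and>
    ract p y = id_tensor_functional t sT sX \<omega> (to_alg (mtensor t (of_alg y) 1 * m)))"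

text \<open>
  The two bracketings of a triple tensor product are realised on the same space \<open>T\<close>:
  \<open>tL\<close> exhibits it as \<open>(X \<otimes> Y) \<otimes> Z\<close> and \<open>tR\<close> as \<open>X \<otimes> (Y \<otimes> Z)\<close>.
\<close>

locale triple_algebra_tensor =
  XY: algebra_tensor sX sY sXY tXY + YZ: algebra_tensor sY sZ sYZ tYZ +
  XY_Z: algebra_tensor sXY sZ sT tL + X_YZ: algebra_tensor sX sYZ sT tR
  for sX :: "'k::field \<Rightarrow> 'x::ring \<Rightarrow> 'x" and sY :: "'k \<Rightarrow> 'y::ring \<Rightarrow> 'y"
    and sZ :: "'k \<Rightarrow> 'z::ring \<Rightarrow> 'z"
    and sXY :: "'k \<Rightarrow> 'xy::ring \<Rightarrow> 'xy" and sYZ :: "'k \<Rightarrow> 'yz::ring \<Rightarrow> 'yz"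
    and sT :: "'k \<Rightarrow> 't::ring \<Rightarrow> 't"
    and tXY :: "'x \<Rightarrow> 'y \<Rightarrow> 'xy" and tYZ :: "'y \<Rightarrow> 'z \<Rightarrow> 'yz"
    and tL :: "'xy \<Rightarrow> 'z \<Rightarrow> 't" and tR :: "'x \<Rightarrow> 'yz \<Rightarrow> 't" +
  assumes associator: "tL (tXY x y) z = tR x (tYZ y z)"


section \<open>Algebraic quantum groups and Galois objects\<close>

text \<open>
  \<open>(\<alpha> \<otimes> \<iota>)\<alpha> = (\<iota> \<otimes> \<Delta>)\<alpha>\<close>. The multiplier \<open>n\<close> is \<open>(\<iota> \<otimes> \<Delta>)(\<alpha> x)\<close>, for the extension of \<open>\<iota> \<otimes> \<Delta>\<close> to
  \<open>M(X \<otimes> A)\<close>. It is also \<open>(\<alpha> \<otimes> \<iota>)(\<alpha> x)\<close>, which is defined by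
  \<open>n(1 \<otimes> 1 \<otimes> a) = (\<alpha> \<otimes> \<iota>)(\<alpha>(x)(1 \<otimes> a))\<close> and \<open>(1 \<otimes> 1 \<otimes> a)n = (\<alpha> \<otimes> \<iota>)((1 \<otimes> a)\<alpha>(x))\<close>; these make sense
  without first knowing that \<open>\<alpha>\<close> is non-degenerate, because \<open>\<alpha>(x)(1 \<otimes> a)\<close> and \<open>(1 \<otimes> a)\<alpha>(x)\<close>
  are in \<open>X \<otimes> A\<close>. Both descriptions determine \<open>n\<close>.
\<close>

definition coassociative ::
  "('x::ring \<Rightarrow> 'a::ring \<Rightarrow> 'xa::ring) \<Rightarrow> ('k::field \<Rightarrow> 'xa \<Rightarrow> 'xa) \<Rightarrow>
   ('xa \<Rightarrow> 'a \<Rightarrow> 't::ring) \<Rightarrow> ('x \<Rightarrow> 'aa::ring \<Rightarrow> 't) \<Rightarrow> ('k \<Rightarrow> 't \<Rightarrow> 't) \<Rightarrow>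
   ('a \<Rightarrow> 'aa multiplier) \<Rightarrow> ('x \<Rightarrow> 'xa multiplier) \<Rightarrow> bool"
  where "coassociative tXA sXA tL tR sT \<Delta> \<alpha> \<longleftrightarrow> (\<forall>x. \<exists>n.
    ext_value (id_tensor_hom tXA sXA tR sT \<Delta>) (\<alpha> x) n \<and>
    (\<forall>a. n * mtensor tL 1 (of_alg a) =
           hom_tensor_id tXA sXA tL sT \<alpha> (to_alg (\<alpha> x * mtensor tXA 1 (of_alg a))) \<and>
         mtensor tL 1 (of_alg a) * n =
           hom_tensor_id tXA sXA tL sT \<alpha> (to_alg (mtensor tXA 1 (of_alg a) * \<alpha> x))))"

locale regular_multiplier_hopf_algebra =
  A: k_algebra sA +
  AAA: triple_algebra_tensor sA sA sA sAA sAA sAAA tAA tAA tAAL tAAR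
  for sA :: "'k::field \<Rightarrow> 'a::ring \<Rightarrow> 'a"
    and sAA :: "'k \<Rightarrow> 'aa::ring \<Rightarrow> 'aa" and tAA :: "'a \<Rightarrow> 'a \<Rightarrow> 'aa"
    and sAAA :: "'k \<Rightarrow> 'aaa::ring \<Rightarrow> 'aaa"
    and tAAL :: "'aa \<Rightarrow> 'a \<Rightarrow> 'aaa" and tAAR :: "'a \<Rightarrow> 'aa \<Rightarrow> 'aaa" +
  fixes \<Delta> :: "'a \<Rightarrow> 'aa multiplier"
  assumes \<Delta>_hom: "algebra_hom sA (mscale sAA) \<Delta>"
    and \<Delta>_nondegenerate:
      "module.span sAA {lact (\<Delta> a) w |a w. True} = UNIV"
      "module.span sAA {ract (\<Delta> a) w |a w. True} = UNIV"
    and \<Delta>_coassociative: "coassociative tAA sAA tAAL tAAR sAAA \<Delta> \<Delta>"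
    and galois_maps:
      "bij_betw (tensor_lift tAA sAA (mscale sAA) (\<lambda>a b. \<Delta> a * mtensor tAA 1 (of_alg b)))
         UNIV (range of_alg)"
      "bij_betw (tensor_lift tAA sAA (mscale sAA) (\<lambda>a b. mtensor tAA (of_alg a) 1 * \<Delta> b))
         UNIV (range of_alg)"
      "bij_betw (tensor_lift tAA sAA (mscale sAA) (\<lambda>a b. \<Delta> a * mtensor tAA (of_alg b) 1))
         UNIV (range of_alg)"
      "bij_betw (tensor_lift tAA sAA (mscale sAA) (\<lambda>a b. mtensor tAA 1 (of_alg a) * \<Delta> b))
         UNIV (range of_alg)"

locale algebraic_quantum_group =
  regular_multiplier_hopf_algebra sA sAA tAA sAAA tAAL tAAR \<Delta>
  for sA :: "'k::field \<Rightarrow> 'a::ring \<Rightarrow> 'a"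
    and sAA :: "'k \<Rightarrow> 'aa::ring \<Rightarrow> 'aa" and tAA :: "'a \<Rightarrow> 'a \<Rightarrow> 'aa"
    and sAAA :: "'k \<Rightarrow> 'aaa::ring \<Rightarrow> 'aaa"
    and tAAL :: "'aa \<Rightarrow> 'a \<Rightarrow> 'aaa" and tAAR :: "'a \<Rightarrow> 'aa \<Rightarrow> 'aaa"
    and \<Delta> :: "'a \<Rightarrow> 'aa multiplier" +
  fixes \<phi> :: "'a \<Rightarrow> 'k"
  assumes \<phi>_linear: "Vector_Spaces.linear sA (*) \<phi>"
    and \<phi>_nonzero: "\<exists>a. \<phi> a \<noteq> 0"
    and \<phi>_left_invariant:
      "id_tensor_functional tAA sAA sA \<phi> (to_alg (\<Delta> a * mtensor tAA (of_alg b) 1)) = sA (\<phi> a) b"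

locale right_coaction =
  H: regular_multiplier_hopf_algebra sA sAA tAA sAAA tAAL tAAR \<Delta> +
  X: k_algebra sX +
  XAA: triple_algebra_tensor sX sA sA sXA sAA sXAA tXA tAA tXAL tXAR
  for sA :: "'k::field \<Rightarrow> 'a::ring \<Rightarrow> 'a"
    and sAA :: "'k \<Rightarrow> 'aa::ring \<Rightarrow> 'aa" and tAA :: "'a \<Rightarrow> 'a \<Rightarrow> 'aa"
    and sAAA :: "'k \<Rightarrow> 'aaa::ring \<Rightarrow> 'aaa"
    and tAAL :: "'aa \<Rightarrow> 'a \<Rightarrow> 'aaa" and tAAR :: "'a \<Rightarrow> 'aa \<Rightarrow> 'aaa"
    and \<Delta> :: "'a \<Rightarrow> 'aa multiplier"
    and sX :: "'k \<Rightarrow> 'x::ring \<Rightarrow> 'x"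
    and sXA :: "'k \<Rightarrow> 'xa::ring \<Rightarrow> 'xa" and tXA :: "'x \<Rightarrow> 'a \<Rightarrow> 'xa"
    and sXAA :: "'k \<Rightarrow> 'xaa::ring \<Rightarrow> 'xaa"
    and tXAL :: "'xa \<Rightarrow> 'a \<Rightarrow> 'xaa" and tXAR :: "'x \<Rightarrow> 'aa \<Rightarrow> 'xaa" +
  fixes \<alpha> :: "'x \<Rightarrow> 'xa multiplier"
  assumes \<alpha>_hom: "algebra_hom sX (mscale sXA) \<alpha>"
    and \<alpha>_inj: "inj \<alpha>"
    and \<alpha>_covered: "\<alpha> x * mtensor tXA 1 (of_alg a) \<in> range of_alg"
      "mtensor tXA 1 (of_alg a) * \<alpha> x \<in> range of_alg"
    and \<alpha>_coassociative: "coassociative tXA sXA tXAL tXAR sXAA \<Delta> \<alpha>"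
begin

definition reduced :: bool
  where "reduced \<longleftrightarrow> (\<forall>x y. mtensor tXA (of_alg y) 1 * \<alpha> x \<in> range of_alg)"

definition coinvariants :: "'x multiplier set"
  where "coinvariants = {f. ext_value \<alpha> f (mtensor tXA f 1)}"

end

locale galois_object =
  right_coaction sA sAA tAA sAAA tAAL tAAR \<Delta> sX sXA tXA sXAA tXAL tXAR \<alpha> +
  XX: tensor_product sX sX sXX tXX
  for sA :: "'k::field \<Rightarrow> 'a::ring \<Rightarrow> 'a"
    and sAA :: "'k \<Rightarrow> 'aa::ring \<Rightarrow> 'aa" and tAA :: "'a \<Rightarrow> 'a \<Rightarrow> 'aa"
    and sAAA :: "'k \<Rightarrow> 'aaa::ring \<Rightarrow> 'aaa"
    and tAAL :: "'aa \<Rightarrow> 'a \<Rightarrow> 'aaa" and tAAR :: "'a \<Rightarrow> 'aa \<Rightarrow> 'aaa"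
    and \<Delta> :: "'a \<Rightarrow> 'aa multiplier"
    and sX :: "'k \<Rightarrow> 'x::ring \<Rightarrow> 'x"
    and sXA :: "'k \<Rightarrow> 'xa::ring \<Rightarrow> 'xa" and tXA :: "'x \<Rightarrow> 'a \<Rightarrow> 'xa"
    and sXAA :: "'k \<Rightarrow> 'xaa::ring \<Rightarrow> 'xaa"
    and tXAL :: "'xa \<Rightarrow> 'a \<Rightarrow> 'xaa" and tXAR :: "'x \<Rightarrow> 'aa \<Rightarrow> 'xaa"
    and \<alpha> :: "'x \<Rightarrow> 'xa multiplier"
    and sXX :: "'k \<Rightarrow> 'xx::ab_group_add \<Rightarrow> 'xx" and tXX :: "'x \<Rightarrow> 'x \<Rightarrow> 'xx" +
  assumes reduced: "reduced"
    and coinvariants_trivial: "coinvariants = range (mscalar sX)"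
    and galois_map_bij:
      "bij_betw (tensor_lift tXX sXX (mscale sXA) (\<lambda>x y. mtensor tXA (of_alg x) 1 * \<alpha> y))
         UNIV (range of_alg)"

end

theory Submission
  imports Defs
begin

text \<open>
  Write \<open>\<alpha>(x) = x\<^sub>0 \<otimes> x\<^sub>1\<close> and \<open>\<Delta>(a) = a\<^sub>1 \<otimes> a\<^sub>2\<close>. If \<open>\<phi>\<^sub>X\<close> is faithful and the functionals
  \<open>\<phi>\<^sub>X(p \<cdot>)\<close> are the same as the functionals \<open>\<phi>\<^sub>X(\<cdot> p)\<close>, then the equation
  \<open>\<phi>\<^sub>X(y \<sigma>\<^sub>X(x)) = \<phi>\<^sub>X(x y)\<close> defines a bijection \<open>\<sigma>\<^sub>X\<close>, which is multiplicative because
  \<open>\<phi>\<^sub>X(x y z)\<close> can be rotated in one step or in two. Since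
  \<open>\<phi>\<^sub>X(\<sigma>\<^sub>X(x) \<sigma>\<^sub>X(y)) = \<phi>\<^sub>X(y \<sigma>\<^sub>X(x)) = \<phi>\<^sub>X(x y)\<close> and products span \<open>X\<close>, it preserves \<open>\<phi>\<^sub>X\<close>.

  The two spaces of functionals are compared through finite rank operators. Bijectivity of the
  Galois map writes \<open>y \<otimes> b\<close> as a sum of \<open>(q \<otimes> 1)\<alpha>(p)\<close>, and applying \<open>\<iota> \<otimes> \<phi>\<close> after multiplication
  by \<open>\<alpha>(z)\<close> gives \<open>y z\<^sub>0 \<phi>(b z\<^sub>1) = \<Sum> \<phi>\<^sub>X(p z) q\<close>. If \<open>w \<otimes> b\<close> is a sum of \<open>\<alpha>(p)(q \<otimes> 1)\<close>, then
  likewise \<open>z\<^sub>0 w \<phi>(z\<^sub>1 b) = \<Sum> \<phi>\<^sub>X(z p) q\<close>. When \<open>\<phi>(b \<cdot>)\<close> and \<open>\<phi>(\<cdot> b)\<close> run through the same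
  functionals on \<open>A\<close>, the functionals \<open>z \<mapsto> \<omega>(y z\<^sub>0 w) \<phi>(b z\<^sub>1)\<close> are therefore of both kinds, and for
  fixed \<open>q\<close>, \<open>w\<close> with \<open>\<omega>(q w) = 1\<close> every \<open>\<phi>\<^sub>X(p \<cdot>)\<close> is a sum of them
  (\<open>left_is_right_representable\<close>, \<open>right_is_left_representable\<close>). The second expansion is
  available when \<open>w\<close> is of the form \<open>y\<^sub>0 \<phi>(y\<^sub>1 c)\<close>: if \<open>x y\<^sub>0 \<otimes> y\<^sub>1 = \<Sum> z \<otimes> a\<close>, then
  \<open>\<alpha>(x)(y\<^sub>0 \<phi>(y\<^sub>1 c) \<otimes> 1) = \<Sum> \<alpha>(z)(1 \<otimes> c\<^sub>1 \<phi>(a c\<^sub>2))\<close> (\<open>of_alg_cover_slice\<close>).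

  On \<open>A\<close> itself the comparison goes through the right invariant functional \<open>\<psi> = \<phi> \<circ> S\<close>. Comparing
  the two slices of \<open>(b \<otimes> y)\<Delta>(z)\<close> identifies the functionals \<open>\<phi>(p \<cdot>)\<close> and \<open>\<psi>(p \<cdot>)\<close>, and the
  functionals \<open>z \<mapsto> \<psi>(b z\<^sub>1) \<phi>(z\<^sub>2 y)\<close> are sums of \<open>\<phi>(\<cdot> e)\<close> and also of \<open>\<psi>(p \<cdot>)\<close>
  (\<open>\<phi>_left_is_right\<close>, \<open>\<phi>_right_is_left\<close>). Counit and antipode come from the inverses of the four
  Galois maps of \<open>A\<close>, with \<open>S(a\<^sub>1 \<phi>(a\<^sub>2 b)) = b\<^sub>1 \<phi>(a b\<^sub>2)\<close> as the working formula. Once the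
  functionals agree, the elements \<open>n\<close> with \<open>\<phi>(n A) = 0\<close> form a two-sided ideal that is stable under
  an inverse Galois map; this forces \<open>\<epsilon>(n) = 0\<close> and then \<open>n = 0\<close> (\<open>\<phi>_faithful\<close>), and faithfulness
  of \<open>\<phi>\<^sub>X\<close> follows from that of \<open>\<phi>\<close>.

  Slices \<open>\<iota> \<otimes> \<theta>\<close> and \<open>\<omega> \<otimes> \<iota>\<close> separate the points of a tensor product, so all identities are
  checked on slices. Coassociativity enters in one form only: a slice \<open>d \<mapsto> (\<iota> \<otimes> f)(\<Delta>(d)(1 \<otimes> y))\<close>
  of the last leg commutes with the Galois map (\<open>galois_slice\<close>).
\<close>

section \<open>Linear maps and functionals\<close>

lemma linear_map_add: "Vector_Spaces.linear s s' f \<Longrightarrow> f (x + y) = f x + f y"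
  and linear_map_scale: "Vector_Spaces.linear s s' f \<Longrightarrow> f (s c x) = s' c (f x)"
  by (simp_all add: Vector_Spaces.linear_iff)

lemma additive_zero:
  fixes f :: "'a::ab_group_add \<Rightarrow> 'b::ab_group_add"
  assumes "\<And>x y. f (x + y) = f x + f y"
  shows "f 0 = 0"
  using assms[of 0 0] by simp

lemma linear_map_zero: "Vector_Spaces.linear s s' f \<Longrightarrow> f 0 = 0"
  by (rule additive_zero) (rule linear_map_add)

lemma vector_space_mult: "vector_space ((*) :: 'k::field \<Rightarrow> 'k \<Rightarrow> 'k)"
  by standard (auto simp: algebra_simps)

lemma separating_functional:
  fixes s :: "'k::field \<Rightarrow> 'v::ab_group_add \<Rightarrow> 'v"
  assumes "vector_space s" "v \<noteq> 0"
  obtains f where "Vector_Spaces.linear s (*) f" "f v = 1"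
proof -
  interpret vector_space s by fact
  interpret F: vector_space "(*) :: 'k \<Rightarrow> 'k \<Rightarrow> 'k" by (rule vector_space_mult)
  interpret P: vector_space_pair s "(*) :: 'k \<Rightarrow> 'k \<Rightarrow> 'k" ..
  have "independent {v}" using assms(2) by simp
  from P.linear_independent_extend[OF this, of "\<lambda>_. 1"] that show ?thesis by blast
qed

lemma functionals_separate:
  assumes "vector_space s" "\<And>f. Vector_Spaces.linear s (*) f \<Longrightarrow> f v = f w"
  shows "v = w"
proof (rule ccontr)
  assume "v \<noteq> w"
  then obtain f where f: "Vector_Spaces.linear s (*) f" "f (v - w) = 1"
    using separating_functional[OF assms(1), of "v - w"] by auto
  have "f ((v - w) + w) = f (v - w) + f w" by (rule linear_map_add[OF f(1)])
  then show False using assms(2)[OF f(1)] f(2) by simp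
qed

lemma linear_inv:
  assumes f: "Vector_Spaces.linear s s' f" and "bij f"
  shows "Vector_Spaces.linear s' s (inv f)"
proof -
  have [simp]: "f (inv f x) = x" for x using \<open>bij f\<close> by (simp add: bij_is_surj surj_f_inv_f)
  have "inj f" using \<open>bij f\<close> by (rule bij_is_inj)
  then have "inv f (x + y) = inv f x + inv f y" "inv f (s' c x) = s c (inv f x)" for x y c
    by (auto intro!: injD[OF \<open>inj f\<close>] simp: linear_map_add[OF f] linear_map_scale[OF f])
  then show ?thesis using f by (simp add: Vector_Spaces.linear_iff)
qed

section \<open>Slices of tensors\<close>

context tensor_product
begin

lemma ten_add_left: "ten (x + x') y = ten x y + ten x' y"
  and ten_add_right: "ten x (y + y') = ten x y + ten x y'"
  and ten_scale_left: "ten (sV c x) y = sT c (ten x y)"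
  and ten_scale_right: "ten x (sW c y) = sT c (ten x y)"
  using bilinear_ten by (auto simp: bilinear_map_def Vector_Spaces.linear_iff)

lemma ten_zero_left [simp]: "ten 0 y = 0"
  using ten_add_left[of 0 0 y] by simp

lemma ten_zero_right [simp]: "ten x 0 = 0"
  using ten_add_right[of x 0 0] by simp

text \<open>
  Elementary tensors absorb scalars, so additivity alone reduces an identity to elementary tensors.
\<close>

lemma tensor_induct [case_names ten add]:
  assumes ten: "\<And>x y. P (ten x y)" and add: "\<And>s t. P s \<Longrightarrow> P t \<Longrightarrow> P (s + t)"
  shows "P t"
proof -
  have "t \<in> T.span {ten x y |x y. True}" using span_ten by simp
  then show ?thesis
  proof (induct rule: T.span_induct_alt)
    case base
    show ?case using ten[of 0 0] by simp
  next
    case (step c s t)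
    then obtain x y where "s = ten x y" by auto
    then have "sT c s = ten (sV c x) y" by (simp add: ten_scale_left)
    then show ?case using ten[of "sV c x" y] step(2) by (metis add)
  qed
qed

lemma tensor_lift:
  assumes U: "vector_space sU"
    and "\<And>x x' y. f (x + x') y = f x y + f x' y" "\<And>x y y'. f x (y + y') = f x y + f x y'"
    and "\<And>c x y. f (sV c x) y = sU c (f x y)" "\<And>c x y. f x (sW c y) = sU c (f x y)"
  shows "Vector_Spaces.linear sT sU (tensor_lift ten sT sU f)"
    and "tensor_lift ten sT sU f (ten x y) = f x y"
proof -
  have "bilinear_map sV sW sU f"
    using assms V.vector_space_axioms W.vector_space_axioms
    by (auto simp: bilinear_map_def Vector_Spaces.linear_iff)
  from theI'[OF universal_property[OF U this]]
  show "Vector_Spaces.linear sT sU (tensor_lift ten sT sU f)"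
    and "tensor_lift ten sT sU f (ten x y) = f x y"
    by (simp_all add: tensor_lift_def)
qed

lemma tensor_lift_add:
  assumes "vector_space sU"
    and "\<And>x x' y. f (x + x') y = f x y + f x' y" "\<And>x y y'. f x (y + y') = f x y + f x y'"
    and "\<And>c x y. f (sV c x) y = sU c (f x y)" "\<And>c x y. f x (sW c y) = sU c (f x y)"
  shows "tensor_lift ten sT sU f (s + t) = tensor_lift ten sT sU f s + tensor_lift ten sT sU f t"
  by (rule linear_map_add[OF tensor_lift(1)[OF assms]])

lemma tensor_product_flip: "tensor_product sW sV sT (\<lambda>y x. ten x y)"
proof -
  have "bilinear_map sW sV sT (\<lambda>y x. ten x y)"
    using bilinear_ten by (simp add: bilinear_map_def)
  moreover have "\<exists>!g. Vector_Spaces.linear sT (*) g \<and> (\<forall>x y. g (ten y x) = \<beta> x y)"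
    if "bilinear_map sW sV (*) \<beta>" for \<beta>
  proof -
    have "bilinear_map sV sW (*) (\<lambda>x y. \<beta> y x)" using that by (simp add: bilinear_map_def)
    from universal_form[OF this] show ?thesis by (metis (no_types, lifting))
  qed
  ultimately show ?thesis
    by (simp add: tensor_product_def tensor_product_axioms_def
        V.vector_space_axioms W.vector_space_axioms T.vector_space_axioms)
qed

definition slice_right :: "('w \<Rightarrow> 'k) \<Rightarrow> 't \<Rightarrow> 'v"
  where "slice_right \<theta> = tensor_lift ten sT sV (\<lambda>x y. sV (\<theta> y) x)"

definition slice_left :: "('v \<Rightarrow> 'k) \<Rightarrow> 't \<Rightarrow> 'w"
  where "slice_left \<omega> = tensor_lift ten sT sW (\<lambda>x y. sW (\<omega> x) y)"

context
  fixes \<theta> assumes \<theta>: "Vector_Spaces.linear sW (*) \<theta>"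
begin

lemma slice_right_linear: "Vector_Spaces.linear sT sV (slice_right \<theta>)"
  and slice_right_ten: "slice_right \<theta> (ten x y) = sV (\<theta> y) x"
  unfolding slice_right_def
  by (rule tensor_lift;
      use V.vector_space_axioms in \<open>simp add: linear_map_add[OF \<theta>] linear_map_scale[OF \<theta>]
        V.scale_left_distrib V.scale_right_distrib mult.commute\<close>)+

lemmas slice_right_add = linear_map_add[OF slice_right_linear]
lemmas slice_right_scale = linear_map_scale[OF slice_right_linear]

end

context
  fixes \<omega> assumes \<omega>: "Vector_Spaces.linear sV (*) \<omega>"
begin

lemma slice_left_linear: "Vector_Spaces.linear sT sW (slice_left \<omega>)"
  and slice_left_ten: "slice_left \<omega> (ten x y) = sW (\<omega> x) y"
  unfolding slice_left_def
  by (rule tensor_lift;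
      use W.vector_space_axioms in \<open>simp add: linear_map_add[OF \<omega>] linear_map_scale[OF \<omega>]
        W.scale_left_distrib W.scale_right_distrib mult.commute\<close>)+

lemmas slice_left_add = linear_map_add[OF slice_left_linear]
lemmas slice_left_scale = linear_map_scale[OF slice_left_linear]

end

lemma slices_commute:
  assumes \<omega>: "Vector_Spaces.linear sV (*) \<omega>" and \<theta>: "Vector_Spaces.linear sW (*) \<theta>"
  shows "\<omega> (slice_right \<theta> t) = \<theta> (slice_left \<omega> t)"
proof (induct t rule: tensor_induct)
  case (ten x y)
  show ?case
    by (simp add: slice_right_ten[OF \<theta>] slice_left_ten[OF \<omega>] linear_map_scale[OF \<theta>] linear_map_scale[OF \<omega>])
next
  case (add s t)
  then show ?case
    by (simp add: slice_right_add[OF \<theta>] slice_left_add[OF \<omega>] linear_map_add[OF \<theta>] linear_map_add[OF \<omega>])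
qed

lemma tensor_basis_expansion:
  assumes B: "W.span B = UNIV"
  obtains F g where "finite F" "F \<subseteq> B" "t = (\<Sum>b\<in>F. ten (g b) b)"
proof -
  have "\<exists>F g. finite F \<and> F \<subseteq> B \<and> t = (\<Sum>b\<in>F. ten (g b) b)"
  proof (induct t rule: tensor_induct)
    case (ten x y)
    have "y \<in> W.span B" using B by simp
    then obtain F r where F: "finite F" "F \<subseteq> B" "y = (\<Sum>b\<in>F. sW (r b) b)"
      by (auto simp: W.span_explicit)
    have "ten x y = (\<Sum>b\<in>F. ten x (sW (r b) b))"
      unfolding F(3) using F(1) by (induct F) (simp_all add: ten_add_right)
    then have "ten x y = (\<Sum>b\<in>F. ten (sV (r b) x) b)"
      unfolding ten_scale_left ten_scale_right .
    with F(1,2) show ?case by (intro exI[of _ F] exI[of _ "\<lambda>b. sV (r b) x"] conjI)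
  next
    case (add s t)
    then obtain F g G h where F: "finite F" "F \<subseteq> B" "s = (\<Sum>b\<in>F. ten (g b) b)"
      and G: "finite G" "G \<subseteq> B" "t = (\<Sum>b\<in>G. ten (h b) b)" by blast
    define g' where "g' b = (if b \<in> F then g b else 0)" for b
    define h' where "h' b = (if b \<in> G then h b else 0)" for b
    have "s = (\<Sum>b\<in>F \<union> G. ten (g' b) b)"
      unfolding F(3) using F G by (intro sum.mono_neutral_cong_left) (auto simp: g'_def)
    moreover have "t = (\<Sum>b\<in>F \<union> G. ten (h' b) b)"
      unfolding G(3) using F G by (intro sum.mono_neutral_cong_left) (auto simp: h'_def)
    ultimately have "s + t = (\<Sum>b\<in>F \<union> G. ten (g' b + h' b) b)"
      by (simp add: sum.distrib ten_add_left)
    with F G show ?case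
      by (intro exI[of _ "F \<union> G"] exI[of _ "\<lambda>b. g' b + h' b"] conjI) simp_all
  qed
  then show ?thesis using that by blast
qed

text \<open>
  Expand the difference along a basis of the second factor: the dual functionals read off the
  coefficients.
\<close>

lemma slices_right_separate:
  assumes "\<And>\<theta>. Vector_Spaces.linear sW (*) \<theta> \<Longrightarrow> slice_right \<theta> s = slice_right \<theta> t"
  shows "s = t"
proof -
  interpret F: vector_space "(*) :: 'k \<Rightarrow> 'k \<Rightarrow> 'k" by (rule vector_space_mult)
  interpret WF: vector_space_pair sW "(*) :: 'k \<Rightarrow> 'k \<Rightarrow> 'k" ..
  obtain B where B: "B \<subseteq> UNIV" "W.independent B" "UNIV \<subseteq> W.span B"
    by (rule W.maximal_independent_subset)
  then have "W.span B = UNIV" by auto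
  then obtain F g where F: "finite F" "F \<subseteq> B" "s - t = (\<Sum>b\<in>F. ten (g b) b)"
    by (rule tensor_basis_expansion)
  have "g b = 0" if b: "b \<in> F" for b
  proof -
    obtain \<theta> where \<theta>: "Vector_Spaces.linear sW (*) \<theta>"
      and \<theta>B: "\<And>b'. b' \<in> B \<Longrightarrow> \<theta> b' = (if b' = b then 1 else 0)"
      using WF.linear_independent_extend[OF B(2), of "\<lambda>b'. if b' = b then 1 else 0"] by blast
    have "slice_right \<theta> (\<Sum>b\<in>G. ten (g b) b) = (\<Sum>b\<in>G. sV (\<theta> b) (g b))" if "finite G" for G
      using that by (induct G)
        (simp_all add: slice_right_add[OF \<theta>] slice_right_ten[OF \<theta>]
          linear_map_zero[OF slice_right_linear[OF \<theta>]])
    then have "slice_right \<theta> (s - t) = (\<Sum>b'\<in>F. sV (\<theta> b') (g b'))" using F by simp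
    also have "\<dots> = (\<Sum>b'\<in>F. if b' = b then g b else 0)"
      using F(2) by (intro sum.cong) (auto simp: \<theta>B)
    also have "\<dots> = g b" using F(1) b by simp
    finally have "slice_right \<theta> (s - t) = g b" .
    moreover have "slice_right \<theta> ((s - t) + t) = slice_right \<theta> (s - t) + slice_right \<theta> t"
      by (rule slice_right_add[OF \<theta>])
    ultimately show ?thesis using assms[OF \<theta>] by simp
  qed
  then have "s - t = 0" unfolding F(3) by simp
  then show ?thesis by simp
qed

lemma slices_left_separate:
  assumes "\<And>\<omega>. Vector_Spaces.linear sV (*) \<omega> \<Longrightarrow> slice_left \<omega> s = slice_left \<omega> t"
  shows "s = t"
proof (rule slices_right_separate, rule functionals_separate[OF V.vector_space_axioms])
  fix \<theta> \<omega> assume "Vector_Spaces.linear sW (*) \<theta>" "Vector_Spaces.linear sV (*) \<omega>"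
  then show "\<omega> (slice_right \<theta> s) = \<omega> (slice_right \<theta> t)"
    using assms by (simp add: slices_commute)
qed

lemma slice_right_zero: "slice_right (\<lambda>_. 0) t = 0"
proof -
  have lin: "Vector_Spaces.linear sW (*) (\<lambda>_. 0 :: 'k)"
    by (simp add: Vector_Spaces.linear_iff W.vector_space_axioms vector_space_mult)
  show ?thesis
    by (induct t rule: tensor_induct) (simp_all add: slice_right_ten[OF lin] slice_right_add[OF lin])
qed

text \<open>
  The slices of a tensor detect the subspace in which its second legs lie: with linearly independent
  first legs, a functional that annihilates the slice annihilates every second leg.
\<close>

lemma annihilated_tensor_expansion:
  assumes "\<And>\<theta>. \<theta> \<in> \<Theta> \<Longrightarrow> Vector_Spaces.linear sW (*) \<theta>"
    and "\<And>\<theta>. \<theta> \<in> \<Theta> \<Longrightarrow> slice_right \<theta> t = 0"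
  obtains F g where "finite F" "t = (\<Sum>b\<in>F. ten b (g b))"
    "\<And>b \<theta>. b \<in> F \<Longrightarrow> \<theta> \<in> \<Theta> \<Longrightarrow> \<theta> (g b) = 0"
proof -
  interpret flip: tensor_product sW sV sT "\<lambda>y x. ten x y" by (rule tensor_product_flip)
  obtain B where B: "B \<subseteq> UNIV" "V.independent B" "UNIV \<subseteq> V.span B"
    by (rule V.maximal_independent_subset)
  then have "V.span B = UNIV" by auto
  then obtain F g where F: "finite F" "F \<subseteq> B" "t = (\<Sum>b\<in>F. ten b (g b))"
    by (rule flip.tensor_basis_expansion)
  have "\<theta> (g b) = 0" if "b \<in> F" "\<theta> \<in> \<Theta>" for b \<theta>
  proof -
    note \<theta> = assms(1)[OF that(2)]
    have "slice_right \<theta> (\<Sum>b\<in>G. ten b (g b)) = (\<Sum>b\<in>G. sV (\<theta> (g b)) b)" if "finite G" for G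
      using that by (induct G)
        (simp_all add: slice_right_add[OF \<theta>] slice_right_ten[OF \<theta>]
          linear_map_zero[OF slice_right_linear[OF \<theta>]])
    then have "(\<Sum>b\<in>F. sV (\<theta> (g b)) b) = 0"
      using assms(2)[OF that(2)] F by simp
    moreover have "V.independent F" using B(2) F(2) by (rule V.independent_mono)
    ultimately show ?thesis
      using F(1) that(1) V.independentD[of F F "\<lambda>b. \<theta> (g b)" b] by simp
  qed
  with F that show ?thesis by blast
qed

end

section \<open>Multipliers of a tensor product of algebras\<close>

context k_algebra
begin

text \<open>
  In a non-degenerate algebra an element, and also a multiplier, is determined by what it does on one
  side.
\<close>

lemma eq_by_left_mult: "(\<And>y. y * a = y * b) \<Longrightarrow> (a::'x) = b"
  using nondegenerate_right[of "a - b"] by (simp add: right_diff_distrib)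

lemma eq_by_right_mult: "(\<And>y. a * y = b * y) \<Longrightarrow> (a::'x) = b"
  using nondegenerate_left[of "a - b"] by (simp add: left_diff_distrib)

lemma lact_scale: "lact m (scale c x) = scale c (lact m x)"
  by (rule eq_by_left_mult) (metis multiplier_props(5) scale_mult_right)

lemma ract_scale: "ract m (scale c x) = scale c (ract m x)"
  by (rule eq_by_right_mult) (metis multiplier_props(5) scale_mult_left)

lemma multiplier_eq_by_ract:
  assumes "\<And>x. ract m x = ract n x" shows "m = (n :: 'x multiplier)"
proof (rule multiplier_eqI, rule eq_by_left_mult)
  show "y * lact m x = y * lact n x" for x y by (simp add: multiplier_props(5) assms)
qed (rule assms)

lemma lact_mscale: "lact (mscale scale c m) x = scale c (lact m x)"
  and ract_mscale: "ract (mscale scale c m) x = scale c (ract m x)"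
  by (simp_all add: mscale_def ract_scale)

lemma mscale_mult_left: "mscale scale c m * n = mscale scale c (m * n)"
  and mscale_mult_right: "m * mscale scale c n = mscale scale c (m * n)"
  by (rule multiplier_eqI; simp add: lact_mscale ract_mscale lact_scale ract_scale)+

lemma of_alg_scale: "of_alg (scale c x) = mscale scale c (of_alg x)"
  by (rule multiplier_eqI)
    (simp_all add: lact_mscale ract_mscale scale_mult_left[symmetric] scale_mult_right[symmetric])

lemma of_alg_add: "of_alg (x + y) = of_alg x + of_alg (y :: 'x)"
  by (rule multiplier_eqI) (simp_all add: algebra_simps)

lemma of_alg_to_alg: "m \<in> range of_alg \<Longrightarrow> of_alg (to_alg m :: 'x) = m"
  by auto

lemma linear_mult_functional:
  assumes "Vector_Spaces.linear scale (*) f"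
  shows "Vector_Spaces.linear scale (*) (\<lambda>x. f (x * a))" "Vector_Spaces.linear scale (*) (\<lambda>x. f (a * x))"
  using assms by (auto simp: Vector_Spaces.linear_iff algebra_simps
      scale_mult_left[symmetric] scale_mult_right[symmetric])

lemma lact_ract_commute: "lact m (ract n t) = ract n (lact m (t :: 'x))"
proof -
  have "of_alg (lact m (ract n t)) = of_alg (ract n (lact m t))"
    by (simp add: mult_of_alg[symmetric] mult.assoc)
  then show ?thesis by (simp add: of_alg_inject)
qed

end

context tensor_product
begin

text \<open>
  A Galois map is given as a map into multipliers whose image is the algebra; this transports its
  bijectivity to the corresponding map into the algebra itself.
\<close>

lemma bij_lift_of_bij_betw:
  assumes U: "k_algebra sU"
    and f: "\<And>x x' y. f (x + x') y = f x y + f x' y" "\<And>x y y'. f x (y + y') = f x y + f x y'"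
      "\<And>c x y. f (sV c x) y = sU c (f x y)" "\<And>c x y. f x (sW c y) = sU c (f x y)"
    and F: "\<And>x y. of_alg (f x y) = F x y"
    and bij: "bij_betw (tensor_lift ten sT (mscale sU) F) UNIV (range of_alg)"
  shows "bij (tensor_lift ten sT sU f)"
proof -
  interpret U: k_algebra sU by fact
  have F: "F = (\<lambda>x y. of_alg (f x y))" by (simp add: fun_eq_iff F)
  have *: "of_alg (tensor_lift ten sT sU f t) = tensor_lift ten sT (mscale sU) F t" for t
  proof (induct t rule: tensor_induct)
    case (ten x y)
    show ?case
      by (subst tensor_lift(2)) (simp_all add: U.vector_space_axioms f tensor_lift(2)
          U.vector_space_mscale F U.of_alg_add U.of_alg_scale)
  next
    case (add s t)
    then show ?case
      by (subst (1 2) tensor_lift_add) (simp_all add: U.vector_space_axioms f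
          U.vector_space_mscale F U.of_alg_add U.of_alg_scale)
  qed
  show ?thesis
  proof (rule bijI)
    show "inj (tensor_lift ten sT sU f)"
    proof (rule injI)
      fix s t assume "tensor_lift ten sT sU f s = tensor_lift ten sT sU f t"
      then have "tensor_lift ten sT (mscale sU) F s = tensor_lift ten sT (mscale sU) F t"
        by (simp add: *[symmetric])
      then show "s = t" using bij by (auto dest!: bij_betw_imp_inj_on injD)
    qed
    show "surj (tensor_lift ten sT sU f)"
    proof (rule surjI)
      fix u
      have "of_alg u \<in> tensor_lift ten sT (mscale sU) F ` UNIV"
        using bij by (simp add: bij_betw_imp_surj_on)
      then have "\<exists>t. of_alg (tensor_lift ten sT sU f t) = of_alg u" by (auto simp: *)
      then have "\<exists>t. tensor_lift ten sT sU f t = u" by (simp add: U.of_alg_inject)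
      then show "tensor_lift ten sT sU f (SOME t. tensor_lift ten sT sU f t = u) = u"
        by (rule someI_ex)
    qed
  qed
qed

end

locale tensor_of_algebras =
  V: k_algebra sV + W: k_algebra sW + algebra_tensor sV sW sT ten
  for sV :: "'k::field \<Rightarrow> 'v::ring \<Rightarrow> 'v" and sW :: "'k \<Rightarrow> 'w::ring \<Rightarrow> 'w"
    and sT :: "'k \<Rightarrow> 't::ring \<Rightarrow> 't" and ten :: "'v \<Rightarrow> 'w \<Rightarrow> 't"
begin

lemma scale_times: "sT c s * t = sT c (s * t)" and times_scale: "s * sT c t = sT c (s * t)"
proof -
  have *: "sT c (ten x y) * t = sT c (ten x y * t)" "ten x y * sT c t = sT c (ten x y * t)" for x y
    by (induct t rule: tensor_induct)
      (simp_all add: ten_mult ten_scale_left[symmetric] V.scale_mult_left[symmetric]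
        V.scale_mult_right[symmetric] distrib_left T.scale_right_distrib)
  show "sT c s * t = sT c (s * t)"
    by (induct s rule: tensor_induct) (simp_all add: * T.scale_right_distrib distrib_right)
  show "s * sT c t = sT c (s * t)"
    by (induct s rule: tensor_induct) (simp_all add: * T.scale_right_distrib distrib_right)
qed

lemma slice_left_times_ten:
  assumes \<omega>: "Vector_Spaces.linear sV (*) \<omega>"
  shows "slice_left \<omega> (t * ten x y) = slice_left (\<lambda>b. \<omega> (b * x)) t * y" (is ?A)
    and "slice_left \<omega> (ten x y * t) = y * slice_left (\<lambda>b. \<omega> (x * b)) t" (is ?B)
proof -
  have *: "Vector_Spaces.linear sV (*) (\<lambda>b. \<omega> (b * x))" "Vector_Spaces.linear sV (*) (\<lambda>b. \<omega> (x * b))"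
    using \<omega> by (auto simp: Vector_Spaces.linear_iff algebra_simps
        V.scale_mult_left[symmetric] V.scale_mult_right[symmetric])
  show ?A ?B
    by (induct t rule: tensor_induct)
      (simp_all add: slice_left_add[OF \<omega>] slice_left_ten[OF \<omega>] slice_left_add[OF *(1)]
        slice_left_ten[OF *(1)] slice_left_add[OF *(2)] slice_left_ten[OF *(2)]
        distrib_left distrib_right ten_mult W.scale_mult_left[symmetric] W.scale_mult_right[symmetric])
qed

text \<open>
  Non-degeneracy passes to the tensor product because multiplication by elementary tensors can be
  carried out slice by slice, where it is cancelled first in one factor and then in the other.
\<close>

sublocale T: k_algebra sT
proof
  show "sT c (x * y) = sT c x * y" "sT c (x * y) = x * sT c y" for c x y
    by (simp_all add: scale_times times_scale)
  show "\<exists>x::'t. x \<noteq> 0"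
  proof -
    obtain x :: 'v and y :: 'w where xy: "x \<noteq> 0" "y \<noteq> 0" using V.nonzero W.nonzero by blast
    obtain \<theta> where \<theta>: "Vector_Spaces.linear sW (*) \<theta>" "\<theta> y = 1"
      using separating_functional[OF W.vector_space_axioms xy(2)] .
    have "slice_right \<theta> (ten x y) = x" by (simp add: slice_right_ten[OF \<theta>(1)] \<theta>(2))
    then have "ten x y \<noteq> 0" using xy linear_map_zero[OF slice_right_linear[OF \<theta>(1)]] by auto
    then show ?thesis ..
  qed
  show "t = 0" if t: "\<And>s. t * s = 0" for t :: 't
  proof (rule slices_left_separate)
    fix \<omega> assume \<omega>: "Vector_Spaces.linear sV (*) \<omega>"
    show "slice_left \<omega> t = slice_left \<omega> 0"
    proof (rule functionals_separate[OF W.vector_space_axioms])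
      fix \<theta> assume \<theta>: "Vector_Spaces.linear sW (*) \<theta>"
      have "slice_left (\<lambda>b. \<omega>' (b * x)) t = 0" if \<omega>': "Vector_Spaces.linear sV (*) \<omega>'" for \<omega>' x
      proof (rule W.nondegenerate_left)
        show "slice_left (\<lambda>b. \<omega>' (b * x)) t * y = 0" for y
          by (simp add: slice_left_times_ten(1)[OF \<omega>', symmetric] t
              linear_map_zero[OF slice_left_linear[OF \<omega>']])
      qed
      note 1 = this
      have "slice_right \<theta> t = 0"
      proof (rule V.nondegenerate_left, rule functionals_separate[OF V.vector_space_axioms])
        fix x \<omega>' assume \<omega>': "Vector_Spaces.linear sV (*) \<omega>'"
        have *: "Vector_Spaces.linear sV (*) (\<lambda>b. \<omega>' (b * x))"
          using \<omega>' by (auto simp: Vector_Spaces.linear_iff algebra_simps V.scale_mult_left[symmetric])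
        show "\<omega>' (slice_right \<theta> t * x) = \<omega>' 0"
          using slices_commute[OF * \<theta>, of t] by (simp add: 1[OF \<omega>'] linear_map_zero[OF \<theta>] linear_map_zero[OF \<omega>'])
      qed
      then show "\<theta> (slice_left \<omega> t) = \<theta> (slice_left \<omega> 0)"
        by (simp add: slices_commute[OF \<omega> \<theta>, symmetric] linear_map_zero[OF \<omega>]
            linear_map_zero[OF slice_left_linear[OF \<omega>]] linear_map_zero[OF \<theta>])
    qed
  qed
  show "t = 0" if t: "\<And>s. s * t = 0" for t :: 't
  proof (rule slices_left_separate)
    fix \<omega> assume \<omega>: "Vector_Spaces.linear sV (*) \<omega>"
    show "slice_left \<omega> t = slice_left \<omega> 0"
    proof (rule functionals_separate[OF W.vector_space_axioms])
      fix \<theta> assume \<theta>: "Vector_Spaces.linear sW (*) \<theta>"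
      have "slice_left (\<lambda>b. \<omega>' (x * b)) t = 0" if \<omega>': "Vector_Spaces.linear sV (*) \<omega>'" for \<omega>' x
      proof (rule W.nondegenerate_right)
        show "y * slice_left (\<lambda>b. \<omega>' (x * b)) t = 0" for y
          by (simp add: slice_left_times_ten(2)[OF \<omega>', symmetric] t
              linear_map_zero[OF slice_left_linear[OF \<omega>']])
      qed
      note 1 = this
      have "slice_right \<theta> t = 0"
      proof (rule V.nondegenerate_right, rule functionals_separate[OF V.vector_space_axioms])
        fix x \<omega>' assume \<omega>': "Vector_Spaces.linear sV (*) \<omega>'"
        have *: "Vector_Spaces.linear sV (*) (\<lambda>b. \<omega>' (x * b))"
          using \<omega>' by (auto simp: Vector_Spaces.linear_iff algebra_simps V.scale_mult_right[symmetric])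
        show "\<omega>' (x * slice_right \<theta> t) = \<omega>' 0"
          using slices_commute[OF * \<theta>, of t] by (simp add: 1[OF \<omega>'] linear_map_zero[OF \<theta>] linear_map_zero[OF \<omega>'])
      qed
      then show "\<theta> (slice_left \<omega> t) = \<theta> (slice_left \<omega> 0)"
        by (simp add: slices_commute[OF \<omega> \<theta>, symmetric] linear_map_zero[OF \<omega>]
            linear_map_zero[OF slice_left_linear[OF \<omega>]] linear_map_zero[OF \<theta>])
    qed
  qed
qed

text \<open>
  The description that defines \<open>m \<otimes> n\<close> is satisfied by exactly one multiplier: its two actions are
  the lifts of \<open>x \<otimes> y \<mapsto> m x \<otimes> n y\<close> and \<open>x \<otimes> y \<mapsto> x m \<otimes> y n\<close>.
\<close>

lemma mtensor_ten [simp]: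
  "lact (mtensor ten m n) (ten x y) = ten (lact m x) (lact n y)"
  "ract (mtensor ten m n) (ten x y) = ten (ract m x) (ract n y)"
proof -
  define l where "l = tensor_lift ten sT sT (\<lambda>x y. ten (lact m x) (lact n y))"
  define r where "r = tensor_lift ten sT sT (\<lambda>x y. ten (ract m x) (ract n y))"
  note bil = T.vector_space_axioms multiplier_props ten_add_left ten_add_right
    V.lact_scale W.lact_scale V.ract_scale W.ract_scale ten_scale_left ten_scale_right
  have l: "l (ten x y) = ten (lact m x) (lact n y)" "l (s + t) = l s + l t" for x y s t
    unfolding l_def by (rule tensor_lift tensor_lift_add; simp add: bil)+
  have r: "r (ten x y) = ten (ract m x) (ract n y)" "r (s + t) = r s + r t" for x y s t
    unfolding r_def by (rule tensor_lift tensor_lift_add; simp add: bil)+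
  have 1: "l (ten x y * t) = l (ten x y) * t" "r (t * ten x y) = t * r (ten x y)"
    "t * l (ten x y) = r t * ten x y" for t x y
    by (induct t rule: tensor_induct)
      (simp_all add: l r ten_mult multiplier_props distrib_left distrib_right)
  have 2: "l (s * t) = l s * t" "r (t * s) = t * r s" "t * l s = r t * s" for s t
    by (induct s rule: tensor_induct) (simp_all add: 1 l(2) r(2) distrib_left distrib_right)
  define p where "p = Abs_multiplier (l, r)"
  have p: "lact p = l" "ract p = r"
    unfolding p_def by (rule acts_Abs_multiplier; simp add: l r 2)+
  have "mtensor ten m n = p"
    unfolding mtensor_def
  proof (rule the_equality)
    show "\<forall>x y. lact p (ten x y) = ten (lact m x) (lact n y) \<and>
        ract p (ten x y) = ten (ract m x) (ract n y)"
      by (simp add: p l r)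
    fix q
    assume q: "\<forall>x y. lact q (ten x y) = ten (lact m x) (lact n y) \<and>
        ract q (ten x y) = ten (ract m x) (ract n y)"
    show "q = p"
    proof (rule multiplier_eqI)
      show "lact q t = lact p t" for t
        by (induct t rule: tensor_induct) (simp_all add: q p l multiplier_props(1))
      show "ract q t = ract p t" for t
        by (induct t rule: tensor_induct) (simp_all add: q p r multiplier_props(2))
    qed
  qed
  then show "lact (mtensor ten m n) (ten x y) = ten (lact m x) (lact n y)"
    "ract (mtensor ten m n) (ten x y) = ten (ract m x) (ract n y)"
    by (simp_all add: p l r)
qed

abbreviation fst_leg :: "'v \<Rightarrow> 't multiplier"
  where "fst_leg x \<equiv> mtensor ten (of_alg x) 1"

abbreviation snd_leg :: "'w \<Rightarrow> 't multiplier"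
  where "snd_leg y \<equiv> mtensor ten 1 (of_alg y)"

lemma multiplier_tensor_eqI:
  assumes "\<And>x y. ract m (ten x y) = ract n (ten x y)" shows "m = (n :: 't multiplier)"
proof (rule T.multiplier_eq_by_ract)
  show "ract m t = ract n t" for t
    by (induct t rule: tensor_induct) (simp_all add: assms multiplier_props)
qed

lemma mtensor_mult: "mtensor ten m n * mtensor ten m' n' = mtensor ten (m * m') (n * n')"
  by (rule multiplier_tensor_eqI) simp

lemma mtensor_of_alg: "mtensor ten (of_alg x) (of_alg y) = of_alg (ten x y)"
  by (rule multiplier_tensor_eqI) (simp add: ten_mult)

lemma legs_mult: "fst_leg x * snd_leg y = of_alg (ten x y)" "snd_leg y * fst_leg x = of_alg (ten x y)"
  by (simp_all add: mtensor_mult mtensor_of_alg)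

lemma mtensor_add: "mtensor ten (m + m') n = mtensor ten m n + mtensor ten m' n"
  "mtensor ten m (n + n') = mtensor ten m n + mtensor ten m n'"
  by (rule multiplier_tensor_eqI; simp add: ten_add_left ten_add_right)+

lemma mtensor_scale: "mtensor ten (mscale sV c m) n = mscale sT c (mtensor ten m n)"
  "mtensor ten m (mscale sW c n) = mscale sT c (mtensor ten m n)"
  by (rule multiplier_tensor_eqI;
      simp add: V.ract_mscale W.ract_mscale T.ract_mscale ten_scale_left ten_scale_right)+

lemma slice_right_legs:
  assumes \<theta>: "Vector_Spaces.linear sW (*) \<theta>"
  shows "slice_right \<theta> (lact (fst_leg x) t) = x * slice_right \<theta> t"
    and "slice_right \<theta> (ract (fst_leg x) t) = slice_right \<theta> t * x"
    and "slice_right \<theta> (lact (snd_leg y) t) = slice_right (\<lambda>b. \<theta> (y * b)) t"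
    and "slice_right \<theta> (ract (snd_leg y) t) = slice_right (\<lambda>b. \<theta> (b * y)) t"
proof -
  have *: "Vector_Spaces.linear sW (*) (\<lambda>b. \<theta> (b * y))" "Vector_Spaces.linear sW (*) (\<lambda>b. \<theta> (y * b))"
    using \<theta> by (auto simp: Vector_Spaces.linear_iff algebra_simps
        W.scale_mult_left[symmetric] W.scale_mult_right[symmetric])
  note s = slice_right_add[OF \<theta>] slice_right_ten[OF \<theta>] slice_right_add[OF *(1)]
        slice_right_ten[OF *(1)] slice_right_add[OF *(2)] slice_right_ten[OF *(2)]
        distrib_left distrib_right V.scale_mult_left[symmetric] V.scale_mult_right[symmetric]
        multiplier_props(1,2)
  show "slice_right \<theta> (lact (fst_leg x) t) = x * slice_right \<theta> t"
    "slice_right \<theta> (ract (fst_leg x) t) = slice_right \<theta> t * x"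
    "slice_right \<theta> (lact (snd_leg y) t) = slice_right (\<lambda>b. \<theta> (y * b)) t"
    "slice_right \<theta> (ract (snd_leg y) t) = slice_right (\<lambda>b. \<theta> (b * y)) t"
    by (induct t rule: tensor_induct) (simp_all add: s)
qed

lemma slice_left_legs:
  assumes \<omega>: "Vector_Spaces.linear sV (*) \<omega>"
  shows "slice_left \<omega> (lact (snd_leg y) t) = y * slice_left \<omega> t"
    and "slice_left \<omega> (ract (snd_leg y) t) = slice_left \<omega> t * y"
    and "slice_left \<omega> (lact (fst_leg x) t) = slice_left (\<lambda>b. \<omega> (x * b)) t"
    and "slice_left \<omega> (ract (fst_leg x) t) = slice_left (\<lambda>b. \<omega> (b * x)) t"
proof -
  have *: "Vector_Spaces.linear sV (*) (\<lambda>b. \<omega> (b * x))" "Vector_Spaces.linear sV (*) (\<lambda>b. \<omega> (x * b))"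
    using \<omega> by (auto simp: Vector_Spaces.linear_iff algebra_simps
        V.scale_mult_left[symmetric] V.scale_mult_right[symmetric])
  note s = slice_left_add[OF \<omega>] slice_left_ten[OF \<omega>] slice_left_add[OF *(1)]
        slice_left_ten[OF *(1)] slice_left_add[OF *(2)] slice_left_ten[OF *(2)]
        distrib_left distrib_right W.scale_mult_left[symmetric] W.scale_mult_right[symmetric]
        multiplier_props(1,2)
  show "slice_left \<omega> (lact (snd_leg y) t) = y * slice_left \<omega> t"
    "slice_left \<omega> (ract (snd_leg y) t) = slice_left \<omega> t * y"
    "slice_left \<omega> (lact (fst_leg x) t) = slice_left (\<lambda>b. \<omega> (x * b)) t"
    "slice_left \<omega> (ract (fst_leg x) t) = slice_left (\<lambda>b. \<omega> (b * x)) t"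
    by (induct t rule: tensor_induct) (simp_all add: s)
qed

lemma eq_by_fst_leg:
  assumes "\<And>u. lact (fst_leg u) s = lact (fst_leg u) t" shows "s = t"
proof (rule slices_right_separate, rule V.eq_by_left_mult)
  fix \<theta> u assume \<theta>: "Vector_Spaces.linear sW (*) \<theta>"
  show "u * slice_right \<theta> s = u * slice_right \<theta> t"
    using assms by (simp add: slice_right_legs(1)[OF \<theta>, symmetric])
qed

lemma eq_by_snd_leg_right:
  assumes "\<And>u. ract (snd_leg u) s = ract (snd_leg u) t" shows "s = t"
proof (rule slices_left_separate, rule W.eq_by_right_mult)
  fix \<omega> u assume \<omega>: "Vector_Spaces.linear sV (*) \<omega>"
  show "slice_left \<omega> s * u = slice_left \<omega> t * u"
    using assms by (simp add: slice_left_legs(2)[OF \<omega>, symmetric])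
qed

lemma multiplier_eq_by_snd_leg:
  assumes "\<And>u. m * snd_leg u = n * snd_leg u" shows "m = n"
proof (rule T.multiplier_eq_by_ract, rule eq_by_snd_leg_right)
  fix t u
  have "ract (m * snd_leg u) t = ract (n * snd_leg u) t" using assms by simp
  then show "ract (snd_leg u) (ract m t) = ract (snd_leg u) (ract n t)" by simp
qed

definition map_right :: "('w \<Rightarrow> 'w) \<Rightarrow> 't \<Rightarrow> 't"
  where "map_right B = tensor_lift ten sT sT (\<lambda>x y. ten x (B y))"

lemma map_right:
  assumes B: "Vector_Spaces.linear sW sW B"
  shows "map_right B (ten x y) = ten x (B y)" "map_right B (s + t) = map_right B s + map_right B t"
  unfolding map_right_def
  by (rule tensor_lift tensor_lift_add;
      simp add: T.vector_space_axioms ten_add_left ten_add_right ten_scale_left ten_scale_right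
        linear_map_add[OF B] linear_map_scale[OF B])+

definition map_left :: "('v \<Rightarrow> 'v) \<Rightarrow> 't \<Rightarrow> 't"
  where "map_left B = tensor_lift ten sT sT (\<lambda>x y. ten (B x) y)"

lemma map_left:
  assumes B: "Vector_Spaces.linear sV sV B"
  shows "map_left B (ten x y) = ten (B x) y" "map_left B (s + t) = map_left B s + map_left B t"
  unfolding map_left_def
  by (rule tensor_lift tensor_lift_add;
      simp add: T.vector_space_axioms ten_add_left ten_add_right ten_scale_left ten_scale_right
        linear_map_add[OF B] linear_map_scale[OF B])+

lemma map_right_legs:
  assumes B: "Vector_Spaces.linear sW sW B"
  shows "map_right B (lact (fst_leg x) t) = lact (fst_leg x) (map_right B t)"
    and "map_right B (ract (fst_leg x) t) = ract (fst_leg x) (map_right B t)"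
  by (induct t rule: tensor_induct) (simp_all add: map_right[OF B] multiplier_props)

lemma slices_map_right:
  assumes B: "Vector_Spaces.linear sW sW B"
  shows "Vector_Spaces.linear sV (*) \<omega> \<Longrightarrow> slice_left \<omega> (map_right B t) = B (slice_left \<omega> t)"
    and "Vector_Spaces.linear sW (*) \<theta> \<Longrightarrow>
      slice_right \<theta> (map_right B t) = slice_right (\<lambda>y. \<theta> (B y)) t"
proof -
  show "slice_left \<omega> (map_right B t) = B (slice_left \<omega> t)" if \<omega>: "Vector_Spaces.linear sV (*) \<omega>"
    by (induct t rule: tensor_induct) (simp_all add: map_right[OF B] slice_left_add[OF \<omega>]
      slice_left_ten[OF \<omega>] linear_map_add[OF B] linear_map_scale[OF B])
  show "slice_right \<theta> (map_right B t) = slice_right (\<lambda>y. \<theta> (B y)) t"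
    if \<theta>: "Vector_Spaces.linear sW (*) \<theta>"
  proof -
    have *: "Vector_Spaces.linear sW (*) (\<lambda>y. \<theta> (B y))"
      using B \<theta> by (simp add: Vector_Spaces.linear_iff)
    show ?thesis
      by (induct t rule: tensor_induct) (simp_all add: map_right[OF B] slice_right_add[OF \<theta>]
        slice_right_ten[OF \<theta>] slice_right_add[OF *] slice_right_ten[OF *])
  qed
qed

lemma slices_map_left:
  assumes B: "Vector_Spaces.linear sV sV B"
  shows "Vector_Spaces.linear sW (*) \<theta> \<Longrightarrow> slice_right \<theta> (map_left B t) = B (slice_right \<theta> t)"
    and "Vector_Spaces.linear sV (*) \<omega> \<Longrightarrow>
      slice_left \<omega> (map_left B t) = slice_left (\<lambda>y. \<omega> (B y)) t"
proof -
  show "slice_right \<theta> (map_left B t) = B (slice_right \<theta> t)" if \<theta>: "Vector_Spaces.linear sW (*) \<theta>"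
    by (induct t rule: tensor_induct) (simp_all add: map_left[OF B] slice_right_add[OF \<theta>]
      slice_right_ten[OF \<theta>] linear_map_add[OF B] linear_map_scale[OF B])
  show "slice_left \<omega> (map_left B t) = slice_left (\<lambda>y. \<omega> (B y)) t"
    if \<omega>: "Vector_Spaces.linear sV (*) \<omega>"
  proof -
    have *: "Vector_Spaces.linear sV (*) (\<lambda>y. \<omega> (B y))"
      using B \<omega> by (simp add: Vector_Spaces.linear_iff)
    show ?thesis
      by (induct t rule: tensor_induct) (simp_all add: map_left[OF B] slice_left_add[OF \<omega>]
        slice_left_ten[OF \<omega>] slice_left_add[OF *] slice_left_ten[OF *])
  qed
qed

end

section \<open>Coassociativity in terms of slices\<close>

lemma algebra_homD:
  assumes "algebra_hom s s' h"
  shows "h (x + y) = h x + h y" "h (s c x) = s' c (h x)" "h (x * y) = h x * h y"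
  using assms by (auto simp: algebra_hom_def Vector_Spaces.linear_iff)

text \<open>
  The common setting of a Galois object \<open>(X, \<alpha>)\<close> and of the quantum group \<open>(A, \<Delta>)\<close>, which coacts on
  itself. The results below are applied to both.
\<close>

locale covered_coaction =
  A: k_algebra sA + X: k_algebra sX +
  AA: tensor_of_algebras sA sA sAA tAA + XA: tensor_of_algebras sX sA sXA tXA +
  XA_A: tensor_of_algebras sXA sA sXAA tXAL + X_AA: tensor_of_algebras sX sAA sXAA tXAR
  for sA :: "'k::field \<Rightarrow> 'a::ring \<Rightarrow> 'a"
    and sAA :: "'k \<Rightarrow> 'aa::ring \<Rightarrow> 'aa" and tAA :: "'a \<Rightarrow> 'a \<Rightarrow> 'aa"
    and \<Delta> :: "'a \<Rightarrow> 'aa multiplier"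
    and sX :: "'k \<Rightarrow> 'x::ring \<Rightarrow> 'x"
    and sXA :: "'k \<Rightarrow> 'xa::ring \<Rightarrow> 'xa" and tXA :: "'x \<Rightarrow> 'a \<Rightarrow> 'xa"
    and sXAA :: "'k \<Rightarrow> 'xaa::ring \<Rightarrow> 'xaa"
    and tXAL :: "'xa \<Rightarrow> 'a \<Rightarrow> 'xaa" and tXAR :: "'x \<Rightarrow> 'aa \<Rightarrow> 'xaa"
    and \<alpha> :: "'x \<Rightarrow> 'xa multiplier" +
  assumes associator: "tXAL (tXA x a) b = tXAR x (tAA a b)"
    and coproduct_hom: "algebra_hom sA (mscale sAA) \<Delta>"
    and coproduct_span: "module.span sAA {ract (\<Delta> a) w |a w. True} = UNIV"
    and coproduct_covered: "\<Delta> a * mtensor tAA 1 (of_alg b) \<in> range of_alg"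
      "mtensor tAA 1 (of_alg b) * \<Delta> a \<in> range of_alg"
    and coaction_hom: "algebra_hom sX (mscale sXA) \<alpha>"
    and coaction_covered: "\<alpha> x * mtensor tXA 1 (of_alg a) \<in> range of_alg"
      "mtensor tXA 1 (of_alg a) * \<alpha> x \<in> range of_alg"
      "mtensor tXA (of_alg y) 1 * \<alpha> x \<in> range of_alg"
    and coaction_coassociative: "coassociative tXA sXA tXAL tXAR sXAA \<Delta> \<alpha>"
begin

definition right_cover :: "'x \<Rightarrow> 'a \<Rightarrow> 'xa"
  where "right_cover x a = to_alg (\<alpha> x * XA.snd_leg a)"

definition left_cover :: "'a \<Rightarrow> 'x \<Rightarrow> 'xa"
  where "left_cover a x = to_alg (XA.snd_leg a * \<alpha> x)"

definition galois :: "'x \<Rightarrow> 'x \<Rightarrow> 'xa"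
  where "galois u x = to_alg (XA.fst_leg u * \<alpha> x)"

definition coproduct_right_cover :: "'a \<Rightarrow> 'a \<Rightarrow> 'aa"
  where "coproduct_right_cover d a = to_alg (\<Delta> d * AA.snd_leg a)"

definition coproduct_left_cover :: "'a \<Rightarrow> 'a \<Rightarrow> 'aa"
  where "coproduct_left_cover a d = to_alg (AA.snd_leg a * \<Delta> d)"

lemma of_alg_covers:
  "of_alg (right_cover x a) = \<alpha> x * XA.snd_leg a"
  "of_alg (left_cover a x) = XA.snd_leg a * \<alpha> x"
  "of_alg (galois u x) = XA.fst_leg u * \<alpha> x"
  "of_alg (coproduct_right_cover d a) = \<Delta> d * AA.snd_leg a"
  "of_alg (coproduct_left_cover a d) = AA.snd_leg a * \<Delta> d"
  by (simp_all add: right_cover_def left_cover_def galois_def coproduct_right_cover_def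
      coproduct_left_cover_def coaction_covered coproduct_covered
      XA.T.of_alg_to_alg AA.T.of_alg_to_alg)

lemmas hom_simps = algebra_homD[OF coaction_hom] algebra_homD[OF coproduct_hom]
lemmas bilinear_simps =
  distrib_left distrib_right XA.mtensor_add AA.mtensor_add XA.mtensor_scale AA.mtensor_scale
  X.of_alg_add A.of_alg_add XA.T.of_alg_add AA.T.of_alg_add
  X.of_alg_scale A.of_alg_scale XA.T.of_alg_scale AA.T.of_alg_scale
  XA.T.mscale_mult_left XA.T.mscale_mult_right AA.T.mscale_mult_left AA.T.mscale_mult_right

lemma covers_add:
  "right_cover (x + x') a = right_cover x a + right_cover x' a"
  "right_cover x (a + a') = right_cover x a + right_cover x a'"
  "left_cover (a + a') x = left_cover a x + left_cover a' x"
  "left_cover a (x + x') = left_cover a x + left_cover a x'"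
  "galois (u + u') x = galois u x + galois u' x"
  "galois u (x + x') = galois u x + galois u x'"
  by (simp_all add: XA.T.of_alg_inject[symmetric] of_alg_covers bilinear_simps hom_simps)

lemma covers_scale:
  "right_cover (sX c x) a = sXA c (right_cover x a)"
  "right_cover x (sA c a) = sXA c (right_cover x a)"
  "left_cover (sA c a) x = sXA c (left_cover a x)"
  "left_cover a (sX c x) = sXA c (left_cover a x)"
  "galois (sX c u) x = sXA c (galois u x)"
  "galois u (sX c x) = sXA c (galois u x)"
  by (simp_all add: XA.T.of_alg_inject[symmetric] of_alg_covers bilinear_simps hom_simps)

lemma coproduct_covers_add:
  "coproduct_right_cover (d + d') a = coproduct_right_cover d a + coproduct_right_cover d' a"
  "coproduct_right_cover d (a + a') = coproduct_right_cover d a + coproduct_right_cover d a'"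
  "coproduct_left_cover (a + a') d = coproduct_left_cover a d + coproduct_left_cover a' d"
  "coproduct_left_cover a (d + d') = coproduct_left_cover a d + coproduct_left_cover a d'"
  by (simp_all add: AA.T.of_alg_inject[symmetric] of_alg_covers bilinear_simps hom_simps)

lemma coproduct_covers_scale:
  "coproduct_right_cover (sA c d) a = sAA c (coproduct_right_cover d a)"
  "coproduct_right_cover d (sA c a) = sAA c (coproduct_right_cover d a)"
  "coproduct_left_cover (sA c a) d = sAA c (coproduct_left_cover a d)"
  "coproduct_left_cover a (sA c d) = sAA c (coproduct_left_cover a d)"
  by (simp_all add: AA.T.of_alg_inject[symmetric] of_alg_covers bilinear_simps hom_simps)

lemma mult_covers:
  "t * galois u x = ract (\<alpha> x) (ract (XA.fst_leg u) t)"
  "w * coproduct_right_cover d a = ract (AA.snd_leg a) (ract (\<Delta> d) w)"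
  "w * coproduct_left_cover a d = ract (\<Delta> d) (ract (AA.snd_leg a) w)"
  by (metis acts(12) acts_of_alg(2) of_alg_covers)+

lemma ract_coaction_ten: "ract (\<alpha> x) (tXA u b) = lact (XA.snd_leg b) (galois u x)"
proof -
  have "of_alg (ract (\<alpha> x) (tXA u b)) = XA.snd_leg b * XA.fst_leg u * \<alpha> x"
    by (simp add: mult_of_alg[symmetric] XA.legs_mult)
  also have "\<dots> = of_alg (lact (XA.snd_leg b) (galois u x))"
    by (simp add: mult_of_alg[symmetric] of_alg_covers mult.assoc)
  finally show ?thesis by (simp add: XA.T.of_alg_inject)
qed

text \<open>
  With the first leg covered by \<open>u\<close>, these maps send \<open>x\<^sub>0 \<otimes> x\<^sub>1 y\<close> and \<open>u x\<^sub>0 \<otimes> x\<^sub>1\<close> to the two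
  expressions \<open>(u x\<^sub>0\<^sub>0 \<otimes> x\<^sub>0\<^sub>1) \<otimes> x\<^sub>1 y\<close> and \<open>u x\<^sub>0 \<otimes> (x\<^sub>1\<^sub>1 \<otimes> x\<^sub>1\<^sub>2 y)\<close> of coassociativity, for
  \<open>D(d) = \<Delta>(d)(1 \<otimes> y)\<close>.
\<close>

abbreviation "expand_left u \<equiv> tensor_lift tXA sXA sXAA (\<lambda>x y. tXAL (galois u x) y)"

abbreviation "expand_right D \<equiv> tensor_lift tXA sXA sXAA (\<lambda>c d. tXAR c (D d))"

lemma expand_left: "expand_left u (tXA x y) = tXAL (galois u x) y"
  "expand_left u (s + t) = expand_left u s + expand_left u t"
  by (rule XA.tensor_lift XA.tensor_lift_add;
      simp add: XA_A.T.vector_space_axioms covers_add covers_scale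
        XA_A.ten_add_left XA_A.ten_add_right XA_A.ten_scale_left XA_A.ten_scale_right)+

lemma expand_right:
  assumes D: "Vector_Spaces.linear sA sAA D"
  shows "expand_right D (tXA c d) = tXAR c (D d)"
  "expand_right D (s + t) = expand_right D s + expand_right D t"
  by (rule XA.tensor_lift XA.tensor_lift_add;
      simp add: XA_A.T.vector_space_axioms linear_map_add[OF D] linear_map_scale[OF D]
        X_AA.ten_add_left X_AA.ten_add_right X_AA.ten_scale_left X_AA.ten_scale_right)+

lemma coproduct_covers_linear:
  "Vector_Spaces.linear sA sAA (\<lambda>d. coproduct_right_cover d y)"
  "Vector_Spaces.linear sA sAA (coproduct_left_cover y)"
  by (simp_all add: Vector_Spaces.linear_iff coproduct_covers_add coproduct_covers_scale
      A.vector_space_axioms AA.T.vector_space_axioms)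

text \<open>
  Let \<open>n\<close> be the multiplier that represents both sides of coassociativity. Multiplication of \<open>n\<close> by
  \<open>y\<close> in the last leg is described through \<open>\<alpha> \<otimes> \<iota>\<close>. Multiplication by \<open>u\<close> in the first leg is
  described through \<open>\<iota> \<otimes> \<Delta>\<close>, but only after covering the other legs by \<open>\<Delta>(b)\<close>; that covering is
  removed because \<open>(A \<otimes> A)\<Delta>(A)\<close> spans \<open>A \<otimes> A\<close>.
\<close>

lemma coassociativity_covered:
  "expand_left u (right_cover x y) = expand_right (\<lambda>d. coproduct_right_cover d y) (galois u x)"
  "expand_left u (left_cover y x) = expand_right (coproduct_left_cover y) (galois u x)"
proof -
  define H where "H = id_tensor_hom tXA sXA tXAR sXAA \<Delta>"
  define K where "K = hom_tensor_id tXA sXA tXAL sXAA \<alpha>"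
  have H: "H (tXA c d) = mtensor tXAR (of_alg c) (\<Delta> d)" "H (s + t) = H s + H t" for c d s t
    unfolding H_def id_tensor_hom_def
    by (rule XA.tensor_lift XA.tensor_lift_add;
        simp add: XA_A.T.vector_space_mscale X_AA.mtensor_add X_AA.mtensor_scale bilinear_simps hom_simps)+
  have K: "K (tXA c d) = mtensor tXAL (\<alpha> c) (of_alg d)" "K (s + t) = K s + K t" for c d s t
    unfolding K_def hom_tensor_id_def
    by (rule XA.tensor_lift XA.tensor_lift_add;
        simp add: XA_A.T.vector_space_mscale XA_A.mtensor_add XA_A.mtensor_scale bilinear_simps hom_simps)+
  from coaction_coassociative obtain n
    where n: "H w * n = H (ract (\<alpha> x) w)"
      and nr: "n * XA_A.snd_leg a = K (right_cover x a)"
      and nl: "XA_A.snd_leg a * n = K (left_cover a x)" for w a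
    unfolding coassociative_def ext_value_def H_def[symmetric] K_def[symmetric]
      right_cover_def[symmetric] left_cover_def[symmetric] by meson
  have snd: "ract (XA_A.snd_leg y) (tXAR c g) = tXAR c (ract (AA.snd_leg y) g)" for c g
    by (induct g rule: AA.tensor_induct)
      (simp_all add: associator[symmetric] X_AA.ten_add_right multiplier_props)
  have HD: "ract (H (lact (XA.snd_leg b) w)) (tXAR p g) = ract (H w) (tXAR p (ract (\<Delta> b) g))" for b w p g
    by (induct w rule: XA.tensor_induct) (simp_all add: H multiplier_props hom_simps)
  have nt: "ract n (tXAR (p * u) g) = ract (H (galois u x)) (tXAR p g)" for p g
  proof -
    have "g \<in> AA.T.span {ract (\<Delta> a) w |a w. True}" using coproduct_span by simp
    then show ?thesis
    proof (induct rule: AA.T.span_induct_alt)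
      case base
      show ?case by (simp add: act_zero)
    next
      case (step c s t)
      then obtain b g' where s: "s = ract (\<Delta> b) g'" by auto
      have "ract n (tXAR (p * u) s) = ract (H (tXA u b) * n) (tXAR p g')"
        by (simp add: H s)
      also have "\<dots> = ract (H (galois u x)) (tXAR p s)"
        unfolding n ract_coaction_ten by (simp add: HD s)
      finally show ?case using step(2)
        by (simp add: X_AA.ten_add_right X_AA.ten_scale_right multiplier_props XA_A.T.ract_scale)
    qed
  qed
  have KL: "ract (K s) (tXAL (tXA (p * u) a) b) = tXAL (tXA p a) b * expand_left u s" for s p a b
    by (induct s rule: XA.tensor_induct)
      (simp_all add: K expand_left XA_A.ten_mult mult_covers distrib_left)
  have HR: "ract (XA_A.snd_leg y) (ract (H w) (tXAR p (tAA a b))) =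
      tXAR p (tAA a b) * expand_right (\<lambda>d. coproduct_right_cover d y) w" for w p a b
    by (induct w rule: XA.tensor_induct)
      (simp_all add: H snd expand_right[OF coproduct_covers_linear(1)] X_AA.ten_mult mult_covers
        distrib_left multiplier_props)
  have HL: "ract (H w) (tXAR p (tAA a (b * y))) =
      tXAR p (tAA a b) * expand_right (coproduct_left_cover y) w" for w p a b
    by (induct w rule: XA.tensor_induct)
      (simp_all add: H expand_right[OF coproduct_covers_linear(2)] X_AA.ten_mult mult_covers
        distrib_left multiplier_props)
  have eqI: "s = t" if *: "\<And>p a b. tXAR p (tAA a b) * s = tXAR p (tAA a b) * t" for s t
  proof (rule XA_A.T.eq_by_left_mult)
    have "tXAR p g * s = tXAR p g * t" for p g
      by (induct g rule: AA.tensor_induct) (simp_all add: * X_AA.ten_add_right distrib_right)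
    then show "r * s = r * t" for r
      by (induct r rule: X_AA.tensor_induct) (simp_all add: distrib_right)
  qed
  show "expand_left u (right_cover x y) = expand_right (\<lambda>d. coproduct_right_cover d y) (galois u x)"
  proof (rule eqI)
    fix p a b
    have "tXAR p (tAA a b) * expand_left u (right_cover x y) =
        ract (n * XA_A.snd_leg y) (tXAR (p * u) (tAA a b))"
      unfolding nr by (simp add: associator[symmetric] KL)
    then show "tXAR p (tAA a b) * expand_left u (right_cover x y) =
        tXAR p (tAA a b) * expand_right (\<lambda>d. coproduct_right_cover d y) (galois u x)"
      by (simp add: nt HR)
  qed
  show "expand_left u (left_cover y x) = expand_right (coproduct_left_cover y) (galois u x)"
  proof (rule eqI)
    fix p a b
    have "tXAR p (tAA a b) * expand_left u (left_cover y x) =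
        ract (XA_A.snd_leg y * n) (tXAR (p * u) (tAA a b))"
      unfolding nl by (simp add: associator[symmetric] KL)
    then show "tXAR p (tAA a b) * expand_left u (left_cover y x) =
        tXAR p (tAA a b) * expand_right (coproduct_left_cover y) (galois u x)"
      by (simp add: snd nt HL)
  qed
qed

text \<open>
  Apply \<open>\<iota> \<otimes> \<iota> \<otimes> f\<close> to both sides of coassociativity.
\<close>

lemma galois_slice:
  assumes f: "Vector_Spaces.linear sA (*) f"
  shows "galois u (XA.slice_right f (right_cover x y)) =
      XA.map_right (\<lambda>d. AA.slice_right f (coproduct_right_cover d y)) (galois u x)"
    and "galois u (XA.slice_right f (left_cover y x)) =
      XA.map_right (\<lambda>d. AA.slice_right f (coproduct_left_cover y d)) (galois u x)"
proof -
  have 1: "XA_A.slice_right f (tXAR c g) = tXA c (AA.slice_right f g)" for c g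
    by (induct g rule: AA.tensor_induct)
      (simp_all add: associator[symmetric] XA_A.slice_right_ten[OF f] AA.slice_right_ten[OF f]
        XA_A.slice_right_add[OF f] AA.slice_right_add[OF f]
        XA.ten_add_right X_AA.ten_add_right XA.ten_scale_right)
  have 2: "XA_A.slice_right f (expand_left u s) = galois u (XA.slice_right f s)" for s
    by (induct s rule: XA.tensor_induct)
      (simp_all add: expand_left XA_A.slice_right_ten[OF f] XA_A.slice_right_add[OF f]
        XA.slice_right_ten[OF f] XA.slice_right_add[OF f] covers_add covers_scale)
  have 3: "Vector_Spaces.linear sA sA (\<lambda>d. AA.slice_right f (D d))"
    if D: "Vector_Spaces.linear sA sAA D" for D
    using D by (simp add: Vector_Spaces.linear_iff AA.slice_right_add[OF f] AA.slice_right_scale[OF f])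
  have 4: "XA_A.slice_right f (expand_right D s) = XA.map_right (\<lambda>d. AA.slice_right f (D d)) s"
    if D: "Vector_Spaces.linear sA sAA D" for D s
    by (induct s rule: XA.tensor_induct)
      (simp_all add: expand_right[OF D] XA.map_right[OF 3[OF D]] 1 XA_A.slice_right_add[OF f])
  show "galois u (XA.slice_right f (right_cover x y)) =
      XA.map_right (\<lambda>d. AA.slice_right f (coproduct_right_cover d y)) (galois u x)"
    and "galois u (XA.slice_right f (left_cover y x)) =
      XA.map_right (\<lambda>d. AA.slice_right f (coproduct_left_cover y d)) (galois u x)"
    by (simp_all add: 2[symmetric] coassociativity_covered 4 coproduct_covers_linear)
qed

lemma linear_slice_covers:
  assumes f: "Vector_Spaces.linear sA (*) f"
  shows "Vector_Spaces.linear sX sX (\<lambda>x. XA.slice_right f (right_cover x y))"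
    and "Vector_Spaces.linear sX sX (\<lambda>x. XA.slice_right f (left_cover y x))"
  by (simp_all add: Vector_Spaces.linear_iff X.vector_space_axioms covers_add covers_scale
      XA.slice_right_add[OF f] XA.slice_right_scale[OF f])

lemma cover_legs:
  "ract (XA.snd_leg a) (galois u x) = lact (XA.fst_leg u) (right_cover x a)"
  "lact (XA.fst_leg u) (left_cover a x) = lact (XA.snd_leg a) (galois u x)"
  "ract (XA.snd_leg b) (left_cover a x) = lact (XA.snd_leg a) (right_cover x b)"
  "lact (\<alpha> x) (tXA u a) = ract (XA.fst_leg u) (right_cover x a)"
  "ract (\<alpha> x) (tXA u a) = lact (XA.fst_leg u) (left_cover a x)"
proof -
  have *: "of_alg (tXA u a) * m = XA.fst_leg u * (XA.snd_leg a * m)"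
    "of_alg (tXA u a) * m = XA.snd_leg a * (XA.fst_leg u * m)" for m
    by (simp_all add: XA.legs_mult mult.assoc[symmetric])
  have **: "m * of_alg (tXA u a) = m * XA.snd_leg a * XA.fst_leg u" for m
    by (simp add: XA.legs_mult mult.assoc)
  show "ract (XA.snd_leg a) (galois u x) = lact (XA.fst_leg u) (right_cover x a)"
    "ract (XA.snd_leg b) (left_cover a x) = lact (XA.snd_leg a) (right_cover x b)"
    by (simp_all add: XA.T.of_alg_inject[symmetric] mult_of_alg[symmetric] of_alg_covers mult.assoc)
  show "lact (XA.fst_leg u) (left_cover a x) = lact (XA.snd_leg a) (galois u x)"
    "ract (\<alpha> x) (tXA u a) = lact (XA.fst_leg u) (left_cover a x)"
    by (simp_all add: XA.T.of_alg_inject[symmetric] mult_of_alg[symmetric] of_alg_covers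
        *[symmetric] XA.legs_mult mult.assoc[symmetric])
  show "lact (\<alpha> x) (tXA u a) = ract (XA.fst_leg u) (right_cover x a)"
    by (simp add: XA.T.of_alg_inject[symmetric] mult_of_alg[symmetric] of_alg_covers **)
qed

lemma coaction_covers:
  "ract (\<alpha> z) (galois u x) = galois u (x * z)"
  "ract (\<alpha> z) (left_cover a x) = left_cover a (x * z)"
  "lact (\<alpha> z) (right_cover x a) = right_cover (z * x) a"
  by (simp_all add: XA.T.of_alg_inject[symmetric] mult_of_alg[symmetric] of_alg_covers hom_simps
      mult.assoc)

text \<open>
  With \<open>\<Delta>(p)(q \<otimes> 1) = c \<otimes> y\<close>, invariance of \<open>\<phi>\<close> computes \<open>\<alpha>(x\<^sub>0 \<phi>(x\<^sub>1 y))(1 \<otimes> c)\<close> as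
  \<open>x\<^sub>0 \<otimes> x\<^sub>1 p\<^sub>1 q \<phi>(x\<^sub>2 p\<^sub>2) = x\<^sub>0 \<phi>(x\<^sub>1 p) \<otimes> q\<close>. The hypothesis on \<open>s = p \<otimes> q\<close> is all that this uses of
  that relation: it says \<open>d\<^sub>1 c \<phi>(d\<^sub>2 y) = \<phi>(d p) q\<close>.
\<close>

lemma right_cover_slice:
  assumes \<phi>: "Vector_Spaces.linear sA (*) \<phi>"
    and s: "\<And>d. AA.slice_right \<phi> (coproduct_right_cover d y) * c = AA.slice_left (\<lambda>p. \<phi> (d * p)) s"
  shows "right_cover (XA.slice_right \<phi> (right_cover x y)) c =
    tensor_lift tAA sAA sXA (\<lambda>p q. tXA (XA.slice_right \<phi> (right_cover x p)) q) s"
proof (rule XA.eq_by_fst_leg)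
  fix u
  define G where "G w = tensor_lift tAA sAA sXA
    (\<lambda>p q. tXA (XA.slice_right \<phi> (ract (XA.snd_leg p) w)) q)" for w
  define H where "H = tensor_lift tAA sAA sXA (\<lambda>p q. tXA (XA.slice_right \<phi> (right_cover x p)) q)"
  note slice = XA.slice_right_add[OF \<phi>] XA.slice_right_scale[OF \<phi>]
  have H: "H (tAA p q) = tXA (XA.slice_right \<phi> (right_cover x p)) q" "H (t + t') = H t + H t'" for p q t t'
    unfolding H_def
    by (rule AA.tensor_lift AA.tensor_lift_add; simp add: XA.T.vector_space_axioms covers_add
        covers_scale slice XA.ten_add_left XA.ten_add_right XA.ten_scale_left XA.ten_scale_right)+
  have snd_leg: "ract (XA.snd_leg (p + p')) w = ract (XA.snd_leg p) w + ract (XA.snd_leg p') w"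
    "ract (XA.snd_leg (sA k p)) w = sXA k (ract (XA.snd_leg p) w)" for p p' w k
    by (simp_all add: bilinear_simps XA.T.ract_mscale)
  have G: "G w (tAA p q) = tXA (XA.slice_right \<phi> (ract (XA.snd_leg p) w)) q"
    "G w (t + t') = G w t + G w t'" for w p q t t'
    unfolding G_def
    by (rule AA.tensor_lift AA.tensor_lift_add; simp add: XA.T.vector_space_axioms snd_leg
        slice XA.ten_add_left XA.ten_add_right XA.ten_scale_left XA.ten_scale_right)+
  have Gadd: "G (w + w') t = G w t + G w' t" for w w' t
    by (induct t rule: AA.tensor_induct)
      (simp_all add: G multiplier_props slice XA.ten_add_left)
  have Gten: "G (tXA v d) t = tXA v (AA.slice_left (\<lambda>p. \<phi> (d * p)) t)" for v d t
  proof -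
    note lin = A.linear_mult_functional(2)[OF \<phi>, of d]
    show ?thesis
      by (induct t rule: AA.tensor_induct)
        (simp_all add: G XA.slice_right_ten[OF \<phi>] AA.slice_left_ten[OF lin]
          AA.slice_left_add[OF lin] XA.ten_add_right XA.ten_scale_left XA.ten_scale_right)
  qed
  have B: "Vector_Spaces.linear sA sA (\<lambda>d. AA.slice_right \<phi> (coproduct_right_cover d y))"
    by (simp add: Vector_Spaces.linear_iff A.vector_space_axioms coproduct_covers_add
        coproduct_covers_scale AA.slice_right_add[OF \<phi>] AA.slice_right_scale[OF \<phi>])
  have "ract (XA.snd_leg c) (XA.map_right (\<lambda>d. AA.slice_right \<phi> (coproduct_right_cover d y)) w)
      = G w s" for w
    by (induct w rule: XA.tensor_induct)
      (simp_all add: XA.map_right[OF B] Gadd Gten s multiplier_props)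
  moreover have "G (galois u x) t = lact (XA.fst_leg u) (H t)" for t
    by (induct t rule: AA.tensor_induct)
      (simp_all add: G H cover_legs(1) XA.slice_right_legs[OF \<phi>] multiplier_props)
  ultimately show "lact (XA.fst_leg u) (right_cover (XA.slice_right \<phi> (right_cover x y)) c) =
      lact (XA.fst_leg u) (tensor_lift tAA sAA sXA
        (\<lambda>p q. tXA (XA.slice_right \<phi> (right_cover x p)) q) s)"
    by (simp add: cover_legs(1)[symmetric] galois_slice[OF \<phi>] H_def)
qed

end

section \<open>The Galois maps of an algebraic quantum group\<close>

locale quantum_group =
  A: k_algebra sA + AA: tensor_of_algebras sA sA sAA tAA
  for sA :: "'k::field \<Rightarrow> 'a::ring \<Rightarrow> 'a"
    and sAA :: "'k \<Rightarrow> 'aa::ring \<Rightarrow> 'aa" and tAA :: "'a \<Rightarrow> 'a \<Rightarrow> 'aa"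
    and sAAA :: "'k \<Rightarrow> 'aaa::ring \<Rightarrow> 'aaa"
    and tAAL :: "'aa \<Rightarrow> 'a \<Rightarrow> 'aaa" and tAAR :: "'a \<Rightarrow> 'aa \<Rightarrow> 'aaa"
    and \<Delta> :: "'a \<Rightarrow> 'aa multiplier" and \<phi> :: "'a \<Rightarrow> 'k" +
  assumes algebraic_quantum_group: "algebraic_quantum_group sA sAA tAA sAAA tAAL tAAR \<Delta> \<phi>"
begin

lemma regular_hopf: "regular_multiplier_hopf_algebra sA sAA tAA sAAA tAAL tAAR \<Delta>"
  using algebraic_quantum_group by (simp add: algebraic_quantum_group_def)

lemma triple: "triple_algebra_tensor sA sA sA sAA sAA sAAA tAA tAA tAAL tAAR"
  using regular_hopf by (simp add: regular_multiplier_hopf_algebra_def)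

lemmas \<Delta>_hom = regular_multiplier_hopf_algebra.\<Delta>_hom[OF regular_hopf]
lemmas galois_maps = regular_multiplier_hopf_algebra.galois_maps[OF regular_hopf]
lemmas \<phi>_linear = algebraic_quantum_group.\<phi>_linear[OF algebraic_quantum_group]

lemmas bilinear_simps =
  distrib_left distrib_right AA.mtensor_add AA.mtensor_scale A.of_alg_add AA.T.of_alg_add
  A.of_alg_scale AA.T.of_alg_scale AA.T.mscale_mult_left AA.T.mscale_mult_right
  algebra_homD[OF \<Delta>_hom]

lemma \<Delta>_covered:
  "\<Delta> a * AA.snd_leg b \<in> range of_alg" "AA.fst_leg a * \<Delta> b \<in> range of_alg"
  "\<Delta> a * AA.fst_leg b \<in> range of_alg" "AA.snd_leg a * \<Delta> b \<in> range of_alg"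
proof -
  have *: "f a b \<in> range of_alg"
    if "bij_betw (tensor_lift tAA sAA (mscale sAA) f) UNIV (range of_alg)"
      "\<And>x x' y. f (x + x') y = f x y + f x' y" "\<And>x y y'. f x (y + y') = f x y + f x y'"
      "\<And>c x y. f (sA c x) y = mscale sAA c (f x y)" "\<And>c x y. f x (sA c y) = mscale sAA c (f x y)"
    for f
    using bij_betw_imp_surj_on[OF that(1)]
      AA.tensor_lift(2)[OF AA.T.vector_space_mscale that(2-5), of a b]
    by (metis rangeI)
  show "\<Delta> a * AA.snd_leg b \<in> range of_alg"
    by (rule *[OF galois_maps(1)]) (simp_all add: bilinear_simps)
  show "AA.fst_leg a * \<Delta> b \<in> range of_alg"
    by (rule *[OF galois_maps(2)]) (simp_all add: bilinear_simps)
  show "\<Delta> a * AA.fst_leg b \<in> range of_alg"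
    by (rule *[OF galois_maps(3)]) (simp_all add: bilinear_simps)
  show "AA.snd_leg a * \<Delta> b \<in> range of_alg"
    by (rule *[OF galois_maps(4)]) (simp_all add: bilinear_simps)
qed

sublocale D: covered_coaction sA sAA tAA \<Delta> sA sAA tAA sAAA tAAL tAAR \<Delta>
proof -
  interpret t: triple_algebra_tensor sA sA sA sAA sAA sAAA tAA tAA tAAL tAAR by (rule triple)
  interpret XA_A: tensor_of_algebras sAA sA sAAA tAAL
    by (intro tensor_of_algebras.intro A.k_algebra_axioms AA.T.k_algebra_axioms
        t.XY_Z.algebra_tensor_axioms)
  interpret X_AA: tensor_of_algebras sA sAA sAAA tAAR
    by (intro tensor_of_algebras.intro A.k_algebra_axioms AA.T.k_algebra_axioms
        t.X_YZ.algebra_tensor_axioms)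
  show "covered_coaction sA sAA tAA \<Delta> sA sAA tAA sAAA tAAL tAAR \<Delta>"
    by unfold_locales (use t.associator \<Delta>_hom \<Delta>_covered
        regular_multiplier_hopf_algebra.\<Delta>_nondegenerate(2)[OF regular_hopf]
        regular_multiplier_hopf_algebra.\<Delta>_coassociative[OF regular_hopf] in simp_all)
qed

lemma coproduct_covers [simp]:
  "D.coproduct_right_cover = D.right_cover" "D.coproduct_left_cover = D.left_cover"
  by (simp_all add: fun_eq_iff D.coproduct_right_cover_def D.coproduct_left_cover_def
      D.right_cover_def D.left_cover_def)

definition reverse_galois :: "'a \<Rightarrow> 'a \<Rightarrow> 'aa"
  where "reverse_galois d c = to_alg (\<Delta> d * AA.fst_leg c)"

lemma of_alg_reverse_galois: "of_alg (reverse_galois d c) = \<Delta> d * AA.fst_leg c"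
  by (simp add: reverse_galois_def \<Delta>_covered AA.T.of_alg_to_alg)

lemma reverse_galois_add:
  "reverse_galois (d + d') c = reverse_galois d c + reverse_galois d' c"
  "reverse_galois d (c + c') = reverse_galois d c + reverse_galois d c'"
  by (simp_all add: AA.T.of_alg_inject[symmetric] of_alg_reverse_galois bilinear_simps)

lemma reverse_galois_scale:
  "reverse_galois (sA k d) c = sAA k (reverse_galois d c)"
  "reverse_galois d (sA k c) = sAA k (reverse_galois d c)"
  by (simp_all add: AA.T.of_alg_inject[symmetric] of_alg_reverse_galois bilinear_simps)

lemma reverse_galois_legs:
  "lact (AA.fst_leg u) (reverse_galois d c) = ract (AA.fst_leg c) (D.galois u d)"
  "ract (AA.snd_leg y) (reverse_galois d c) = ract (AA.fst_leg c) (D.right_cover d y)"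
  "lact (AA.snd_leg y) (reverse_galois d c) = ract (AA.fst_leg c) (D.left_cover y d)"
  "lact (\<Delta> z) (reverse_galois d c) = reverse_galois (z * d) c"
  "lact (\<Delta> d) (tAA c y) = ract (AA.snd_leg y) (reverse_galois d c)"
proof -
  have **: "m * of_alg (tAA u a) = m * AA.snd_leg a * AA.fst_leg u"
    "m * of_alg (tAA u a) = m * AA.fst_leg u * AA.snd_leg a" for m u a
    by (simp_all add: AA.legs_mult mult.assoc)
  show "lact (AA.fst_leg u) (reverse_galois d c) = ract (AA.fst_leg c) (D.galois u d)"
    "lact (AA.snd_leg y) (reverse_galois d c) = ract (AA.fst_leg c) (D.left_cover y d)"
    "lact (\<Delta> z) (reverse_galois d c) = reverse_galois (z * d) c"
    by (simp_all add: AA.T.of_alg_inject[symmetric] mult_of_alg[symmetric] of_alg_reverse_galois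
        D.of_alg_covers mult.assoc algebra_homD[OF \<Delta>_hom])
  show "lact (\<Delta> d) (tAA c y) = ract (AA.snd_leg y) (reverse_galois d c)"
    by (simp add: AA.T.of_alg_inject[symmetric] mult_of_alg[symmetric] of_alg_reverse_galois **(2))
  show "ract (AA.snd_leg y) (reverse_galois d c) = ract (AA.fst_leg c) (D.right_cover d y)"
    by (simp add: AA.T.of_alg_inject[symmetric] mult_of_alg[symmetric] of_alg_reverse_galois
        D.of_alg_covers **[symmetric])
qed

definition "galois_lift = tensor_lift tAA sAA sAA D.galois"
definition "right_lift = tensor_lift tAA sAA sAA D.right_cover"
definition "reverse_lift = tensor_lift tAA sAA sAA reverse_galois"
definition "left_lift = tensor_lift tAA sAA sAA D.left_cover"
definition "mult_lift = tensor_lift tAA sAA sA (*)"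

lemma lift_ten:
  "galois_lift (tAA x y) = D.galois x y" "right_lift (tAA x y) = D.right_cover x y"
  "reverse_lift (tAA x y) = reverse_galois x y" "left_lift (tAA x y) = D.left_cover x y"
  "mult_lift (tAA x y) = x * y"
  unfolding galois_lift_def right_lift_def reverse_lift_def left_lift_def mult_lift_def
  by (rule AA.tensor_lift; simp add: AA.T.vector_space_axioms A.vector_space_axioms D.covers_add
      D.covers_scale reverse_galois_add reverse_galois_scale distrib_left distrib_right
      A.scale_mult_left[symmetric] A.scale_mult_right[symmetric])+

lemma lift_linear:
  "Vector_Spaces.linear sAA sAA galois_lift" "Vector_Spaces.linear sAA sAA right_lift"
  "Vector_Spaces.linear sAA sAA reverse_lift" "Vector_Spaces.linear sAA sAA left_lift"
  "Vector_Spaces.linear sAA sA mult_lift"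
  unfolding galois_lift_def right_lift_def reverse_lift_def left_lift_def mult_lift_def
  by (rule AA.tensor_lift; simp add: AA.T.vector_space_axioms A.vector_space_axioms D.covers_add
      D.covers_scale reverse_galois_add reverse_galois_scale distrib_left distrib_right
      A.scale_mult_left[symmetric] A.scale_mult_right[symmetric])+

lemma lift_bij: "bij galois_lift" "bij right_lift" "bij reverse_lift" "bij left_lift"
proof -
  note s = AA.T.k_algebra_axioms D.covers_add D.covers_scale reverse_galois_add
    reverse_galois_scale D.of_alg_covers of_alg_reverse_galois
  show "bij galois_lift"
    unfolding galois_lift_def by (rule AA.bij_lift_of_bij_betw[OF _ _ _ _ _ _ galois_maps(2)])
      (simp_all add: s)
  show "bij right_lift"
    unfolding right_lift_def by (rule AA.bij_lift_of_bij_betw[OF _ _ _ _ _ _ galois_maps(1)])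
      (simp_all add: s)
  show "bij reverse_lift"
    unfolding reverse_lift_def by (rule AA.bij_lift_of_bij_betw[OF _ _ _ _ _ _ galois_maps(3)])
      (simp_all add: s)
  show "bij left_lift"
    unfolding left_lift_def by (rule AA.bij_lift_of_bij_betw[OF _ _ _ _ _ _ galois_maps(4)])
      (simp_all add: s)
qed

text \<open>
  In terms of the antipode these inverses are \<open>r \<otimes> a \<mapsto> r S(a\<^sub>1) \<otimes> a\<^sub>2\<close>,
  \<open>a \<otimes> c \<mapsto> a\<^sub>1 \<otimes> S(a\<^sub>2) c\<close>, \<open>c \<otimes> a \<mapsto> a\<^sub>2 \<otimes> S\<^sup>-\<^sup>1(a\<^sub>1) c\<close> and
  \<open>b \<otimes> a \<mapsto> a S\<^sup>-\<^sup>1(b\<^sub>2) \<otimes> b\<^sub>1\<close>. Counit and antipode are read off from the first three.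
\<close>

abbreviation "galois_inv \<equiv> inv galois_lift"
abbreviation "right_inv \<equiv> inv right_lift"
abbreviation "reverse_inv \<equiv> inv reverse_lift"
abbreviation "left_inv \<equiv> inv left_lift"

lemmas inv_linear = linear_inv[OF lift_linear(1) lift_bij(1)] linear_inv[OF lift_linear(2) lift_bij(2)]
  linear_inv[OF lift_linear(3) lift_bij(3)] linear_inv[OF lift_linear(4) lift_bij(4)]

lemmas lift_add = lift_linear[THEN linear_map_add] inv_linear[THEN linear_map_add]
lemmas lift_scale = lift_linear[THEN linear_map_scale] inv_linear[THEN linear_map_scale]

lemma lift_inv [simp]:
  "galois_lift (galois_inv t) = t" "right_lift (right_inv t) = t"
  "reverse_lift (reverse_inv t) = t" "left_lift (left_inv t) = t"
  "galois_inv (galois_lift t) = t" "right_inv (right_lift t) = t"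
  "reverse_inv (reverse_lift t) = t" "left_inv (left_lift t) = t"
  using lift_bij by (simp_all add: bij_is_surj surj_f_inv_f bij_is_inj inv_f_f)

text \<open>
  The condition stands for \<open>\<Delta>(B(d)) = (\<iota> \<otimes> B)(\<Delta>(d))\<close>, with the first leg covered. Slices of the
  last leg have this property, and it lets them pass through the inverses of the Galois maps.
\<close>

definition colinear :: "('a \<Rightarrow> 'a) \<Rightarrow> bool"
  where "colinear B \<longleftrightarrow> Vector_Spaces.linear sA sA B \<and>
    (\<forall>u d. D.galois u (B d) = AA.map_right B (D.galois u d))"

lemma colinear_slices:
  assumes f: "Vector_Spaces.linear sA (*) f"
  shows "colinear (\<lambda>d. AA.slice_right f (D.right_cover d y))"
    and "colinear (\<lambda>d. AA.slice_right f (D.left_cover y d))"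
  unfolding colinear_def using D.linear_slice_covers[OF f] D.galois_slice[OF f] by simp_all

lemma galois_inv_colinear:
  assumes "colinear B"
  shows "galois_inv (tAA r (B a)) = AA.map_right B (galois_inv (tAA r a))"
proof -
  have B: "Vector_Spaces.linear sA sA B" using assms by (simp add: colinear_def)
  have "galois_lift (AA.map_right B s) = AA.map_right B (galois_lift s)" for s
    by (induct s rule: AA.tensor_induct)
      (use assms in \<open>simp_all add: colinear_def AA.map_right[OF B] lift_ten lift_add\<close>)
  from this[of "galois_inv (tAA r a)"] show ?thesis
    by (metis AA.map_right(1)[OF B] lift_inv(1,5))
qed

lemma reverse_galois_colinear:
  assumes "colinear B"
  shows "reverse_galois (B d) c = AA.map_right B (reverse_galois d c)"
proof (rule AA.eq_by_fst_leg)
  fix u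
  have B: "Vector_Spaces.linear sA sA B" using assms by (simp add: colinear_def)
  show "lact (AA.fst_leg u) (reverse_galois (B d) c) =
      lact (AA.fst_leg u) (AA.map_right B (reverse_galois d c))"
    using assms
    by (simp add: reverse_galois_legs(1) AA.map_right_legs[OF B, symmetric] colinear_def)
qed

lemma reverse_inv_colinear:
  assumes "colinear B"
  shows "reverse_inv (tAA c (B a)) = AA.map_left B (reverse_inv (tAA c a))"
proof -
  have B: "Vector_Spaces.linear sA sA B" using assms by (simp add: colinear_def)
  have "reverse_lift (AA.map_left B s) = AA.map_right B (reverse_lift s)" for s
    by (induct s rule: AA.tensor_induct)
      (simp_all add: AA.map_right[OF B] AA.map_left[OF B] lift_ten lift_add
        reverse_galois_colinear[OF assms])
  from this[of "reverse_inv (tAA c a)"] show ?thesis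
    by (metis AA.map_right(1)[OF B] lift_inv(3,7))
qed

text \<open>
  Slices of the first leg commute with slices of the last leg. This is the mirror image of the
  colinearity of the latter, and follows from it by slicing.
\<close>

lemma right_cover_left_slice:
  assumes \<omega>: "Vector_Spaces.linear sA (*) \<omega>"
  shows "D.right_cover (AA.slice_left \<omega> (D.galois b a)) y =
    AA.map_left (\<lambda>a. AA.slice_left \<omega> (D.galois b a)) (D.right_cover a y)"
proof (rule AA.slices_right_separate)
  fix f assume f: "Vector_Spaces.linear sA (*) f"
  define B where "B d = AA.slice_right f (D.right_cover d y)" for d
  have cB: "colinear B" unfolding B_def by (rule colinear_slices[OF f])
  then have B: "Vector_Spaces.linear sA sA B" by (simp add: colinear_def)
  have C: "Vector_Spaces.linear sA sA (\<lambda>a. AA.slice_left \<omega> (D.galois b a))"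
    by (simp add: Vector_Spaces.linear_iff A.vector_space_axioms D.covers_add D.covers_scale
        AA.slice_left_add[OF \<omega>] AA.slice_left_scale[OF \<omega>])
  have "AA.slice_right f (D.right_cover (AA.slice_left \<omega> (D.galois b a)) y) =
      AA.slice_left \<omega> (D.galois b (B a))"
    using cB by (simp add: colinear_def AA.slices_map_right(1)[OF B \<omega>] B_def)
  then show "AA.slice_right f (D.right_cover (AA.slice_left \<omega> (D.galois b a)) y) =
      AA.slice_right f (AA.map_left (\<lambda>a. AA.slice_left \<omega> (D.galois b a)) (D.right_cover a y))"
    by (simp add: AA.slices_map_left(1)[OF C f] B_def)
qed

lemma right_inv_left_slice:
  assumes \<omega>: "Vector_Spaces.linear sA (*) \<omega>"
  shows "right_inv (tAA (AA.slice_left \<omega> (D.galois b a)) c) =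
    AA.map_left (\<lambda>a. AA.slice_left \<omega> (D.galois b a)) (right_inv (tAA a c))"
proof -
  define C where "C a = AA.slice_left \<omega> (D.galois b a)" for a
  have C: "Vector_Spaces.linear sA sA C"
    by (simp add: Vector_Spaces.linear_iff A.vector_space_axioms D.covers_add D.covers_scale
        AA.slice_left_add[OF \<omega>] AA.slice_left_scale[OF \<omega>] C_def)
  have "D.right_cover (C a) y = AA.map_left C (D.right_cover a y)" for a y
    using right_cover_left_slice[OF \<omega>] by (simp add: C_def[abs_def])
  then have "right_lift (AA.map_left C s) = AA.map_left C (right_lift s)" for s
    by (induct s rule: AA.tensor_induct) (simp_all add: AA.map_left[OF C] lift_ten lift_add)
  from this[of "right_inv (tAA a c)"] have "right_inv (tAA (C a) c) = AA.map_left C (right_inv (tAA a c))"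
    by (metis AA.map_left(1)[OF C] lift_inv(2,6))
  then show ?thesis by (simp add: C_def[abs_def])
qed

section \<open>The counit\<close>

text \<open>
  A functional and an element on which it is \<open>1\<close>. For any such pair \<open>(f, b)\<close> the formula for the
  counit below is \<open>f(\<epsilon>(a) b) = \<epsilon>(a)\<close>, because multiplying out the inverse image of \<open>a \<otimes> b\<close> under
  \<open>x \<otimes> y \<mapsto> \<Delta>(x)(1 \<otimes> y)\<close> gives \<open>\<epsilon>(a) b\<close>.
\<close>

definition counit_witness :: "('a \<Rightarrow> 'k) \<times> 'a"
  where "counit_witness = (SOME (f, b). Vector_Spaces.linear sA (*) f \<and> f b = 1)"

definition counit :: "'a \<Rightarrow> 'k"
  where "counit a = fst counit_witness (mult_lift (right_inv (tAA a (snd counit_witness))))"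

lemma counit_witness:
  "Vector_Spaces.linear sA (*) (fst counit_witness)" "fst counit_witness (snd counit_witness) = 1"
proof -
  obtain b :: 'a where "b \<noteq> 0" using A.nonzero by blast
  then obtain f where "Vector_Spaces.linear sA (*) f" "f b = 1"
    by (rule separating_functional[OF A.vector_space_axioms])
  then have "\<exists>w. case w of (f, b) \<Rightarrow> Vector_Spaces.linear sA (*) f \<and> f b = 1"
    by (intro exI[of _ "(f, b)"]) simp
  then have "case counit_witness of (f, b) \<Rightarrow> Vector_Spaces.linear sA (*) f \<and> f b = 1"
    unfolding counit_witness_def by (rule someI_ex)
  then show "Vector_Spaces.linear sA (*) (fst counit_witness)"
    "fst counit_witness (snd counit_witness) = 1" by (auto split: prod.splits)
qed

text \<open>
  In Sweedler notation, the inverse of \<open>d \<otimes> c \<mapsto> d\<^sub>1 c \<otimes> d\<^sub>2\<close> sends \<open>c \<otimes> a\<close> to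
  \<open>a\<^sub>2 \<otimes> S\<^sup>-\<^sup>1(a\<^sub>1) c\<close>, and its two legs multiply to \<open>\<epsilon>(a) c\<close>. For \<open>a = x\<^sub>1 f(x\<^sub>2 y)\<close> the answer is
  \<open>f(x y) c\<close>, a scalar multiple of \<open>c\<close> with a factor that does not depend on \<open>c\<close>; this is what
  makes the counit well defined.
\<close>

lemma mult_reverse_inv_slice:
  assumes f: "Vector_Spaces.linear sA (*) f"
  shows "mult_lift (reverse_inv (tAA c (AA.slice_right f (right_lift s)))) = sA (f (mult_lift s)) c"
proof (induct s rule: AA.tensor_induct)
  case (ten a y)
  define B where "B d = AA.slice_right f (D.right_cover d y)" for d
  have cB: "colinear B" unfolding B_def by (rule colinear_slices[OF f])
  then have B: "Vector_Spaces.linear sA sA B" by (simp add: colinear_def)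
  have "mult_lift (AA.map_left B s) = AA.slice_right f (ract (AA.snd_leg y) (reverse_lift s))" for s
    by (induct s rule: AA.tensor_induct)
      (simp_all add: AA.map_left[OF B] lift_ten lift_add multiplier_props AA.slice_right_add[OF f]
        reverse_galois_legs(2) AA.slice_right_legs(2)[OF f] B_def[symmetric])
  then have "mult_lift (reverse_inv (tAA c (B a))) =
      AA.slice_right f (ract (AA.snd_leg y) (tAA c a))"
    by (simp add: reverse_inv_colinear[OF cB])
  then show ?case by (simp add: lift_ten AA.slice_right_ten[OF f] B_def)
next
  case (add s t)
  then show ?case
    by (simp add: lift_add AA.slice_right_add[OF f] AA.ten_add_right linear_map_add[OF f]
        A.scale_left_distrib)
qed

lemma mult_reverse_inv: "mult_lift (reverse_inv (tAA c a)) = sA (counit a) c"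
  using mult_reverse_inv_slice[OF counit_witness(1), of c "right_inv (tAA a (snd counit_witness))"]
  by (simp add: AA.slice_right_ten[OF counit_witness(1)] counit_witness(2) counit_def)

lemma counit_linear: "Vector_Spaces.linear sA (*) counit"
proof -
  have "counit (a + a') = counit a + counit a'" "counit (sA k a) = k * counit a" for a a' k
    by (simp_all add: counit_def AA.ten_add_left AA.ten_scale_left lift_add lift_scale
        linear_map_add[OF counit_witness(1)] linear_map_scale[OF counit_witness(1)])
  then show ?thesis
    by (simp add: Vector_Spaces.linear_iff A.vector_space_axioms vector_space_mult)
qed

lemma counit_right_lift: "AA.slice_left counit (right_lift s) = mult_lift s"
proof (rule functionals_separate[OF A.vector_space_axioms])
  fix f assume f: "Vector_Spaces.linear sA (*) f"
  obtain c :: 'a where c: "c \<noteq> 0" using A.nonzero by blast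
  have "sA (counit (AA.slice_right f (right_lift s))) c = sA (f (mult_lift s)) c"
    by (simp add: mult_reverse_inv[symmetric] mult_reverse_inv_slice[OF f])
  then have "counit (AA.slice_right f (right_lift s)) = f (mult_lift s)"
    using c A.scale_cancel_right by blast
  then show "f (AA.slice_left counit (right_lift s)) = f (mult_lift s)"
    by (simp add: AA.slices_commute[OF counit_linear f])
qed

lemmas slice_counit = AA.slice_left_add[OF counit_linear] AA.slice_left_ten[OF counit_linear]
  AA.slice_right_add[OF counit_linear] AA.slice_right_ten[OF counit_linear]

lemma counit_reverse_lift: "AA.slice_right counit (reverse_lift s) = mult_lift s"
proof -
  have "AA.slice_right counit t = mult_lift (reverse_inv t)" for t
    by (induct t rule: AA.tensor_induct) (simp_all add: slice_counit mult_reverse_inv lift_add)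
  from this[of "reverse_lift s"] show ?thesis by simp
qed

lemma counit_laws:
  "AA.slice_left counit (D.right_cover a y) = a * y"
  "AA.slice_right counit (reverse_galois a y) = a * y"
  "AA.slice_right counit (D.galois c a) = c * a"
  "AA.slice_left counit (D.left_cover z y) = z * y"
proof -
  show 1: "AA.slice_left counit (D.right_cover a y) = a * y" for a y
    using counit_right_lift[of "tAA a y"] by (simp add: lift_ten)
  show 2: "AA.slice_right counit (reverse_galois a y) = a * y" for a y
    using counit_reverse_lift[of "tAA a y"] by (simp add: lift_ten)
  show "AA.slice_right counit (D.galois c a) = c * a"
  proof (rule A.eq_by_right_mult)
    fix x
    show "AA.slice_right counit (D.galois c a) * x = c * a * x"
      by (simp add: AA.slice_right_legs[OF counit_linear, symmetric]
          reverse_galois_legs(1)[symmetric])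
        (simp add: AA.slice_right_legs[OF counit_linear] 2 mult.assoc)
  qed
  show "AA.slice_left counit (D.left_cover z y) = z * y"
  proof (rule A.eq_by_right_mult)
    fix x
    show "AA.slice_left counit (D.left_cover z y) * x = z * y * x"
      by (simp add: AA.slice_left_legs[OF counit_linear, symmetric] D.cover_legs(3))
        (simp add: AA.slice_left_legs[OF counit_linear] 1 mult.assoc)
  qed
qed

lemma counit_galois_lift: "AA.slice_right counit (galois_lift s) = mult_lift s"
  by (induct s rule: AA.tensor_induct) (simp_all add: lift_ten lift_add slice_counit counit_laws)

lemma mult_inv: "mult_lift (galois_inv t) = AA.slice_right counit t"
  "mult_lift (right_inv t) = AA.slice_left counit t"
  using counit_galois_lift[of "galois_inv t"] counit_right_lift[of "right_inv t"] by simp_all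

text \<open>
  Apply \<open>\<iota> \<otimes> \<epsilon>\<close> to \<open>(d \<otimes> e)\<Delta>(b)\<close>. It gives \<open>\<epsilon>(e) d b\<close>, as one sees by writing \<open>d \<otimes> e\<close> as a sum of
  \<open>(c \<otimes> 1)\<Delta>(a)\<close>; and \<open>(d \<otimes> 1)\<Delta>(b)\<close> can in turn be any tensor \<open>r \<otimes> b\<close>.
\<close>

lemma counit_mult: "counit (e * b) = counit e * counit b"
proof -
  have 1: "AA.slice_right counit (ract (\<Delta> b) (galois_lift s)) =
      AA.slice_right counit (galois_lift s) * b" for s b
    by (induct s rule: AA.tensor_induct)
      (simp_all add: lift_ten lift_add multiplier_props slice_counit D.coaction_covers
        counit_laws distrib_right mult.assoc)
  have 2: "AA.slice_right counit (lact (AA.snd_leg e) (D.galois d b)) =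
      sA (counit e) (AA.slice_right counit (D.galois d b))" for d b
    using 1[of b "galois_inv (tAA d e)"] 
    by (simp add: D.cover_legs(2,5) slice_counit counit_laws A.scale_mult_left)
  have 3: "AA.slice_right counit (lact (AA.snd_leg e) (galois_lift s)) =
      sA (counit e) (AA.slice_right counit (galois_lift s))" for s
    by (induct s rule: AA.tensor_induct)
      (simp_all add: lift_ten lift_add multiplier_props slice_counit 2 A.scale_right_distrib)
  obtain r :: 'a where r: "r \<noteq> 0" using A.nonzero by blast
  have "sA (counit (e * b)) r = sA (counit e * counit b) r"
    using 3[of "galois_inv (tAA r b)"] by (simp add: slice_counit)
  then show ?thesis using r A.scale_cancel_right by blast
qed

text \<open>
  Products span the algebra: multiplying out the inverse image of \<open>e \<otimes> a\<close> gives \<open>\<epsilon>(e) a\<close>.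
\<close>

lemma mult_lift_surj: "\<exists>s. mult_lift s = a"
proof -
  have "\<exists>e. counit e \<noteq> 0"
  proof (rule ccontr)
    assume "\<not> ?thesis"
    then have 0: "counit = (\<lambda>_. 0)" by auto
    have "AA.slice_left counit t = 0" for t
      by (induct t rule: AA.tensor_induct) (simp_all add: slice_counit, simp add: 0)
    then have "x * y = 0" for x y :: 'a using counit_laws(1) by metis
    then show False using A.nonzero A.nondegenerate_left by blast
  qed
  then obtain e where "counit e \<noteq> 0" ..
  then have "mult_lift (right_inv (tAA (sA (inverse (counit e)) e) a)) = a"
    by (simp add: mult_inv slice_counit linear_map_scale[OF counit_linear])
  then show ?thesis ..
qed

section \<open>The antipode\<close>

lemmas slice_\<phi> = AA.slice_right_add[OF \<phi>_linear] AA.slice_right_ten[OF \<phi>_linear]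
  AA.slice_right_scale[OF \<phi>_linear] AA.slice_left_add[OF \<phi>_linear]
  AA.slice_left_ten[OF \<phi>_linear] AA.slice_left_scale[OF \<phi>_linear]

lemma \<phi>_normalized: obtains b where "\<phi> b = 1"
proof -
  obtain a where "\<phi> a \<noteq> 0" using algebraic_quantum_group.\<phi>_nonzero[OF algebraic_quantum_group] ..
  then have "\<phi> (sA (inverse (\<phi> a)) a) = 1" by (simp add: linear_map_scale[OF \<phi>_linear])
  then show ?thesis by (rule that)
qed

text \<open>
  Left invariance with the covering element on either side; the two are equivalent because both
  coverings of \<open>\<Delta>(a)\<close> can be applied at once.
\<close>

lemma left_invariance:
  "AA.slice_right \<phi> (reverse_galois a b) = sA (\<phi> a) b"
  "AA.slice_right \<phi> (D.galois b a) = sA (\<phi> a) b"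
proof -
  show 1: "AA.slice_right \<phi> (reverse_galois a b) = sA (\<phi> a) b" for a b
    using algebraic_quantum_group.\<phi>_left_invariant[OF algebraic_quantum_group, of a b]
    by (simp add: id_tensor_functional_def AA.slice_right_def reverse_galois_def)
  show "AA.slice_right \<phi> (D.galois b a) = sA (\<phi> a) b"
  proof (rule A.eq_by_right_mult)
    fix x
    show "AA.slice_right \<phi> (D.galois b a) * x = sA (\<phi> a) b * x"
      by (simp add: AA.slice_right_legs[OF \<phi>_linear, symmetric] reverse_galois_legs(1)[symmetric])
        (simp add: AA.slice_right_legs[OF \<phi>_linear] 1 A.scale_mult_left[symmetric]
          A.scale_mult_right[symmetric])
  qed
qed

text \<open>
  Invariance after multiplication by \<open>\<Delta>(z)\<close>: for \<open>s = q \<otimes> p\<close> it reads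
  \<open>q p\<^sub>1 z\<^sub>1 \<phi>(p\<^sub>2 z\<^sub>2) = q \<phi>(p z)\<close>. Read from right to left it computes slices of inverse images under
  the Galois map.
\<close>

lemma galois_lift_\<phi>:
  "AA.slice_right (\<lambda>p. \<phi> (p * z)) s = AA.slice_right \<phi> (ract (\<Delta> z) (galois_lift s))"
proof -
  note lin = A.linear_mult_functional(1)[OF \<phi>_linear, of z]
  show ?thesis
    by (induct s rule: AA.tensor_induct)
      (simp_all add: AA.slice_right_ten[OF lin] AA.slice_right_add[OF lin] lift_ten lift_add
        multiplier_props slice_\<phi> D.coaction_covers left_invariance)
qed

lemma reverse_lift_\<phi>:
  "AA.slice_left (\<lambda>p. \<phi> (z * p)) s = AA.slice_right \<phi> (lact (\<Delta> z) (reverse_lift s))"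
proof -
  note lin = A.linear_mult_functional(2)[OF \<phi>_linear, of z]
  show ?thesis
    by (induct s rule: AA.tensor_induct)
      (simp_all add: AA.slice_left_ten[OF lin] AA.slice_left_add[OF lin] lift_ten lift_add
        multiplier_props slice_\<phi> reverse_galois_legs(4) left_invariance)
qed

lemma slice_of_right_lift_surj: "\<exists>s. AA.slice_right \<phi> (right_lift s) = a"
  and slice_of_left_lift_surj: "\<exists>s. AA.slice_right \<phi> (left_lift s) = a"
proof -
  obtain b where "\<phi> b = 1" by (rule \<phi>_normalized)
  then have *: "AA.slice_right \<phi> (tAA a b) = a" by (simp add: slice_\<phi>)
  show "\<exists>s. AA.slice_right \<phi> (right_lift s) = a"
    by (rule exI[of _ "right_inv (tAA a b)"]) (simp add: *)
  show "\<exists>s. AA.slice_right \<phi> (left_lift s) = a"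
    by (rule exI[of _ "left_inv (tAA a b)"]) (simp add: *)
qed

text \<open>
  The inverse Galois map sends \<open>r \<otimes> a\<close> to \<open>r S(a\<^sub>1) \<otimes> a\<^sub>2\<close>, so the left-hand side is \<open>r S(a)\<close> for
  \<open>a = z\<^sub>1 \<phi>(z\<^sub>2 y)\<close>. It depends only on \<open>a\<close>, and the right-hand side \<open>r y\<^sub>1 \<phi>(z y\<^sub>2)\<close> shows that
  \<open>S(a)\<close> is an element of \<open>A\<close> and not just a multiplier.
\<close>

lemma galois_inv_counit:
  "AA.slice_right counit (galois_inv (tAA r (AA.slice_right \<phi> (right_lift s)))) =
    r * AA.slice_right \<phi> (left_lift s)"
proof (induct s rule: AA.tensor_induct)
  case (ten z y)
  define B where "B d = AA.slice_right \<phi> (D.right_cover d y)" for d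
  have cB: "colinear B" unfolding B_def by (rule colinear_slices[OF \<phi>_linear])
  then have B: "Vector_Spaces.linear sA sA B" by (simp add: colinear_def)
  have "counit (B d) = \<phi> (d * y)" for d
    by (simp add: B_def AA.slices_commute[OF counit_linear \<phi>_linear] counit_laws)
  then have "AA.slice_right counit (galois_inv (tAA r (B z))) =
      AA.slice_right \<phi> (ract (\<Delta> y) (tAA r z))"
    by (simp add: galois_inv_colinear[OF cB] AA.slices_map_right(2)[OF B counit_linear]
        galois_lift_\<phi>)
  then show ?case
    by (simp add: lift_ten B_def D.cover_legs(5) AA.slice_right_legs[OF \<phi>_linear])
next
  case (add s t)
  then show ?case by (simp add: lift_add slice_\<phi> AA.ten_add_right slice_counit distrib_left)
qed

text \<open>
  The same computation for the other Galois map recovers \<open>a\<close> from \<open>S(a)\<close>; hence \<open>S\<close> is injective.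
\<close>

lemma reverse_inv_counit:
  "AA.slice_left counit (reverse_inv (tAA c (AA.slice_right \<phi> (left_lift s)))) =
    AA.slice_right \<phi> (right_lift s) * c"
proof (induct s rule: AA.tensor_induct)
  case (ten y z)
  define B where "B d = AA.slice_right \<phi> (D.left_cover y d)" for d
  have cB: "colinear B" unfolding B_def by (rule colinear_slices[OF \<phi>_linear])
  then have B: "Vector_Spaces.linear sA sA B" by (simp add: colinear_def)
  have "counit (B d) = \<phi> (y * d)" for d
    by (simp add: B_def AA.slices_commute[OF counit_linear \<phi>_linear] counit_laws)
  then have "AA.slice_left counit (reverse_inv (tAA c (B z))) =
      AA.slice_right \<phi> (lact (\<Delta> y) (tAA c z))"
    by (simp add: reverse_inv_colinear[OF cB] AA.slices_map_left(2)[OF B counit_linear]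
        reverse_lift_\<phi>)
  then show ?case
    by (simp add: lift_ten B_def D.cover_legs(4) AA.slice_right_legs[OF \<phi>_linear])
next
  case (add s t)
  then show ?case by (simp add: lift_add slice_\<phi> AA.ten_add_right slice_counit distrib_right)
qed

text \<open>
  Any element \<open>b\<close> with \<open>\<phi>(b) = 1\<close> makes \<open>a\<close> the slice \<open>(\<iota> \<otimes> \<phi>)(a \<otimes> b)\<close>, and all of them
  give the same value by \<open>galois_inv_counit\<close>.
\<close>

definition antipode :: "'a \<Rightarrow> 'a"
  where "antipode a = AA.slice_right \<phi> (left_lift (right_inv (tAA a (SOME b. \<phi> b = 1))))"

lemma antipode_char: "AA.slice_right counit (galois_inv (tAA r a)) = r * antipode a"
proof -
  have "\<phi> (SOME b. \<phi> b = 1) = 1" by (rule someI_ex) (use \<phi>_normalized in blast)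
  then have "AA.slice_right \<phi> (right_lift (right_inv (tAA a (SOME b. \<phi> b = 1)))) = a"
    by (simp add: slice_\<phi>)
  then show ?thesis using galois_inv_counit unfolding antipode_def by metis
qed

lemma antipode_slice: "antipode (AA.slice_right \<phi> (right_lift s)) = AA.slice_right \<phi> (left_lift s)"
  by (rule A.eq_by_left_mult) (simp add: antipode_char[symmetric] galois_inv_counit)

lemma antipode_linear: "Vector_Spaces.linear sA sA antipode"
  by (simp add: Vector_Spaces.linear_iff A.vector_space_axioms antipode_def AA.ten_add_left
      AA.ten_scale_left lift_add lift_scale slice_\<phi>)

lemma antipode_bij: "bij antipode"
proof (rule bijI)
  have *: "AA.slice_left counit (reverse_inv (tAA c (antipode a))) = a * c" for a c
    using slice_of_right_lift_surj[of a] reverse_inv_counit by (metis antipode_slice)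
  show "inj antipode"
    by (rule injI, rule A.eq_by_right_mult) (metis *)
  show "surj antipode"
    unfolding surj_def using slice_of_left_lift_surj antipode_slice by metis
qed

text \<open>
  If \<open>\<Sum> r\<^sub>i \<otimes> a\<^sub>i\<close> is the inverse image of \<open>r \<otimes> a\<close> under the Galois map, then multiplying the inverse
  image of each \<open>r\<^sub>i \<otimes> b\<close> by \<open>1 \<otimes> a\<^sub>i\<close> on the right produces the inverse image of \<open>r \<otimes> b a\<close>.
\<close>

lemma antipode_mult: "antipode (b * a) = antipode a * antipode b"
proof (rule A.eq_by_left_mult)
  fix r
  define K where "K = tensor_lift tAA sAA sAA (\<lambda>r a. ract (AA.snd_leg a) (galois_inv (tAA r b)))"
  have K: "K (tAA r a) = ract (AA.snd_leg a) (galois_inv (tAA r b))" "K (s + t) = K s + K t" for r a s t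
    unfolding K_def
    by (rule AA.tensor_lift AA.tensor_lift_add; simp add: AA.T.vector_space_axioms
        AA.ten_add_left AA.ten_scale_left lift_add lift_scale multiplier_props bilinear_simps
        AA.T.ract_mscale AA.T.ract_scale)+
  have 1: "galois_lift (ract (AA.snd_leg a) s) = ract (\<Delta> a) (galois_lift s)" for a s
    by (induct s rule: AA.tensor_induct)
      (simp_all add: lift_ten lift_add multiplier_props D.coaction_covers)
  have 2: "galois_lift (K s) = lact (AA.snd_leg b) (galois_lift s)" for s
    by (induct s rule: AA.tensor_induct)
      (simp_all add: K 1 lift_ten lift_add multiplier_props D.cover_legs)
  have 3: "AA.slice_right counit (ract (AA.snd_leg a) s) = sA (counit a) (AA.slice_right counit s)" for a s
    by (induct s rule: AA.tensor_induct)
      (simp_all add: slice_counit multiplier_props counit_mult A.scale_right_distrib mult.commute)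
  have 4: "AA.slice_right counit (K s) = AA.slice_right counit s * antipode b" for s
    by (induct s rule: AA.tensor_induct)
      (simp_all add: K 3 slice_counit antipode_char distrib_right A.scale_mult_left)
  have "K (galois_inv (tAA r a)) = galois_inv (tAA r (b * a))"
    using 2[of "galois_inv (tAA r a)"] by (metis acts_of_alg(1) AA.mtensor_ten(1) acts(3) lift_inv(1,5))
  then show "r * antipode (b * a) = r * (antipode a * antipode b)"
    using 4[of "galois_inv (tAA r a)"] by (simp add: antipode_char mult.assoc)
qed

text \<open>
  Compute \<open>r S(a\<^sub>1) a\<^sub>2 S(a\<^sub>3) c\<close> in two ways. The tensor \<open>K\<close> below stands for
  \<open>r S(a\<^sub>1) \<otimes> a\<^sub>2 S(a\<^sub>3) c\<close>; slicing shows that it equals \<open>r S(a) \<otimes> c\<close>.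
\<close>

lemma antipode_right_char: "AA.slice_left counit (right_inv (tAA a c)) = antipode a * c"
proof (rule A.eq_by_left_mult)
  fix r
  define K where "K = tensor_lift tAA sAA sAA (\<lambda>a c. ract (AA.snd_leg c) (galois_inv (tAA r a)))"
  have K: "K (tAA a c) = ract (AA.snd_leg c) (galois_inv (tAA r a))" "K (s + t) = K s + K t" for a c s t
    unfolding K_def
    by (rule AA.tensor_lift AA.tensor_lift_add; simp add: AA.T.vector_space_axioms
        AA.ten_add_right AA.ten_scale_right lift_add lift_scale multiplier_props bilinear_simps
        AA.T.ract_mscale AA.T.ract_scale)+
  have slice: "AA.slice_right f (K s) =
      AA.slice_right counit (galois_inv (tAA r (AA.slice_right f (right_lift s))))"
    if f: "Vector_Spaces.linear sA (*) f" for f s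
  proof (induct s rule: AA.tensor_induct)
    case (ten a y)
    define B where "B d = AA.slice_right f (D.right_cover d y)" for d
    have cB: "colinear B" unfolding B_def by (rule colinear_slices[OF f])
    then have B: "Vector_Spaces.linear sA sA B" by (simp add: colinear_def)
    have "counit (B d) = f (d * y)" for d
      by (simp add: B_def AA.slices_commute[OF counit_linear f] counit_laws)
    then have "AA.slice_right counit (galois_inv (tAA r (B a))) =
        AA.slice_right f (ract (AA.snd_leg y) (galois_inv (tAA r a)))"
      by (simp add: galois_inv_colinear[OF cB] AA.slices_map_right(2)[OF B counit_linear]
          AA.slice_right_legs[OF f])
    then show ?case by (simp add: K lift_ten B_def)
  next
    case (add s t)
    then show ?case
      by (simp add: K lift_add AA.slice_right_add[OF f] AA.ten_add_right slice_counit)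
  qed
  have K1: "K (right_inv (tAA a c)) = tAA (r * antipode a) c"
  proof (rule AA.slices_right_separate)
    fix f assume f: "Vector_Spaces.linear sA (*) f"
    show "AA.slice_right f (K (right_inv (tAA a c))) = AA.slice_right f (tAA (r * antipode a) c)"
      by (simp add: slice[OF f] AA.slice_right_ten[OF f] AA.ten_scale_right lift_scale
          AA.slice_right_scale[OF counit_linear] antipode_char)
  qed
  have 1: "mult_lift (ract (AA.snd_leg c) t) = mult_lift t * c" for c t
    by (induct t rule: AA.tensor_induct)
      (simp_all add: lift_ten lift_add multiplier_props distrib_right mult.assoc)
  have "mult_lift (K s) = r * AA.slice_left counit s" for s
    by (induct s rule: AA.tensor_induct)
      (simp_all add: K lift_add 1 mult_inv slice_counit distrib_left A.scale_mult_left[symmetric]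
        A.scale_mult_right[symmetric])
  from this[of "right_inv (tAA a c)"]
  show "r * AA.slice_left counit (right_inv (tAA a c)) = r * (antipode a * c)"
    by (simp add: K1 lift_ten mult.assoc)
qed

section \<open>The right invariant functional and the modular property of \<open>\<phi>\<close>\<close>

definition \<psi> :: "'a \<Rightarrow> 'k"
  where "\<psi> a = \<phi> (antipode a)"

lemma \<psi>_linear: "Vector_Spaces.linear sA (*) \<psi>"
  unfolding \<psi>_def[abs_def] using Vector_Spaces.linear_compose[OF antipode_linear \<phi>_linear]
  by (simp add: o_def)

lemmas slice_\<psi> = AA.slice_right_add[OF \<psi>_linear] AA.slice_right_ten[OF \<psi>_linear]
  AA.slice_left_add[OF \<psi>_linear] AA.slice_left_ten[OF \<psi>_linear]

lemma \<psi>_normalized: obtains b where "\<psi> b = 1"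
proof -
  obtain b where "\<phi> b = 1" by (rule \<phi>_normalized)
  then have "\<psi> (inv antipode b) = 1"
    by (simp add: \<psi>_def surj_f_inv_f bij_is_surj antipode_bij)
  then show ?thesis by (rule that)
qed

lemma right_cover_slice_\<phi>:
  "D.right_cover (AA.slice_right \<phi> (D.right_cover z y)) c = tensor_lift tAA sAA sAA
    (\<lambda>p q. tAA (AA.slice_right \<phi> (D.right_cover z p)) q) (reverse_inv (tAA c y))"
  by (rule D.right_cover_slice[OF \<phi>_linear])
    (simp add: reverse_lift_\<phi> D.cover_legs(4) AA.slice_right_legs[OF \<phi>_linear])

text \<open>
  It suffices to take \<open>a = z\<^sub>1 \<phi>(z\<^sub>2 y)\<close>, where \<open>\<psi>(a) = \<phi>(y\<^sub>1) \<phi>(z y\<^sub>2)\<close>. Writing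
  \<open>c \<otimes> y = p\<^sub>1 q \<otimes> p\<^sub>2\<close> turns \<open>\<psi>(a\<^sub>1) a\<^sub>2 c\<close> into \<open>\<phi>(p\<^sub>1) \<phi>(z p\<^sub>2) q\<close>, and left invariance at the
  element \<open>p\<^sub>1 \<phi>(z p\<^sub>2)\<close> turns this into \<open>\<phi>(y\<^sub>1) \<phi>(z y\<^sub>2) c\<close>.
\<close>

lemma right_invariance:
  "AA.slice_left \<psi> (D.right_cover a c) = sA (\<psi> a) c"
  "AA.slice_left \<psi> (D.left_cover c a) = sA (\<psi> a) c"
proof -
  have 1: "AA.slice_left \<psi> (D.right_cover (AA.slice_right \<phi> (right_lift s)) c) =
      sA (\<psi> (AA.slice_right \<phi> (right_lift s))) c" for s c
  proof (induct s rule: AA.tensor_induct)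
    case (ten z y)
    define B where "B p = AA.slice_right \<phi> (D.left_cover z p)" for p
    have cB: "colinear B" unfolding B_def by (rule colinear_slices[OF \<phi>_linear])
    then have B: "Vector_Spaces.linear sA sA B" by (simp add: colinear_def)
    have \<psi>_slice: "\<psi> (AA.slice_right \<phi> (D.right_cover z p)) = \<phi> (B p)" for p
      using antipode_slice[of "tAA z p"] by (simp add: \<psi>_def B_def lift_ten)
    define H where "H = tensor_lift tAA sAA sAA
      (\<lambda>p q. tAA (AA.slice_right \<phi> (D.right_cover z p)) q)"
    have H: "H (tAA p q) = tAA (AA.slice_right \<phi> (D.right_cover z p)) q" "H (t + t') = H t + H t'"
      for p q t t'
      unfolding H_def
      by (rule AA.tensor_lift AA.tensor_lift_add; simp add: AA.T.vector_space_axioms D.covers_add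
          D.covers_scale slice_\<phi> AA.ten_add_left AA.ten_add_right AA.ten_scale_left
          AA.ten_scale_right)+
    have "AA.slice_left \<psi> (H s) = AA.slice_right \<phi> (AA.map_right B (reverse_lift s))" for s
      by (induct s rule: AA.tensor_induct)
        (simp_all add: H slice_\<psi> slice_\<phi> lift_ten lift_add AA.map_right[OF B] \<psi>_slice
          reverse_galois_colinear[OF cB, symmetric] left_invariance)
    then have "AA.slice_left \<psi> (D.right_cover (AA.slice_right \<phi> (D.right_cover z y)) c) =
        sA (\<phi> (B y)) c"
      by (simp add: right_cover_slice_\<phi> H_def[symmetric] AA.map_right[OF B] slice_\<phi>)
    then show ?case by (simp add: lift_ten \<psi>_slice)
  next
    case (add s t)
    then show ?case
      by (simp add: lift_add slice_\<phi> slice_\<psi> D.covers_add linear_map_add[OF \<psi>_linear]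
          A.scale_left_distrib)
  qed
  show 2: "AA.slice_left \<psi> (D.right_cover a c) = sA (\<psi> a) c" for a c
    using slice_of_right_lift_surj[of a] 1 by metis
  show "AA.slice_left \<psi> (D.left_cover c a) = sA (\<psi> a) c"
  proof (rule A.eq_by_right_mult)
    fix x
    show "AA.slice_left \<psi> (D.left_cover c a) * x = sA (\<psi> a) c * x"
      by (simp add: AA.slice_left_legs[OF \<psi>_linear, symmetric] D.cover_legs(3))
        (simp add: AA.slice_left_legs[OF \<psi>_linear] 2 A.scale_mult_left[symmetric]
          A.scale_mult_right[symmetric])
  qed
qed

lemma left_lift_\<psi>:
  "AA.slice_right (\<lambda>p. \<psi> (p * z)) s = AA.slice_left \<psi> (ract (\<Delta> z) (left_lift s))"
proof -
  note lin = A.linear_mult_functional(1)[OF \<psi>_linear, of z]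
  show ?thesis
    by (induct s rule: AA.tensor_induct)
      (simp_all add: AA.slice_right_ten[OF lin] AA.slice_right_add[OF lin] lift_ten lift_add
        multiplier_props slice_\<psi> D.coaction_covers right_invariance)
qed

lemma right_lift_\<psi>:
  "AA.slice_left (\<lambda>p. \<psi> (z * p)) s = AA.slice_left \<psi> (lact (\<Delta> z) (right_lift s))"
proof -
  note lin = A.linear_mult_functional(2)[OF \<psi>_linear, of z]
  show ?thesis
    by (induct s rule: AA.tensor_induct)
      (simp_all add: AA.slice_left_ten[OF lin] AA.slice_left_add[OF lin] lift_ten lift_add
        multiplier_props slice_\<psi> D.coaction_covers right_invariance)
qed

text \<open>
  Both sides are \<open>(\<psi> \<otimes> \<phi>)(t \<Delta>(z))\<close> for the common value \<open>t\<close>. In the form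
  \<open>t = (1 \<otimes> q)\<Delta>(p)\<close> the functional \<open>\<psi>\<close> is applied first, in the form \<open>t = (q \<otimes> 1)\<Delta>(p)\<close> the
  functional \<open>\<phi>\<close>.
\<close>

lemma \<phi>_\<psi>_left_exchange:
  assumes "left_lift s = galois_lift s'"
  shows "\<psi> (AA.slice_left \<phi> s * z) = \<phi> (AA.slice_left \<psi> s' * z)"
proof -
  have "\<psi> (AA.slice_left \<phi> s * z) = \<phi> (AA.slice_left \<psi> (ract (\<Delta> z) (left_lift s)))"
    using AA.slices_commute[OF \<phi>_linear A.linear_mult_functional(1)[OF \<psi>_linear], of z s]
    by (simp add: left_lift_\<psi>)
  also have "\<dots> = \<psi> (AA.slice_right \<phi> (ract (\<Delta> z) (galois_lift s')))"
    using AA.slices_commute[OF \<psi>_linear \<phi>_linear] assms by simp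
  also have "\<dots> = \<phi> (AA.slice_left \<psi> s' * z)"
    using AA.slices_commute[OF \<psi>_linear A.linear_mult_functional(1)[OF \<phi>_linear], of z s']
    by (simp add: galois_lift_\<phi>)
  finally show ?thesis .
qed

lemma left_\<psi>_is_left_\<phi>: "\<exists>p'. \<forall>z. \<psi> (p * z) = \<phi> (p' * z)"
proof -
  obtain q where "\<phi> q = 1" by (rule \<phi>_normalized)
  then have "AA.slice_left \<phi> (tAA q p) = p" by (simp add: slice_\<phi>)
  then show ?thesis
    using \<phi>_\<psi>_left_exchange[of "tAA q p" "galois_inv (left_lift (tAA q p))"] by auto
qed

lemma left_\<phi>_is_left_\<psi>: "\<exists>p'. \<forall>z. \<phi> (p * z) = \<psi> (p' * z)"
proof -
  obtain q where "\<psi> q = 1" by (rule \<psi>_normalized)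
  then have "AA.slice_left \<psi> (tAA q p) = p" by (simp add: slice_\<psi>)
  then show ?thesis
    using \<phi>_\<psi>_left_exchange[of "left_inv (galois_lift (tAA q p))" "tAA q p", symmetric]
    by auto
qed

text \<open>
  The counterpart for \<open>\<psi>\<close> of the formula \<open>S(a\<^sub>1 \<phi>(a\<^sub>2 b)) = b\<^sub>1 \<phi>(a b\<^sub>2)\<close>, namely
  \<open>S(\<psi>(b z\<^sub>1) z\<^sub>2) = \<psi>(b\<^sub>1 z) b\<^sub>2\<close>.
\<close>

lemma antipode_slice_\<psi>:
  "antipode (AA.slice_left \<psi> (D.galois b z)) = AA.slice_left \<psi> (reverse_galois b z)"
proof (rule A.eq_by_right_mult)
  fix c
  define C where "C a = AA.slice_left \<psi> (D.galois b a)" for a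
  have C: "Vector_Spaces.linear sA sA C"
    by (simp add: Vector_Spaces.linear_iff A.vector_space_axioms D.covers_add D.covers_scale
        slice_\<psi> AA.slice_left_scale[OF \<psi>_linear] C_def)
  have 1: "counit (C d) = \<psi> (b * d)" for d
    by (simp add: C_def AA.slices_commute[OF \<psi>_linear counit_linear, symmetric] counit_laws)
  have "antipode (C z) * c = AA.slice_left counit (right_inv (tAA (C z) c))"
    by (simp add: antipode_right_char)
  also have "\<dots> = AA.slice_left counit (AA.map_left C (right_inv (tAA z c)))"
    using right_inv_left_slice[OF \<psi>_linear, of b] by (simp add: C_def[abs_def])
  also have "\<dots> = AA.slice_left \<psi> (lact (\<Delta> b) (tAA z c))"
    by (simp add: AA.slices_map_left(2)[OF C counit_linear] 1 right_lift_\<psi>)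
  also have "\<dots> = AA.slice_left \<psi> (reverse_galois b z) * c"
    by (simp add: reverse_galois_legs(5) AA.slice_left_legs[OF \<psi>_linear])
  finally show "antipode (AA.slice_left \<psi> (D.galois b z)) * c =
      AA.slice_left \<psi> (reverse_galois b z) * c"
    by (simp add: C_def)
qed

text \<open>
  The functional \<open>z \<mapsto> \<psi>(b z\<^sub>1) \<phi>(z\<^sub>2 y)\<close> links the two sides. Taking the slice by \<open>\<phi>\<close> first, the
  formula for the antipode of that slice yields \<open>\<phi>(y\<^sub>1 S(b)) \<phi>(z y\<^sub>2)\<close>.
\<close>

lemma mixed_functional_is_right_\<phi>:
  "\<psi> (b * AA.slice_right \<phi> (D.right_cover z y)) =
    \<phi> (z * AA.slice_left \<phi> (reverse_lift (tAA y (antipode b))))"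
proof -
  have "\<psi> (b * AA.slice_right \<phi> (D.right_cover z y)) =
      \<phi> (AA.slice_right \<phi> (ract (AA.fst_leg (antipode b)) (D.left_cover z y)))"
    using antipode_slice[of "tAA z y"]
    by (simp add: \<psi>_def antipode_mult lift_ten AA.slice_right_legs[OF \<phi>_linear])
  also have "\<dots> = \<phi> (AA.slice_right (\<lambda>b. \<phi> (z * b)) (reverse_galois y (antipode b)))"
    by (simp add: reverse_galois_legs(3)[symmetric] AA.slice_right_legs[OF \<phi>_linear])
  finally show ?thesis
    by (simp add: lift_ten AA.slices_commute[OF \<phi>_linear A.linear_mult_functional(2)[OF \<phi>_linear]])
qed

text \<open>
  Taking the slice by \<open>\<psi>\<close> first, it becomes \<open>\<phi>\<close> of a product; written as
  \<open>\<phi> \<circ> S\<^sup>-\<^sup>1\<close> of the reversed product, it is \<open>\<psi>(b\<^sub>1 z) \<phi>(S\<^sup>-\<^sup>1(S(y) b\<^sub>2))\<close>.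
\<close>

abbreviation "\<phi>_inv \<equiv> (\<lambda>a. \<phi> (inv antipode a))"

lemma \<phi>_inv_linear: "Vector_Spaces.linear sA (*) \<phi>_inv"
  using Vector_Spaces.linear_compose[OF linear_inv[OF antipode_linear antipode_bij] \<phi>_linear]
  by (simp add: o_def)

lemma mixed_functional_is_left_\<psi>:
  "\<psi> (b * AA.slice_right \<phi> (D.right_cover z y)) =
    \<psi> (AA.slice_right \<phi>_inv (left_lift (tAA (antipode y) b)) * z)"
proof -
  have "\<psi> (b * AA.slice_right \<phi> (D.right_cover z y)) =
      \<psi> (AA.slice_right (\<lambda>d. \<phi> (d * y)) (D.galois b z))"
    by (simp add: AA.slice_right_legs[OF \<phi>_linear, symmetric] D.cover_legs(1))
  also have "\<dots> = \<phi> (AA.slice_left \<psi> (D.galois b z) * y)"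
    by (simp add: AA.slices_commute[OF \<psi>_linear A.linear_mult_functional(1)[OF \<phi>_linear]])
  also have "\<dots> = \<phi>_inv (antipode y * AA.slice_left \<psi> (reverse_galois b z))"
    by (simp add: antipode_slice_\<psi>[symmetric] antipode_mult[symmetric] inv_f_f
        bij_is_inj[OF antipode_bij])
  also have "\<dots> = \<phi>_inv (AA.slice_left (\<lambda>d. \<psi> (d * z)) (D.left_cover (antipode y) b))"
    by (simp add: AA.slice_left_legs[OF \<psi>_linear, symmetric] reverse_galois_legs(3))
  also have "\<dots> = \<psi> (AA.slice_right \<phi>_inv (D.left_cover (antipode y) b) * z)"
    by (simp add: AA.slices_commute[OF A.linear_mult_functional(1)[OF \<psi>_linear] \<phi>_inv_linear])
  finally show ?thesis by (simp add: lift_ten)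
qed

lemma antipode_inv: "antipode (inv antipode a) = a"
  by (simp add: surj_f_inv_f bij_is_surj antipode_bij)

text \<open>
  Since \<open>S\<close> is onto and the Galois maps are bijective, the elements that occur in the two descriptions
  of the mixed functionals exhaust \<open>A\<close>. Hence these functionals span all \<open>\<phi>(\<cdot> e)\<close> and all
  \<open>\<psi>(p \<cdot>)\<close>.
\<close>

lemma right_\<phi>_is_left_\<psi>: "\<exists>p. \<forall>z. \<phi> (z * e) = \<psi> (p * z)"
proof -
  obtain q where "\<phi> q = 1" by (rule \<phi>_normalized)
  then have e: "AA.slice_left \<phi> (reverse_lift (reverse_inv (tAA q e))) = e" by (simp add: slice_\<phi>)
  have "\<exists>p. \<forall>z. \<phi> (z * AA.slice_left \<phi> (reverse_lift s)) = \<psi> (p * z)" for s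
  proof (induct s rule: AA.tensor_induct)
    case (ten y b)
    show ?case
      using mixed_functional_is_right_\<phi>[of "inv antipode b" _ y] mixed_functional_is_left_\<psi>
      by (metis antipode_inv)
  next
    case (add s t)
    then obtain p p' where p: "\<And>z. \<phi> (z * AA.slice_left \<phi> (reverse_lift s)) = \<psi> (p * z)"
      "\<And>z. \<phi> (z * AA.slice_left \<phi> (reverse_lift t)) = \<psi> (p' * z)" by blast
    have "\<phi> (z * AA.slice_left \<phi> (reverse_lift (s + t))) = \<psi> ((p + p') * z)" for z
      by (simp add: lift_add slice_\<phi> distrib_left distrib_right linear_map_add[OF \<phi>_linear]
          linear_map_add[OF \<psi>_linear] p)
    then show ?case by blast
  qed
  from this[of "reverse_inv (tAA q e)"] show ?thesis unfolding e .
qed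

lemma left_\<psi>_is_right_\<phi>: "\<exists>e. \<forall>z. \<psi> (p * z) = \<phi> (z * e)"
proof -
  obtain q where "\<phi> q = 1" by (rule \<phi>_normalized)
  then have "\<phi>_inv (antipode q) = 1" by (simp add: inv_f_f bij_is_inj[OF antipode_bij])
  then have p: "AA.slice_right \<phi>_inv (left_lift (left_inv (tAA p (antipode q)))) = p"
    by (simp add: AA.slice_right_ten[OF \<phi>_inv_linear])
  have "\<exists>e. \<forall>z. \<psi> (AA.slice_right \<phi>_inv (left_lift s) * z) = \<phi> (z * e)" for s
  proof (induct s rule: AA.tensor_induct)
    case (ten y b)
    show ?case
      using mixed_functional_is_left_\<psi>[of b _ "inv antipode y"] mixed_functional_is_right_\<phi>
      by (metis antipode_inv)
  next
    case (add s t)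
    then obtain e e' where e: "\<And>z. \<psi> (AA.slice_right \<phi>_inv (left_lift s) * z) = \<phi> (z * e)"
      "\<And>z. \<psi> (AA.slice_right \<phi>_inv (left_lift t) * z) = \<phi> (z * e')" by blast
    have "\<psi> (AA.slice_right \<phi>_inv (left_lift (s + t)) * z) = \<phi> (z * (e + e'))" for z
      by (simp add: lift_add AA.slice_right_add[OF \<phi>_inv_linear] distrib_left distrib_right
          linear_map_add[OF \<phi>_linear] linear_map_add[OF \<psi>_linear] e)
    then show ?case by blast
  qed
  from this[of "left_inv (tAA p (antipode q))"] show ?thesis unfolding p .
qed

theorem \<phi>_left_is_right: "\<exists>b'. \<forall>z. \<phi> (b * z) = \<phi> (z * b')"
  using left_\<phi>_is_left_\<psi>[of b] left_\<psi>_is_right_\<phi> by metis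

theorem \<phi>_right_is_left: "\<exists>b'. \<forall>z. \<phi> (z * b) = \<phi> (b' * z)"
  using right_\<phi>_is_left_\<psi>[of b] left_\<psi>_is_left_\<phi> by metis

section \<open>Faithfulness of \<open>\<phi>\<close>\<close>

definition null_elements :: "'a set"
  where "null_elements = {n. \<forall>z. \<phi> (n * z) = 0}"

text \<open>
  By the modular property the elements that \<open>\<phi>\<close> annihilates from the left and from the right are the
  same, so they form a two-sided ideal.
\<close>

lemma null_elements_iff: "n \<in> null_elements \<longleftrightarrow> (\<forall>z. \<phi> (z * n) = 0)"
proof -
  have "\<phi> (z * n) = 0" if n: "\<And>z. \<phi> (n * z) = 0" for z
  proof -
    obtain z' where "\<And>x. \<phi> (z * x) = \<phi> (x * z')" using \<phi>_left_is_right[of z] by blast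
    then show ?thesis using n by simp
  qed
  moreover have "\<phi> (n * z) = 0" if n: "\<And>z. \<phi> (z * n) = 0" for z
  proof -
    obtain z' where "\<And>x. \<phi> (x * z) = \<phi> (z' * x)" using \<phi>_right_is_left[of z] by blast
    then show ?thesis using n by simp
  qed
  ultimately show ?thesis by (auto simp: null_elements_def)
qed

lemma null_elements_mult: "n \<in> null_elements \<Longrightarrow> a * n \<in> null_elements"
  unfolding null_elements_iff by (simp add: mult.assoc[symmetric])

lemma null_elements_sum:
  assumes "finite F" "\<And>b. b \<in> F \<Longrightarrow> h b \<in> null_elements" shows "(\<Sum>b\<in>F. h b) \<in> null_elements"
  using assms by (induct F)
    (simp_all add: null_elements_def distrib_right linear_map_add[OF \<phi>_linear] linear_map_zero[OF \<phi>_linear])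

lemma tensor_null_expansion:
  assumes "\<And>z. AA.slice_right (\<lambda>a. \<phi> (a * z)) t = 0"
  obtains F g where "finite F" "t = (\<Sum>b\<in>F. tAA b (g b))" "\<And>b. b \<in> F \<Longrightarrow> g b \<in> null_elements"
proof (rule AA.annihilated_tensor_expansion[of "{\<lambda>a. \<phi> (a * z) |z. True}" t])
  show "Vector_Spaces.linear sA (*) \<theta>" if "\<theta> \<in> {\<lambda>a. \<phi> (a * z) |z. True}" for \<theta>
    using that A.linear_mult_functional(1)[OF \<phi>_linear] by auto
  show "AA.slice_right \<theta> t = 0" if "\<theta> \<in> {\<lambda>a. \<phi> (a * z) |z. True}" for \<theta>
    using that assms by auto
  fix F g
  assume "finite F" "t = (\<Sum>b\<in>F. tAA b (g b))"
    and "\<And>b \<theta>. b \<in> F \<Longrightarrow> \<theta> \<in> {\<lambda>a. \<phi> (a * z) |z. True} \<Longrightarrow> \<theta> (g b) = 0"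
  then show thesis by (intro that[of F g]) (auto simp: null_elements_def)
qed

lemma slice_null:
  assumes "n \<in> null_elements" shows "AA.slice_right (\<lambda>b. \<phi> (n * b)) t = 0"
proof -
  have "(\<lambda>b. \<phi> (n * b)) = (\<lambda>_. 0)" using assms by (auto simp: null_elements_def)
  then show ?thesis by (simp add: AA.slice_right_zero)
qed

text \<open>
  For a null element \<open>n\<close> the inverse image of \<open>r \<otimes> n\<close> under the Galois map has null second legs;
  multiplying it out shows that \<open>\<epsilon>(n) r\<close> is null. If \<open>\<epsilon>(n)\<close> were not zero, \<open>\<phi>\<close> would vanish on
  all products.
\<close>

lemma counit_null:
  assumes n: "n \<in> null_elements" shows "counit n = 0"
proof (rule ccontr)
  assume c: "counit n \<noteq> 0"
  have "r \<in> null_elements" for r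
  proof -
    have "AA.slice_right (\<lambda>a. \<phi> (a * z)) (galois_inv (tAA r n)) = 0" for z
      by (simp add: galois_lift_\<phi> D.cover_legs(2,5) AA.slice_right_legs(3)[OF \<phi>_linear]
          slice_null[OF n])
    then obtain F g where F: "finite F" "galois_inv (tAA r n) = (\<Sum>b\<in>F. tAA b (g b))"
      "\<And>b. b \<in> F \<Longrightarrow> g b \<in> null_elements"
      by (rule tensor_null_expansion) blast
    have "mult_lift (\<Sum>b\<in>G. tAA b (g b)) = (\<Sum>b\<in>G. b * g b)" if "finite G" for G
      using that by (induct G) (simp_all add: lift_add lift_ten linear_map_zero[OF lift_linear(5)])
    then have "mult_lift (galois_inv (tAA r n)) = (\<Sum>b\<in>F. b * g b)" using F by simp
    then have "sA (counit n) r = (\<Sum>b\<in>F. b * g b)" by (simp add: mult_inv slice_counit)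
    then have "sA (counit n) r \<in> null_elements"
      using F(1,3) null_elements_sum[of F "\<lambda>b. b * g b"] null_elements_mult by simp
    then show "r \<in> null_elements"
      using c by (simp add: null_elements_def A.scale_mult_left[symmetric] linear_map_scale[OF \<phi>_linear])
  qed
  then have "\<phi> (mult_lift s) = 0" for s
    by (induct s rule: AA.tensor_induct)
      (simp_all add: lift_ten lift_add linear_map_add[OF \<phi>_linear] null_elements_def)
  then show False
    using mult_lift_surj algebraic_quantum_group.\<phi>_nonzero[OF algebraic_quantum_group] by metis
qed

text \<open>
  The injectivity of \<open>S\<close> makes the slices \<open>n\<^sub>1 \<phi>(n\<^sub>2 y)\<close> vanish, so \<open>(b \<otimes> 1)\<Delta>(n)\<close> has null second
  legs. The counit kills these, and \<open>(\<iota> \<otimes> \<epsilon>)((b \<otimes> 1)\<Delta>(n)) = b n\<close>.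
\<close>

lemma null_elements_zero:
  assumes n: "n \<in> null_elements" shows "n = 0"
proof (rule A.nondegenerate_right)
  fix b
  have P: "AA.slice_right \<phi> (D.right_cover n y) = 0" for y
  proof -
    have "AA.slice_right \<phi> (D.left_cover n y) = 0"
    proof (rule A.nondegenerate_right)
      fix u
      show "u * AA.slice_right \<phi> (D.left_cover n y) = 0"
        by (simp add: AA.slice_right_legs(1)[OF \<phi>_linear, symmetric] D.cover_legs(2))
          (simp add: AA.slice_right_legs(3)[OF \<phi>_linear] slice_null[OF n])
    qed
    then have "antipode (AA.slice_right \<phi> (D.right_cover n y)) = antipode 0"
      using antipode_slice[of "tAA n y"] by (simp add: lift_ten linear_map_zero[OF antipode_linear])
    then show ?thesis using injD[OF bij_is_inj[OF antipode_bij]] by blast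
  qed
  have "AA.slice_right (\<lambda>a. \<phi> (a * y)) (D.galois b n) = 0" for y
    by (simp add: AA.slice_right_legs(4)[OF \<phi>_linear, symmetric] D.cover_legs(1))
      (simp add: AA.slice_right_legs(1)[OF \<phi>_linear] P)
  then obtain F g where F: "finite F" "D.galois b n = (\<Sum>b\<in>F. tAA b (g b))"
    "\<And>b. b \<in> F \<Longrightarrow> g b \<in> null_elements"
    by (rule tensor_null_expansion) blast
  have "AA.slice_right counit (\<Sum>b\<in>G. tAA b (g b)) = (\<Sum>b\<in>G. sA (counit (g b)) b)"
    if "finite G" for G
    using that by (induct G)
      (simp_all add: slice_counit linear_map_zero[OF AA.slice_right_linear[OF counit_linear]])
  then have "AA.slice_right counit (D.galois b n) = 0" using F by (simp add: counit_null)
  then show "b * n = 0" by (simp add: counit_laws)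
qed

theorem \<phi>_faithful:
  "(\<And>z. \<phi> (n * z) = 0) \<Longrightarrow> n = 0" "(\<And>z. \<phi> (z * n) = 0) \<Longrightarrow> n = 0"
  using null_elements_zero null_elements_iff unfolding null_elements_def by blast+

end

section \<open>Galois objects\<close>

locale quantum_galois_object =
  quantum_group sA sAA tAA sAAA tAAL tAAR \<Delta> \<phi> +
  X: k_algebra sX + XA: tensor_of_algebras sX sA sXA tXA + XX: tensor_product sX sX sXX tXX
  for sA :: "'k::field \<Rightarrow> 'a::ring \<Rightarrow> 'a"
    and sAA :: "'k \<Rightarrow> 'aa::ring \<Rightarrow> 'aa" and tAA :: "'a \<Rightarrow> 'a \<Rightarrow> 'aa"
    and sAAA :: "'k \<Rightarrow> 'aaa::ring \<Rightarrow> 'aaa"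
    and tAAL :: "'aa \<Rightarrow> 'a \<Rightarrow> 'aaa" and tAAR :: "'a \<Rightarrow> 'aa \<Rightarrow> 'aaa"
    and \<Delta> :: "'a \<Rightarrow> 'aa multiplier" and \<phi> :: "'a \<Rightarrow> 'k"
    and sX :: "'k \<Rightarrow> 'x::ring \<Rightarrow> 'x"
    and sXA :: "'k \<Rightarrow> 'xa::ring \<Rightarrow> 'xa" and tXA :: "'x \<Rightarrow> 'a \<Rightarrow> 'xa"
    and sXAA :: "'k \<Rightarrow> 'xaa::ring \<Rightarrow> 'xaa"
    and tXAL :: "'xa \<Rightarrow> 'a \<Rightarrow> 'xaa" and tXAR :: "'x \<Rightarrow> 'aa \<Rightarrow> 'xaa"
    and \<alpha> :: "'x \<Rightarrow> 'xa multiplier"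
    and sXX :: "'k \<Rightarrow> 'xx::ab_group_add \<Rightarrow> 'xx" and tXX :: "'x \<Rightarrow> 'x \<Rightarrow> 'xx"
    and \<phi>X :: "'x \<Rightarrow> 'k" +
  assumes galois_object:
      "galois_object sA sAA tAA sAAA tAAL tAAR \<Delta> sX sXA tXA sXAA tXAL tXAR \<alpha> sXX tXX"
    and \<phi>X_linear: "Vector_Spaces.linear sX (*) \<phi>X"
    and \<phi>X_slice: "slice_value tXA sXA sX \<phi> (\<alpha> x) (mscalar sX (\<phi>X x))"
begin

lemma right_coaction: "right_coaction sA sAA tAA sAAA tAAL tAAR \<Delta> sX sXA tXA sXAA tXAL tXAR \<alpha>"
  using galois_object by (simp add: galois_object_def)

lemma triple_X: "triple_algebra_tensor sX sA sA sXA sAA sXAA tXA tAA tXAL tXAR"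
  using right_coaction by (simp add: right_coaction_def)

lemma galois_covered: "XA.fst_leg y * \<alpha> x \<in> range of_alg"
  using galois_object.reduced[OF galois_object]
  unfolding right_coaction.reduced_def[OF right_coaction] by blast

sublocale C: covered_coaction sA sAA tAA \<Delta> sX sXA tXA sXAA tXAL tXAR \<alpha>
proof -
  interpret t: triple_algebra_tensor sX sA sA sXA sAA sXAA tXA tAA tXAL tXAR by (rule triple_X)
  interpret XA_A: tensor_of_algebras sXA sA sXAA tXAL
    by (intro tensor_of_algebras.intro A.k_algebra_axioms XA.T.k_algebra_axioms
        t.XY_Z.algebra_tensor_axioms)
  interpret X_AA: tensor_of_algebras sX sAA sXAA tXAR
    by (intro tensor_of_algebras.intro X.k_algebra_axioms AA.T.k_algebra_axioms
        t.X_YZ.algebra_tensor_axioms)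
  show "covered_coaction sA sAA tAA \<Delta> sX sXA tXA sXAA tXAL tXAR \<alpha>"
    by unfold_locales (use t.associator \<Delta>_hom \<Delta>_covered D.coproduct_span galois_covered
        right_coaction.\<alpha>_hom[OF right_coaction] right_coaction.\<alpha>_covered[OF right_coaction]
        right_coaction.\<alpha>_coassociative[OF right_coaction] in simp_all)
qed

lemma coaction_coproduct_covers [simp]:
  "C.coproduct_right_cover = D.right_cover" "C.coproduct_left_cover = D.left_cover"
  by (simp_all add: fun_eq_iff C.coproduct_right_cover_def C.coproduct_left_cover_def
      D.right_cover_def D.left_cover_def)

lemmas slice_\<phi>_X = XA.slice_right_add[OF \<phi>_linear] XA.slice_right_ten[OF \<phi>_linear]
  XA.slice_right_scale[OF \<phi>_linear]

lemma \<phi>X_galois: "XA.slice_right \<phi> (C.galois y x) = sX (\<phi>X x) y"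
proof -
  have "ract (mscalar sX (\<phi>X x)) y = id_tensor_functional tXA sXA sX \<phi> (to_alg (XA.fst_leg y * \<alpha> x))"
    using \<phi>X_slice unfolding slice_value_def by blast
  then show ?thesis by (simp add: id_tensor_functional_def XA.slice_right_def C.galois_def)
qed

definition "X_galois_lift = tensor_lift tXX sXX sXA C.galois"

lemma X_galois_lift: "X_galois_lift (tXX x y) = C.galois x y"
  "X_galois_lift (s + t) = X_galois_lift s + X_galois_lift t"
  unfolding X_galois_lift_def
  by (rule XX.tensor_lift XX.tensor_lift_add; simp add: XA.T.vector_space_axioms C.covers_add
      C.covers_scale)+

text \<open>
  The elements \<open>(x \<otimes> 1)\<alpha>(y)\<close> span \<open>X \<otimes> A\<close>.
\<close>

lemma X_galois_induct [consumes 0, case_names galois add]: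
  assumes "\<And>x y. P (C.galois x y)" "\<And>s t. P s \<Longrightarrow> P t \<Longrightarrow> P (s + t)"
  shows "P t"
proof -
  have "bij X_galois_lift"
    unfolding X_galois_lift_def
    by (rule XX.bij_lift_of_bij_betw[OF _ _ _ _ _ _ galois_object.galois_map_bij[OF galois_object]])
      (simp_all add: XA.T.k_algebra_axioms C.covers_add C.covers_scale C.of_alg_covers)
  then obtain s where "t = X_galois_lift s" by (metis bij_pointE)
  moreover have "P (X_galois_lift s)" for s
    by (induct s rule: XX.tensor_induct) (simp_all add: X_galois_lift assms)
  ultimately show ?thesis by simp
qed

text \<open>
  The action \<open>x \<mapsto> x\<^sub>0 \<phi>(x\<^sub>1 c)\<close> on \<open>X\<close> of the functional \<open>\<phi>(\<cdot> c)\<close>.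
\<close>

definition act :: "'a \<Rightarrow> 'x \<Rightarrow> 'x"
  where "act c x = XA.slice_right \<phi> (C.right_cover x c)"

lemma act_add: "act (c + c') x = act c x + act c' x" "act c (x + x') = act c x + act c x'"
  and act_scale: "act (sA k c) x = sX k (act c x)" "act c (sX k x) = sX k (act c x)"
  by (simp_all add: act_def C.covers_add C.covers_scale slice_\<phi>_X)

lemma mult_act: "u * act c x = XA.slice_right (\<lambda>a. \<phi> (a * c)) (C.galois u x)"
  by (simp add: act_def XA.slice_right_legs[OF \<phi>_linear, symmetric] C.cover_legs(1)[symmetric])

text \<open>
  For the second and third part, \<open>y z\<^sub>0 \<phi>(b z\<^sub>1)\<close> is brought into the form \<open>y z\<^sub>0 \<phi>(z\<^sub>1 b')\<close> by the
  modular property of \<open>\<phi>\<close>.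
\<close>

lemma slice_coaction_ten:
  "XA.slice_right \<phi> (lact (\<alpha> z) (tXA y b)) = act b z * y"
  "\<exists>b'. \<forall>y z. XA.slice_right \<phi> (ract (\<alpha> z) (tXA y b)) = y * act b' z"
  "\<exists>b'. \<forall>y z. y * act b z = XA.slice_right \<phi> (ract (\<alpha> z) (tXA y b'))"
proof -
  show "XA.slice_right \<phi> (lact (\<alpha> z) (tXA y b)) = act b z * y"
    by (simp add: act_def C.cover_legs(4) XA.slice_right_legs[OF \<phi>_linear])
  have *: "XA.slice_right \<phi> (ract (\<alpha> z) (tXA y b)) = XA.slice_right (\<lambda>a. \<phi> (b * a)) (C.galois y z)"
    for y z b by (simp add: C.cover_legs(2,5) XA.slice_right_legs(3)[OF \<phi>_linear])
  show "\<exists>b'. \<forall>y z. XA.slice_right \<phi> (ract (\<alpha> z) (tXA y b)) = y * act b' z"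
    using \<phi>_left_is_right[of b] by (auto simp: * mult_act)
  show "\<exists>b'. \<forall>y z. y * act b z = XA.slice_right \<phi> (ract (\<alpha> z) (tXA y b'))"
    using \<phi>_right_is_left[of b] by (auto simp: * mult_act)
qed

text \<open>
  Slice the expansion of \<open>x \<otimes> b\<close> in elements \<open>(u \<otimes> 1)\<alpha>(y)\<close> by \<open>\<phi>(\<cdot> c)\<close>, with \<open>\<phi>(b c) = 1\<close>.
\<close>

lemma mult_act_induct [consumes 0, case_names mult add]:
  assumes mult: "\<And>u c y. P (u * act c y)" and add: "\<And>x y. P x \<Longrightarrow> P y \<Longrightarrow> P (x + y)"
  shows "P x"
proof -
  obtain b where b: "\<phi> b = 1" by (rule \<phi>_normalized)
  then have "b \<noteq> 0" using linear_map_zero[OF \<phi>_linear] by auto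
  then obtain c where "\<phi> (b * c) \<noteq> 0" using \<phi>_faithful(1) by blast
  define c' where "c' = sA (inverse (\<phi> (b * c))) c"
  have c: "\<phi> (b * c') = 1"
    using \<open>\<phi> (b * c) \<noteq> 0\<close>
    by (simp add: c'_def A.scale_mult_right[symmetric] linear_map_scale[OF \<phi>_linear])
  note lin = A.linear_mult_functional(1)[OF \<phi>_linear, of c']
  have "P (XA.slice_right (\<lambda>a. \<phi> (a * c')) t)" for t
    by (induct t rule: X_galois_induct)
      (simp_all add: mult_act[symmetric] mult add XA.slice_right_add[OF lin])
  from this[of "tXA x b"] show ?thesis
    using c by (simp add: XA.slice_right_ten[OF lin])
qed

definition "act_lift y = tensor_lift tAA sAA sXA (\<lambda>p q. tXA (act p y) q)"

definition "cover_act_lift y = tensor_lift tAA sAA sXA (\<lambda>e c. C.right_cover (act c y) e)"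

lemma act_lift: "act_lift y (tAA p q) = tXA (act p y) q"
  "act_lift y (s + t) = act_lift y s + act_lift y t"
  unfolding act_lift_def
  by (rule AA.tensor_lift AA.tensor_lift_add; simp add: XA.T.vector_space_axioms act_add act_scale
      XA.ten_add_left XA.ten_add_right XA.ten_scale_left XA.ten_scale_right)+

lemma cover_act_lift: "cover_act_lift y (tAA e c) = C.right_cover (act c y) e"
  "cover_act_lift y (s + t) = cover_act_lift y s + cover_act_lift y t"
  unfolding cover_act_lift_def
  by (rule AA.tensor_lift AA.tensor_lift_add; simp add: XA.T.vector_space_axioms act_add act_scale
      C.covers_add C.covers_scale)+

text \<open>
  Every \<open>act c y \<otimes> e\<close> is a sum of \<open>\<alpha>(x)(1 \<otimes> a)\<close>, explicitly of the \<open>\<alpha>(act c\<^sub>2 y)(1 \<otimes> c\<^sub>1 e)\<close>.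
\<close>

lemma cover_act_lift_reverse: "cover_act_lift y (reverse_galois c e) = tXA (act c y) e"
proof -
  have "C.right_cover (act c y) e = act_lift y (reverse_inv (tAA e c))" for c e
    unfolding act_def[abs_def] act_lift_def
    by (rule C.right_cover_slice[OF \<phi>_linear])
      (simp add: reverse_lift_\<phi> D.cover_legs(4) AA.slice_right_legs[OF \<phi>_linear])
  then have "cover_act_lift y t = act_lift y (reverse_inv t)" for t
    by (induct t rule: AA.tensor_induct) (simp_all add: cover_act_lift act_lift lift_add)
  from this[of "reverse_lift (tAA c e)"] show ?thesis
    unfolding lift_inv(7) by (simp add: lift_ten act_lift)
qed

text \<open>
  The map \<open>z \<otimes> a \<mapsto> \<alpha>(z)(1 \<otimes> c\<^sub>1 \<phi>(a c\<^sub>2))\<close>; with the antipode, \<open>c\<^sub>1 \<phi>(a c\<^sub>2)\<close> is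
  \<open>S(a\<^sub>1) \<phi>(a\<^sub>2 c)\<close>.
\<close>

definition "cover_slice c =
  tensor_lift tXA sXA sXA (\<lambda>z a. C.right_cover z (AA.slice_right \<phi> (D.left_cover a c)))"

lemma cover_slice:
  "cover_slice c (tXA z a) = C.right_cover z (AA.slice_right \<phi> (D.left_cover a c))"
  "cover_slice c (s + t) = cover_slice c s + cover_slice c t"
  unfolding cover_slice_def
  by (rule XA.tensor_lift XA.tensor_lift_add; simp add: XA.T.vector_space_axioms C.covers_add
      C.covers_scale D.covers_add D.covers_scale slice_\<phi>)+

text \<open>
  The elements \<open>\<alpha>(x)(w \<otimes> 1)\<close> with \<open>w = act c y\<close> belong to \<open>X \<otimes> A\<close>. Expand \<open>w \<otimes> e\<close> by
  \<open>cover_act_lift_reverse\<close>; then \<open>\<alpha>(x) \<alpha>(act c\<^sub>2 y) = \<alpha>(x act c\<^sub>2 y)\<close>, and \<open>x act c\<^sub>2 y\<close> is the slice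
  of \<open>x y\<^sub>0 \<otimes> y\<^sub>1\<close> by \<open>\<phi>(\<cdot> c\<^sub>2)\<close>.
\<close>

lemma of_alg_cover_slice:
  "of_alg (cover_slice c (C.galois x y)) = \<alpha> x * XA.fst_leg (act c y)"
proof (rule XA.multiplier_eq_by_snd_leg)
  fix e
  define N where "N w = tensor_lift tAA sAA sXA
    (\<lambda>e c. C.right_cover (XA.slice_right \<phi> (ract (XA.snd_leg c) w)) e)" for w
  have snd_leg: "ract (XA.snd_leg (p + p')) w = ract (XA.snd_leg p) w + ract (XA.snd_leg p') w"
    "ract (XA.snd_leg (sA k p)) w = sXA k (ract (XA.snd_leg p) w)" for p p' w k
    by (simp_all add: C.bilinear_simps XA.T.ract_mscale)
  have N: "N w (tAA e c) = C.right_cover (XA.slice_right \<phi> (ract (XA.snd_leg c) w)) e"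
    "N w (s + t) = N w s + N w t" for w e c s t
    unfolding N_def
    by (rule AA.tensor_lift AA.tensor_lift_add; simp add: XA.T.vector_space_axioms snd_leg
        slice_\<phi>_X C.covers_add C.covers_scale)+
  have N_add: "N (w + w') t = N w t + N w' t" for w w' t
    by (induct t rule: AA.tensor_induct)
      (simp_all add: N multiplier_props slice_\<phi>_X C.covers_add)
  have N_ten: "N (tXA z a) t = C.right_cover z (AA.slice_right (\<lambda>c. \<phi> (a * c)) t)" for z a t
  proof -
    note lin = A.linear_mult_functional(2)[OF \<phi>_linear, of a]
    show ?thesis
      by (induct t rule: AA.tensor_induct)
        (simp_all add: N slice_\<phi>_X AA.slice_right_ten[OF lin] AA.slice_right_add[OF lin]
          C.covers_add C.covers_scale)
  qed
  have cover_mult: "C.right_cover z (b * e) = ract (XA.snd_leg e) (C.right_cover z b)" for z b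
    by (simp add: XA.T.of_alg_inject[symmetric] mult_of_alg[symmetric] C.of_alg_covers mult.assoc
        XA.mtensor_mult of_alg_mult)
  have slice: "AA.slice_right (\<lambda>d. \<phi> (a * d)) (reverse_galois c e) =
      AA.slice_right \<phi> (D.left_cover a c) * e" for a
    by (simp add: AA.slice_right_legs(3)[OF \<phi>_linear, symmetric] reverse_galois_legs(3))
      (simp add: AA.slice_right_legs[OF \<phi>_linear])
  have 1: "N w (reverse_galois c e) = ract (XA.snd_leg e) (cover_slice c w)" for w
    by (induct w rule: XA.tensor_induct)
      (simp_all add: N_add N_ten cover_slice multiplier_props cover_mult slice)
  have 2: "N (C.galois x y) t = lact (\<alpha> x) (cover_act_lift y t)" for t
    by (induct t rule: AA.tensor_induct)
      (simp_all add: N cover_act_lift multiplier_props C.coaction_covers mult_act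
        XA.slice_right_legs(4)[OF \<phi>_linear])
  have "ract (XA.snd_leg e) (cover_slice c (C.galois x y)) = lact (\<alpha> x) (tXA (act c y) e)"
    using 1[of "C.galois x y"] 2[of "reverse_galois c e"] by (simp add: cover_act_lift_reverse)
  then have "of_alg (cover_slice c (C.galois x y)) * XA.snd_leg e = \<alpha> x * of_alg (tXA (act c y) e)"
    by (simp add: mult_of_alg)
  then show "of_alg (cover_slice c (C.galois x y)) * XA.snd_leg e =
      \<alpha> x * XA.fst_leg (act c y) * XA.snd_leg e"
    by (simp add: XA.legs_mult mult.assoc)
qed

text \<open>
  This is \<open>z\<^sub>0 x\<^sub>0 w \<phi>(z\<^sub>1 x\<^sub>1) = \<phi>\<^sub>X(z x) w\<close> for \<open>w = act c y\<close>.
\<close>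

lemma slice_cover_slice:
  "XA.slice_right \<phi> (lact (\<alpha> z) (cover_slice c (C.galois x y))) = sX (\<phi>X (z * x)) (act c y)"
proof (rule X.eq_by_left_mult)
  fix u
  have "lact (XA.fst_leg u) (lact (\<alpha> z) (cover_slice c (C.galois x y))) =
      ract (XA.fst_leg (act c y)) (C.galois u (z * x))"
    by (simp add: XA.T.of_alg_inject[symmetric] mult_of_alg[symmetric] of_alg_cover_slice
        C.of_alg_covers C.hom_simps mult.assoc)
  then have "u * XA.slice_right \<phi> (lact (\<alpha> z) (cover_slice c (C.galois x y))) =
      XA.slice_right \<phi> (C.galois u (z * x)) * act c y"
    by (simp add: XA.slice_right_legs[OF \<phi>_linear, symmetric])
  then show "u * XA.slice_right \<phi> (lact (\<alpha> z) (cover_slice c (C.galois x y))) =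
      u * sX (\<phi>X (z * x)) (act c y)"
    by (simp add: \<phi>X_galois X.scale_mult_left[symmetric] X.scale_mult_right[symmetric])
qed

definition right_representable :: "('x \<Rightarrow> 'k) \<Rightarrow> bool"
  where "right_representable f \<longleftrightarrow> (\<exists>p. \<forall>z. f z = \<phi>X (z * p))"

definition left_representable :: "('x \<Rightarrow> 'k) \<Rightarrow> bool"
  where "left_representable f \<longleftrightarrow> (\<exists>p. \<forall>z. f z = \<phi>X (p * z))"

lemma representable_add:
  "right_representable f \<Longrightarrow> right_representable g \<Longrightarrow> right_representable (\<lambda>z. f z + g z)"
  "left_representable f \<Longrightarrow> left_representable g \<Longrightarrow> left_representable (\<lambda>z. f z + g z)"
  unfolding right_representable_def left_representable_def
  by (metis distrib_left linear_map_add[OF \<phi>X_linear], metis distrib_right linear_map_add[OF \<phi>X_linear])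

lemma representable_scale:
  "right_representable (\<lambda>z. \<phi>X (z * p) * k)" "left_representable (\<lambda>z. \<phi>X (p * z) * k)"
  unfolding right_representable_def left_representable_def
  by (rule exI[of _ "sX k p"], simp add: X.scale_mult_left[symmetric] X.scale_mult_right[symmetric]
      linear_map_scale[OF \<phi>X_linear] mult.commute)+

text \<open>
  By \<open>slice_cover_slice\<close> the elements \<open>\<alpha>(p)(act c y \<otimes> 1)\<close> give functionals \<open>\<phi>\<^sub>X(\<cdot> p)\<close>. The map
  \<open>cover_slice\<close> and the bijectivity of the Galois map show that they span all \<open>\<alpha>(x)(1 \<otimes> b)\<close>, because
  the elements \<open>c\<^sub>1 \<phi>(a c\<^sub>2)\<close> span \<open>A\<close>.
\<close>

lemma right_representable_slice_cover:
  assumes \<omega>: "Vector_Spaces.linear sX (*) \<omega>"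
  shows "right_representable (\<lambda>z. \<omega> (XA.slice_right \<phi> (lact (\<alpha> z) (C.right_cover x b))))"
proof -
  have 1: "right_representable (\<lambda>z. \<omega> (XA.slice_right \<phi> (lact (\<alpha> z) (cover_slice c t))))" for c t
    by (induct t rule: X_galois_induct)
      (simp_all add: slice_cover_slice linear_map_scale[OF \<omega>] representable_scale cover_slice
        multiplier_props slice_\<phi>_X linear_map_add[OF \<omega>] representable_add)
  have 2: "right_representable (\<lambda>z. \<omega> (XA.slice_right \<phi> (lact (\<alpha> z)
      (C.right_cover x (AA.slice_right \<phi> (left_lift s))))))" for s
  proof (induct s rule: AA.tensor_induct)
    case (ten a c)
    show ?case using 1[of c "tXA x a"] by (simp add: cover_slice lift_ten)
  next
    case (add s t)
    from representable_add(1)[OF this] show ?case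
      by (simp add: lift_add slice_\<phi> C.covers_add multiplier_props slice_\<phi>_X linear_map_add[OF \<omega>])
  qed
  obtain s where "AA.slice_right \<phi> (left_lift s) = b" using slice_of_left_lift_surj by blast
  with 2[of s] show ?thesis by simp
qed

lemma right_representable_act:
  assumes \<omega>: "Vector_Spaces.linear sX (*) \<omega>"
  shows "right_representable (\<lambda>z. \<omega> (act b z * act c y))"
proof -
  have "right_representable (\<lambda>z. \<omega> (XA.slice_right \<phi> (lact (\<alpha> z) (cover_act_lift y t))))" for t
  proof (induct t rule: AA.tensor_induct)
    case (ten e c)
    show ?case by (simp add: cover_act_lift right_representable_slice_cover[OF \<omega>])
  next
    case (add s t)
    from representable_add(1)[OF this] show ?case
      by (simp add: cover_act_lift multiplier_props slice_\<phi>_X linear_map_add[OF \<omega>])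
  qed
  from this[of "reverse_galois c b"] show ?thesis
    by (simp add: cover_act_lift_reverse slice_coaction_ten(1))
qed

lemma mult_act_normalized:
  obtains \<omega> u c y where "Vector_Spaces.linear sX (*) \<omega>" "\<omega> (u * act c y) = 1"
proof -
  have "\<exists>u c y. u * act c y \<noteq> 0"
  proof (rule ccontr)
    assume "\<not> ?thesis"
    then have 0: "u * act c y = 0" for u c y by blast
    have "x = 0" for x :: 'x by (induct x rule: mult_act_induct) (simp_all add: 0)
    then show False using X.nonzero by blast
  qed
  then show ?thesis
    using separating_functional[OF X.vector_space_axioms] that by metis
qed

text \<open>
  Fix \<open>w = act c y\<close> and \<open>u\<close> with \<open>\<omega>(u w) = 1\<close>. Then \<open>\<phi>\<^sub>X(p z)\<close> is \<open>\<omega>\<close> of \<open>\<phi>\<^sub>X(p z) u w\<close>, which is a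
  sum of terms \<open>v z\<^sub>0 \<phi>(z\<^sub>1 b) w\<close> by the expansion of \<open>(u \<otimes> 1)\<alpha>(p)\<close>, and these are of the form
  \<open>\<phi>\<^sub>X(z p')\<close> because of \<open>w\<close>.
\<close>

lemma left_is_right_representable: "right_representable (\<lambda>z. \<phi>X (p * z))"
proof -
  obtain \<omega> u c y where \<omega>: "Vector_Spaces.linear sX (*) \<omega>" "\<omega> (u * act c y) = 1"
    by (rule mult_act_normalized)
  have "right_representable (\<lambda>z. \<omega> (XA.slice_right \<phi> (ract (\<alpha> z) t) * act c y))" for t
  proof (induct t rule: XA.tensor_induct)
    case (ten v b)
    obtain b' where b': "\<And>y z. XA.slice_right \<phi> (ract (\<alpha> z) (tXA y b)) = y * act b' z"
      using slice_coaction_ten(2) by blast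
    show ?case
      using right_representable_act[OF X.linear_mult_functional(2)[OF \<omega>(1)], of v b' c y]
      by (simp add: b' mult.assoc)
  next
    case (add s t)
    from representable_add(1)[OF this] show ?case
      by (simp add: multiplier_props slice_\<phi>_X distrib_right linear_map_add[OF \<omega>(1)])
  qed
  from this[of "C.galois u p"] show ?thesis
    by (simp add: C.coaction_covers \<phi>X_galois X.scale_mult_left[symmetric] linear_map_scale[OF \<omega>(1)] \<omega>(2))
qed

text \<open>
  The mirror image: \<open>\<phi>\<^sub>X(z p)\<close> is \<open>\<omega>\<close> of \<open>\<phi>\<^sub>X(z p) u w\<close>, which is now expanded through
  \<open>\<alpha>(p)(w \<otimes> 1)\<close> into terms \<open>u z\<^sub>0 \<phi>(z\<^sub>1 b) v\<close>; these are of the form \<open>\<phi>\<^sub>X(p' z)\<close> because of \<open>u\<close>.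
\<close>

lemma right_is_left_representable: "left_representable (\<lambda>z. \<phi>X (z * p))"
proof -
  obtain \<omega> u c y where \<omega>: "Vector_Spaces.linear sX (*) \<omega>" "\<omega> (u * act c y) = 1"
    by (rule mult_act_normalized)
  have 1: "left_representable (\<lambda>z. \<omega> (XA.slice_right \<phi> (ract (\<alpha> z) t) * v))" for t v
  proof (induct t rule: X_galois_induct)
    case (galois q r)
    show ?case
      by (simp add: C.coaction_covers \<phi>X_galois X.scale_mult_left[symmetric]
          linear_map_scale[OF \<omega>(1)] representable_scale)
  next
    case (add s t)
    from representable_add(2)[OF this] show ?case
      by (simp add: multiplier_props slice_\<phi>_X distrib_right linear_map_add[OF \<omega>(1)])
  qed
  have "left_representable (\<lambda>z. \<omega> (u * XA.slice_right \<phi> (lact (\<alpha> z) t)))" for t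
  proof (induct t rule: XA.tensor_induct)
    case (ten v b)
    obtain b' where b': "\<And>y z. y * act b z = XA.slice_right \<phi> (ract (\<alpha> z) (tXA y b'))"
      using slice_coaction_ten(3) by blast
    show ?case
      using 1[of "tXA u b'" v] by (simp add: slice_coaction_ten(1) b'[symmetric] mult.assoc)
  next
    case (add s t)
    from representable_add(2)[OF this] show ?case
      by (simp add: multiplier_props slice_\<phi>_X distrib_left linear_map_add[OF \<omega>(1)])
  qed
  from this[of "cover_slice c (C.galois p y)"] show ?thesis
    by (simp add: slice_cover_slice X.scale_mult_right[symmetric] linear_map_scale[OF \<omega>(1)] \<omega>(2))
qed

text \<open>
  If \<open>\<phi>\<^sub>X(p x) = 0\<close> for all \<open>p\<close>, then all \<open>y x\<^sub>0 \<phi>(b x\<^sub>1)\<close> vanish by the expansion of \<open>y \<otimes> b\<close>. As \<open>\<phi>\<close>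
  is faithful, \<open>\<alpha>(x) = 0\<close>, and \<open>\<alpha>\<close> is injective.
\<close>

lemma \<phi>X_faithful_left:
  assumes 0: "\<And>p. \<phi>X (p * x) = 0" shows "x = 0"
proof -
  have 1: "XA.slice_right \<phi> (ract (\<alpha> x) t) = 0" for t
    by (induct t rule: X_galois_induct)
      (simp_all add: C.coaction_covers \<phi>X_galois 0 multiplier_props slice_\<phi>_X)
  have "ract (\<alpha> x) t = 0" for t
  proof (rule XA.slices_left_separate, rule A.eq_by_left_mult)
    fix \<omega> b assume \<omega>: "Vector_Spaces.linear sX (*) \<omega>"
    have "b * XA.slice_left \<omega> (ract (\<alpha> x) t) = 0"
    proof (rule \<phi>_faithful(2))
      fix a
      have "\<phi> (a * (b * XA.slice_left \<omega> (ract (\<alpha> x) t))) =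
          \<phi> (XA.slice_left \<omega> (lact (XA.snd_leg (a * b)) (ract (\<alpha> x) t)))"
        by (simp add: XA.slice_left_legs[OF \<omega>] mult.assoc)
      also have "\<dots> = \<omega> (XA.slice_right \<phi> (lact (XA.snd_leg (a * b)) (ract (\<alpha> x) t)))"
        by (simp add: XA.slices_commute[OF \<omega> \<phi>_linear])
      also have "\<dots> = 0"
        by (simp add: XA.T.lact_ract_commute 1 linear_map_zero[OF \<omega>])
      finally show "\<phi> (a * (b * XA.slice_left \<omega> (ract (\<alpha> x) t))) = 0" .
    qed
    then show "b * XA.slice_left \<omega> (ract (\<alpha> x) t) = b * XA.slice_left \<omega> 0"
      by (simp add: linear_map_zero[OF XA.slice_left_linear[OF \<omega>]])
  qed
  then have "\<alpha> x = \<alpha> 0"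
    using additive_zero[of \<alpha>] by (intro XA.T.multiplier_eq_by_ract) (simp add: C.hom_simps)
  then show ?thesis using right_coaction.\<alpha>_inj[OF right_coaction] by (simp add: inj_eq)
qed

lemma \<phi>X_faithful_right:
  assumes 0: "\<And>p. \<phi>X (x * p) = 0" shows "x = 0"
proof (rule \<phi>X_faithful_left)
  fix p
  obtain p' where "\<And>z. \<phi>X (p * z) = \<phi>X (z * p')"
    using left_is_right_representable[of p] unfolding right_representable_def by blast
  then show "\<phi>X (p * x) = 0" by (simp add: 0)
qed

lemma \<phi>X_eqI: "(\<And>y. \<phi>X (y * a) = \<phi>X (y * b)) \<Longrightarrow> a = b"
proof -
  assume *: "\<And>y. \<phi>X (y * a) = \<phi>X (y * b)"
  have "\<phi>X (y * (a - b)) = 0" for y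
    using linear_map_add[OF \<phi>X_linear, of "y * (a - b)" "y * b"] * by (simp add: algebra_simps)
  then show "a = b" using \<phi>X_faithful_left[of "a - b"] by simp
qed

section \<open>The modular automorphism of a Galois object\<close>

definition \<sigma>X :: "'x \<Rightarrow> 'x"
  where "\<sigma>X x = (THE x'. \<forall>y. \<phi>X (x * y) = \<phi>X (y * x'))"

lemma \<sigma>X: "\<phi>X (y * \<sigma>X x) = \<phi>X (x * y)"
proof -
  have "\<exists>!x'. \<forall>y. \<phi>X (x * y) = \<phi>X (y * x')"
  proof (rule ex_ex1I)
    show "\<exists>x'. \<forall>y. \<phi>X (x * y) = \<phi>X (y * x')"
      using left_is_right_representable[of x] by (simp add: right_representable_def)
    show "a = b" if "\<forall>y. \<phi>X (x * y) = \<phi>X (y * a)" "\<forall>y. \<phi>X (x * y) = \<phi>X (y * b)" for a b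
      by (rule \<phi>X_eqI) (use that in simp)
  qed
  from theI'[OF this, THEN spec, of y, symmetric] show ?thesis unfolding \<sigma>X_def .
qed

lemma \<sigma>X_mult: "\<sigma>X (x * y) = \<sigma>X x * \<sigma>X y"
proof (rule \<phi>X_eqI)
  fix z
  have "\<phi>X (z * \<sigma>X (x * y)) = \<phi>X (x * (y * z))" by (simp add: \<sigma>X mult.assoc)
  also have "\<dots> = \<phi>X (y * (z * \<sigma>X x))"
    unfolding \<sigma>X[of "y * z" x, symmetric] by (simp add: mult.assoc)
  also have "\<dots> = \<phi>X (z * (\<sigma>X x * \<sigma>X y))"
    unfolding \<sigma>X[of "z * \<sigma>X x" y, symmetric] by (simp add: mult.assoc)
  finally show "\<phi>X (z * \<sigma>X (x * y)) = \<phi>X (z * (\<sigma>X x * \<sigma>X y))" .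
qed

lemma \<sigma>X_automorphism: "algebra_automorphism sX \<sigma>X"
proof -
  have "\<sigma>X (x + y) = \<sigma>X x + \<sigma>X y" "\<sigma>X (sX c x) = sX c (\<sigma>X x)" for x y c
    by (rule \<phi>X_eqI; simp add: \<sigma>X distrib_left distrib_right linear_map_add[OF \<phi>X_linear]
        linear_map_scale[OF \<phi>X_linear] X.scale_mult_left[symmetric] X.scale_mult_right[symmetric])+
  then have "algebra_hom sX sX \<sigma>X"
    by (simp add: algebra_hom_def Vector_Spaces.linear_iff X.vector_space_axioms \<sigma>X_mult)
  moreover have "inj \<sigma>X"
  proof (rule injI)
    fix x y assume "\<sigma>X x = \<sigma>X y"
    then have *: "\<phi>X (x * z) = \<phi>X (y * z)" for z by (metis \<sigma>X)
    have "\<phi>X ((x - y) * z) = 0" for z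
      using linear_map_add[OF \<phi>X_linear, of "(x - y) * z" "y * z"] * by (simp add: algebra_simps)
    then show "x = y" using \<phi>X_faithful_right[of "x - y"] by simp
  qed
  moreover have "\<exists>x. y = \<sigma>X x" for y
  proof -
    obtain x where "\<And>z. \<phi>X (z * y) = \<phi>X (x * z)"
      using right_is_left_representable[of y] unfolding left_representable_def by blast
    then have "y = \<sigma>X x" by (intro \<phi>X_eqI) (simp add: \<sigma>X)
    then show ?thesis ..
  qed
  ultimately show ?thesis by (simp add: algebra_automorphism_def bij_def surj_def)
qed

lemma \<phi>X_\<sigma>X: "\<phi>X (\<sigma>X x) = \<phi>X x"
proof (induct x rule: mult_act_induct)
  case (mult u c y)
  show ?case by (simp add: \<sigma>X_mult) (metis \<sigma>X)
next
  case (add x y)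
  have "\<sigma>X (x + y) = \<sigma>X x + \<sigma>X y"
    using \<sigma>X_automorphism
    by (simp add: algebra_automorphism_def algebra_hom_def Vector_Spaces.linear_iff)
  with add show ?case by (simp add: linear_map_add[OF \<phi>X_linear])
qed

end

theorem proposition2p11:
  fixes sA :: "'k::field \<Rightarrow> 'a::ring \<Rightarrow> 'a"
    and sAA :: "'k \<Rightarrow> 'aa::ring \<Rightarrow> 'aa" and tAA :: "'a \<Rightarrow> 'a \<Rightarrow> 'aa"
    and sAAA :: "'k \<Rightarrow> 'aaa::ring \<Rightarrow> 'aaa"
    and tAAL :: "'aa \<Rightarrow> 'a \<Rightarrow> 'aaa" and tAAR :: "'a \<Rightarrow> 'aa \<Rightarrow> 'aaa"
    and \<Delta> :: "'a \<Rightarrow> 'aa multiplier" and \<phi> :: "'a \<Rightarrow> 'k"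
    and sX :: "'k \<Rightarrow> 'x::ring \<Rightarrow> 'x"
    and sXA :: "'k \<Rightarrow> 'xa::ring \<Rightarrow> 'xa" and tXA :: "'x \<Rightarrow> 'a \<Rightarrow> 'xa"
    and sXAA :: "'k \<Rightarrow> 'xaa::ring \<Rightarrow> 'xaa"
    and tXAL :: "'xa \<Rightarrow> 'a \<Rightarrow> 'xaa" and tXAR :: "'x \<Rightarrow> 'aa \<Rightarrow> 'xaa"
    and \<alpha> :: "'x \<Rightarrow> 'xa multiplier"
    and sXX :: "'k \<Rightarrow> 'xx::ab_group_add \<Rightarrow> 'xx" and tXX :: "'x \<Rightarrow> 'x \<Rightarrow> 'xx"
    and \<phi>X :: "'x \<Rightarrow> 'k"
  assumes "algebraic_quantum_group sA sAA tAA sAAA tAAL tAAR \<Delta> \<phi>"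
    and "galois_object sA sAA tAA sAAA tAAL tAAR \<Delta> sX sXA tXA sXAA tXAL tXAR \<alpha> sXX tXX"
    and "Vector_Spaces.linear sX (*) \<phi>X"
    and "\<And>x. slice_value tXA sXA sX \<phi> (\<alpha> x) (mscalar sX (\<phi>X x))"
  shows "\<exists>\<sigma>X. algebra_automorphism sX \<sigma>X \<and>
           (\<forall>x y. \<phi>X (y * \<sigma>X x) = \<phi>X (x * y)) \<and>
           \<phi>X \<circ> \<sigma>X = \<phi>X"
proof -
  interpret Q: algebraic_quantum_group sA sAA tAA sAAA tAAL tAAR \<Delta> \<phi> by fact
  interpret G: galois_object sA sAA tAA sAAA tAAL tAAR \<Delta> sX sXA tXA sXAA tXAL tXAR \<alpha> sXX tXX
    by fact
  interpret quantum_galois_object sA sAA tAA sAAA tAAL tAAR \<Delta> \<phi> sX sXA tXA sXAA tXAL tXAR \<alpha> sXX tXX \<phi>X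
    by (intro quantum_galois_object.intro quantum_group.intro quantum_group_axioms.intro
        quantum_galois_object_axioms.intro tensor_of_algebras.intro Q.A.k_algebra_axioms
        G.X.k_algebra_axioms Q.AAA.XY.algebra_tensor_axioms G.XAA.XY.algebra_tensor_axioms
        G.XX.tensor_product_axioms assms)
  show ?thesis
  proof (intro exI[of _ \<sigma>X] conjI allI)
    show "algebra_automorphism sX \<sigma>X" by (rule \<sigma>X_automorphism)
    show "\<phi>X (y * \<sigma>X x) = \<phi>X (x * y)" for x y by (rule \<sigma>X)
    show "\<phi>X \<circ> \<sigma>X = \<phi>X" by (simp add: fun_eq_iff \<phi>X_\<sigma>X)
  qed
qed

end
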